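(* Let $R$ be a commutative Noetherian ring with $1$ and $I$ a proper ideal of $R$. If $N$ is a weakly Laskerian $R$-module of dimension $d$, then $\mathrm{Supp}_R H^d_I(N)$ is finite. Consequently, $H^d_I(N)$ is weakly Laskerian. In particular, $H^d_I(N)$ is $I$-weakly cofinite.
   Context: An $R$-module $W$ is weakly Laskerian if $\mathrm{Ass}_R(W/U)$ is finite for every $R$-submodule $U$ of $W$. An $R$-module $W$ is $I$-weakly cofinite if $\mathrm{Supp}_R W\subset V(I)=\{P\in\mathrm{Spec}\,R\mid I\subset P\}$ and $\mathrm{Ext}^i_R(R/I,W)$ is weakly Laskerian for all $i\ge 0$. $H^i_I(N)$ denotes ordinary local cohomology. The dimension of a (not necessarily finitely generated) module is the Krull dimension of its support. *)

theory Defs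
  imports
    "HOL-Library.Extended_Real"
    "HOL-Algebra.Ideal_Product"
    "HOL-Algebra.Ring_Divisibility"
    "HOL-Algebra.Module"
begin

text \<open>
  Modules over a commutative ring are those of \<^theory>\<open>HOL-Algebra.Module\<close>. Their records extend
  ring records; the fields \<open>mult\<close> and \<open>one\<close> play no role in a module and are left undefined in the
  modules constructed below.
\<close>

section \<open>Homomorphisms and quotients\<close>

definition mod_hom ::
  "('r, 'b) ring_scheme \<Rightarrow> ('r, 'm, 'c) module_scheme \<Rightarrow> ('r, 'n, 'd) module_scheme \<Rightarrow> ('m \<Rightarrow> 'n) set"
  where "mod_hom R M N = {f \<in> carrier M \<rightarrow> carrier N.
    (\<forall>x \<in> carrier M. \<forall>y \<in> carrier M. f (x \<oplus>\<^bsub>M\<^esub> y) = f x \<oplus>\<^bsub>N\<^esub> f y) \<and>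
    (\<forall>a \<in> carrier R. \<forall>x \<in> carrier M. f (a \<odot>\<^bsub>M\<^esub> x) = a \<odot>\<^bsub>N\<^esub> f x)}"

text \<open>The elements of the Hom module are made extensional, so that homomorphisms which agree on
  \<open>carrier M\<close> are equal.\<close>

definition Hom_module ::
  "('r, 'b) ring_scheme \<Rightarrow> ('r, 'm, 'c) module_scheme \<Rightarrow> ('r, 'n, 'd) module_scheme
    \<Rightarrow> ('r, 'm \<Rightarrow> 'n) module"
  where "Hom_module R M N =
    \<lparr>carrier = mod_hom R M N \<inter> extensional (carrier M),
     monoid.mult = undefined, one = undefined,
     zero = (\<lambda>x \<in> carrier M. \<zero>\<^bsub>N\<^esub>),
     add = (\<lambda>f g. \<lambda>x \<in> carrier M. f x \<oplus>\<^bsub>N\<^esub> g x),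
     smult = (\<lambda>a f. \<lambda>x \<in> carrier M. a \<odot>\<^bsub>N\<^esub> f x)\<rparr>"

definition quot_module :: "('r, 'm, 'c) module_scheme \<Rightarrow> 'm set \<Rightarrow> ('r, 'm set) module"
  where "quot_module M U =
    \<lparr>carrier = a_rcosets\<^bsub>M\<^esub> U,
     monoid.mult = undefined, one = undefined,
     zero = U,
     add = set_add M,
     smult = (\<lambda>a A. \<Union>x \<in> A. U +>\<^bsub>M\<^esub> (a \<odot>\<^bsub>M\<^esub> x))\<rparr>"

definition regular_module :: "('r, 'b) ring_scheme \<Rightarrow> ('r, 'r) module"
  where "regular_module R =
    \<lparr>carrier = carrier R, monoid.mult = undefined, one = undefined,
     zero = \<zero>\<^bsub>R\<^esub>, add = (\<oplus>\<^bsub>R\<^esub>), smult = (\<otimes>\<^bsub>R\<^esub>)\<rparr>"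

section \<open>Spectrum, support, dimension, associated primes\<close>

definition Spec :: "('r, 'b) ring_scheme \<Rightarrow> 'r set set"
  where "Spec R = {P. primeideal P R}"

definition V_set :: "('r, 'b) ring_scheme \<Rightarrow> 'r set \<Rightarrow> 'r set set"
  where "V_set R I = {P \<in> Spec R. I \<subseteq> P}"

text \<open>The pairs \<open>(x, s)\<close> and \<open>(y, t)\<close> are related iff the fractions \<open>x/s\<close> and \<open>y/t\<close> are equal in the
  localization of \<open>M\<close> at the multiplicative set \<open>S\<close>. Only the carrier and the zero of the localized
  module are needed.\<close>

definition frac_rel ::
  "('r, 'm, 'c) module_scheme \<Rightarrow> 'r set \<Rightarrow> (('m \<times> 'r) \<times> ('m \<times> 'r)) set"
  where "frac_rel M S = {((x, s), (y, t)). x \<in> carrier M \<and> s \<in> S \<and> y \<in> carrier M \<and> t \<in> S \<and>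
    (\<exists>u \<in> S. u \<odot>\<^bsub>M\<^esub> (t \<odot>\<^bsub>M\<^esub> x) = u \<odot>\<^bsub>M\<^esub> (s \<odot>\<^bsub>M\<^esub> y))}"

definition localization_carrier :: "('r, 'm, 'c) module_scheme \<Rightarrow> 'r set \<Rightarrow> ('m \<times> 'r) set set"
  where "localization_carrier M S = (carrier M \<times> S) // frac_rel M S"

definition localization_zero ::
  "('r, 'b) ring_scheme \<Rightarrow> ('r, 'm, 'c) module_scheme \<Rightarrow> 'r set \<Rightarrow> ('m \<times> 'r) set"
  where "localization_zero R M S = frac_rel M S `` {(\<zero>\<^bsub>M\<^esub>, \<one>\<^bsub>R\<^esub>)}"

definition Supp :: "('r, 'b) ring_scheme \<Rightarrow> ('r, 'm, 'c) module_scheme \<Rightarrow> 'r set set"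
  where "Supp R M = {P \<in> Spec R.
    localization_carrier M (carrier R - P) \<noteq> {localization_zero R M (carrier R - P)}}"

text \<open>The supremum of the lengths \<open>n\<close> of chains \<open>P\<^sub>0 \<subset> \<dots> \<subset> P\<^sub>n\<close> of primes in the support. The zero module
  has dimension \<open>-\<infinity>\<close>.\<close>

definition module_dim :: "('r, 'b) ring_scheme \<Rightarrow> ('r, 'm, 'c) module_scheme \<Rightarrow> ereal"
  where "module_dim R M = Sup {ereal (real n) | n.
    \<exists>P :: nat \<Rightarrow> 'r set. (\<forall>i \<le> n. P i \<in> Supp R M) \<and> (\<forall>i < n. P i \<subset> P (Suc i))}"

definition Ass :: "('r, 'b) ring_scheme \<Rightarrow> ('r, 'm, 'c) module_scheme \<Rightarrow> 'r set set"
  where "Ass R M = {P \<in> Spec R. \<exists>x \<in> carrier M. P = {a \<in> carrier R. a \<odot>\<^bsub>M\<^esub> x = \<zero>\<^bsub>M\<^esub>}}"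

definition weakly_Laskerian :: "('r, 'b) ring_scheme \<Rightarrow> ('r, 'm, 'c) module_scheme \<Rightarrow> bool"
  where "weakly_Laskerian R W \<longleftrightarrow> module R W \<and>
    (\<forall>U. submodule U R W \<longrightarrow> finite (Ass R (quot_module W U)))"

section \<open>Cohomology and Ext\<close>

definition mod_ker :: "('r, 'm, 'c) module_scheme \<Rightarrow> ('r, 'n, 'd) module_scheme \<Rightarrow> ('m \<Rightarrow> 'n) \<Rightarrow> 'm set"
  where "mod_ker M N f = {x \<in> carrier M. f x = \<zero>\<^bsub>N\<^esub>}"

text \<open>For a cochain complex \<open>C 0 \<rightarrow> C 1 \<rightarrow> \<dots>\<close> with differentials \<open>\<delta> i : C i \<rightarrow> C (i + 1)\<close>.\<close>

definition coboundaries ::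
  "(nat \<Rightarrow> ('r, 'm, 'c) module_scheme) \<Rightarrow> (nat \<Rightarrow> 'm \<Rightarrow> 'm) \<Rightarrow> nat \<Rightarrow> 'm set"
  where "coboundaries C \<delta> i = (case i of 0 \<Rightarrow> {\<zero>\<^bsub>C 0\<^esub>} | Suc j \<Rightarrow> \<delta> j ` carrier (C j))"

definition cohomology ::
  "(nat \<Rightarrow> ('r, 'm, 'c) module_scheme) \<Rightarrow> (nat \<Rightarrow> 'm \<Rightarrow> 'm) \<Rightarrow> nat \<Rightarrow> ('r, 'm set) module"
  where "cohomology C \<delta> i =
    quot_module ((C i)\<lparr>carrier := mod_ker (C i) (C (Suc i)) (\<delta> i)\<rparr>) (coboundaries C \<delta> i)"

definition free_module :: "('r, 'b) ring_scheme \<Rightarrow> ('r, 'm, 'c) module_scheme \<Rightarrow> bool"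
  where "free_module R F \<longleftrightarrow> module R F \<and> (\<exists>B \<subseteq> carrier F. \<forall>x \<in> carrier F.
    \<exists>!c. (\<forall>b \<in> B. c b \<in> carrier R) \<and> (\<forall>b. b \<notin> B \<longrightarrow> c b = \<zero>\<^bsub>R\<^esub>) \<and> finite {b. c b \<noteq> \<zero>\<^bsub>R\<^esub>} \<and>
         x = (\<Oplus>\<^bsub>F\<^esub> b \<in> {b. c b \<noteq> \<zero>\<^bsub>R\<^esub>}. c b \<odot>\<^bsub>F\<^esub> b))"

text \<open>\<open>\<dots> \<rightarrow> F 1 \<rightarrow> F 0 \<rightarrow> M \<rightarrow> 0\<close> is exact, with \<open>D i : F (i + 1) \<rightarrow> F i\<close> and \<open>\<eta> : F 0 \<rightarrow> M\<close>.\<close>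

definition free_resolution ::
  "('r, 'b) ring_scheme \<Rightarrow> ('r, 'm, 'c) module_scheme \<Rightarrow> (nat \<Rightarrow> ('r, 'f, 'd) module_scheme)
    \<Rightarrow> (nat \<Rightarrow> 'f \<Rightarrow> 'f) \<Rightarrow> ('f \<Rightarrow> 'm) \<Rightarrow> bool"
  where "free_resolution R M F D \<eta> \<longleftrightarrow>
    (\<forall>i. free_module R (F i)) \<and>
    \<eta> \<in> mod_hom R (F 0) M \<and> \<eta> ` carrier (F 0) = carrier M \<and>
    (\<forall>i. D i \<in> mod_hom R (F (Suc i)) (F i)) \<and>
    mod_ker (F 0) M \<eta> = D 0 ` carrier (F 1) \<and>
    (\<forall>i. mod_ker (F (Suc i)) (F i) (D i) = D (Suc i) ` carrier (F (Suc (Suc i))))"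

text \<open>For a free resolution \<open>(F, D)\<close> of a module \<open>M\<close>, this is the \<open>i\<close>-th Ext module of \<open>(M, W)\<close>.\<close>

definition Ext ::
  "('r, 'b) ring_scheme \<Rightarrow> (nat \<Rightarrow> ('r, 'f, 'd) module_scheme) \<Rightarrow> (nat \<Rightarrow> 'f \<Rightarrow> 'f)
    \<Rightarrow> ('r, 'w, 'c) module_scheme \<Rightarrow> nat \<Rightarrow> ('r, ('f \<Rightarrow> 'w) set) module"
  where "Ext R F D W i =
    cohomology (\<lambda>j. Hom_module R (F j) W) (\<lambda>j f. compose (carrier (F (Suc j))) f (D j)) i"

text \<open>
  The Ext modules of \<open>(R/I, W)\<close> are computed by any free resolution of \<open>R/I\<close>. Such resolutions do
  exist on the carrier type used here: if \<open>R\<close> is Noetherian, \<open>R/I\<close> is resolved by modules \<open>R\<^sup>n\<close>, which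
  embed into the functions from \<^typ>\<open>nat\<close> to \<open>R\<close>.
\<close>

definition weakly_cofinite ::
  "('r, 'b) ring_scheme \<Rightarrow> 'r set \<Rightarrow> ('r, 'w, 'c) module_scheme \<Rightarrow> bool"
  where "weakly_cofinite R I W \<longleftrightarrow> module R W \<and> Supp R W \<subseteq> V_set R I \<and>
    (\<forall>(F :: nat \<Rightarrow> ('r, nat \<Rightarrow> 'r) module) D \<eta>.
       free_resolution R (quot_module (regular_module R) I) F D \<eta> \<longrightarrow>
       (\<forall>i. weakly_Laskerian R (Ext R F D W i)))"

section \<open>Local cohomology\<close>

text \<open>
  The test modules \<open>A\<close> and \<open>B\<close> are carried by (arbitrary subsets of) the type of \<open>R\<close>, since a definition
  cannot quantify over all types. These include \<open>R\<close> and its ideals, so that by Baer's criterion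
  homomorphisms into \<open>E\<close> extend along injections of modules on any types.
\<close>

definition injective_module :: "('r, 'b) ring_scheme \<Rightarrow> ('r, 'e, 'c) module_scheme \<Rightarrow> bool"
  where "injective_module R E \<longleftrightarrow> module R E \<and>
    (\<forall>(A :: ('r, 'r) module) (B :: ('r, 'r) module) f g.
       module R A \<and> module R B \<and> f \<in> mod_hom R A B \<and> inj_on f (carrier A) \<and> g \<in> mod_hom R A E \<longrightarrow>
       (\<exists>h \<in> mod_hom R B E. \<forall>a \<in> carrier A. h (f a) = g a))"

text \<open>\<open>0 \<rightarrow> N \<rightarrow> E 0 \<rightarrow> E 1 \<rightarrow> \<dots>\<close> is exact, with \<open>\<epsilon> : N \<rightarrow> E 0\<close> and \<open>\<delta> i : E i \<rightarrow> E (i + 1)\<close>.\<close>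

definition injective_resolution ::
  "('r, 'b) ring_scheme \<Rightarrow> ('r, 'm, 'c) module_scheme \<Rightarrow> (nat \<Rightarrow> ('r, 'e, 'd) module_scheme)
    \<Rightarrow> (nat \<Rightarrow> 'e \<Rightarrow> 'e) \<Rightarrow> ('m \<Rightarrow> 'e) \<Rightarrow> bool"
  where "injective_resolution R N E \<delta> \<epsilon> \<longleftrightarrow>
    (\<forall>i. injective_module R (E i)) \<and>
    \<epsilon> \<in> mod_hom R N (E 0) \<and> inj_on \<epsilon> (carrier N) \<and>
    (\<forall>i. \<delta> i \<in> mod_hom R (E i) (E (Suc i))) \<and>
    mod_ker (E 0) (E 1) (\<delta> 0) = \<epsilon> ` carrier N \<and>
    (\<forall>i. mod_ker (E (Suc i)) (E (Suc (Suc i))) (\<delta> (Suc i)) = \<delta> i ` carrier (E i))"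

definition torsion ::
  "('r, 'b) ring_scheme \<Rightarrow> 'r set \<Rightarrow> ('r, 'm, 'c) module_scheme \<Rightarrow> ('r, 'm, 'c) module_scheme"
  where "torsion R I M = M\<lparr>carrier :=
    {x \<in> carrier M. \<exists>n :: nat. \<forall>a \<in> I [^]\<^bsub>ideals_set R\<^esub> n. a \<odot>\<^bsub>M\<^esub> x = \<zero>\<^bsub>M\<^esub>}\<rparr>"

text \<open>For an injective resolution \<open>(E, \<delta>)\<close> of a module \<open>N\<close>, this is the \<open>i\<close>-th local cohomology module of
  \<open>N\<close> with respect to \<open>I\<close>: the value at \<open>N\<close> of the \<open>i\<close>-th right derived functor of the \<open>I\<close>-torsion
  functor.\<close>

definition local_cohomology ::
  "('r, 'b) ring_scheme \<Rightarrow> 'r set \<Rightarrow> (nat \<Rightarrow> ('r, 'e, 'd) module_scheme) \<Rightarrow> (nat \<Rightarrow> 'e \<Rightarrow> 'e)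
    \<Rightarrow> nat \<Rightarrow> ('r, 'e set) module"
  where "local_cohomology R I E \<delta> i = cohomology (\<lambda>j. torsion R I (E j)) \<delta> i"

end

theory Submission
  imports Defs
begin

text \<open>
  In the classical picture one first divides the weakly Laskerian module \<open>N\<close> by its \<open>I\<close>-torsion, which
  changes local cohomology only in degree \<open>0\<close>. Then the finitely many associated primes of \<open>N\<close> do not
  contain \<open>I\<close>, and by prime avoidance some \<open>x \<in> I\<close> is regular on \<open>N\<close>. The sequence
  \<open>H\<^sup>d\<^sup>-\<^sup>1(N/x N) \<rightarrow> H\<^sup>d(N) \<rightarrow> H\<^sup>d(N)\<close>, whose second map is multiplication by \<open>x\<close>, shows that the kernel of \<open>x\<close>
  on \<open>H\<^sup>d(N)\<close> is a quotient of \<open>H\<^sup>d\<^sup>-\<^sup>1(N/x N)\<close>; and the support of the torsion module \<open>H\<^sup>d(N)\<close> is the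
  support of that kernel. The module \<open>N/x N\<close> is again weakly Laskerian, because being weakly Laskerian
  passes to quotients, and its dimension is smaller, because \<open>x\<close> lies outside the associated primes of
  \<open>N\<close>. By induction on the dimension the support of \<open>H\<^sup>d(N)\<close> is finite. The induction ends with modules of
  dimension zero, whose support consists of associated primes. The same induction shows that local
  cohomology vanishes above the dimension.

  The induction below is carried out on complexes of injective modules, all of which are constructed
  from the given resolution of the original module. Reduction modulo torsion is done in all degrees of the complex at once (\<open>torsion_complex\<close>): modulo torsion, the cohomology of an injective
  resolution of \<open>N\<close> is the local cohomology of \<open>N\<close> shifted by one degree, with \<open>N\<close> modulo torsion
  appearing in degree \<open>0\<close>. Passing from \<open>N\<close> to \<open>N/x N\<close> becomes passing to the cone of multiplication by
  \<open>x\<close> on the complex (\<open>wl_cone\<close>), which again consists of injectives. Its lemmas \<open>cone_wl\<close> and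
  \<open>vanishes_from_cone\<close> form the inductive step. Injectivity is used through \<open>exact_below\<close>: torsion parts of
  injectives over a Noetherian ring are injective, so coboundaries split off, and a complex of
  injectives with torsion cohomology is exact modulo torsion.

  Once the support of \<open>H\<^sup>d(N)\<close> is finite, the other claims are claims about supports. Associated primes of
  quotients lie in the support, and the support of a torsion module lies in \<open>V(I)\<close>. The support of the
  Ext modules lies in that of \<open>H\<^sup>d(N)\<close>; as the given free resolution \<open>F\<close> of \<open>R/I\<close> may have infinite rank,
  this is not visible on the level of cochains. But the identity of \<open>F\<close> is homotopic to an endomorphism
  whose image is finitely generated in each degree (\<open>small_homotopy\<close>), and this suffices.
\<close>

section \<open>Ideals of Noetherian rings\<close>

lemma (in noetherian_ring) ideal_family_has_maximal:
  assumes "\<F> \<noteq> {}" and "\<And>J. J \<in> \<F> \<Longrightarrow> ideal J R"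
  obtains J where "J \<in> \<F>" and "\<And>J'. J' \<in> \<F> \<Longrightarrow> J \<subseteq> J' \<Longrightarrow> J' = J"
proof -
  have "\<exists>M\<in>\<F>. \<forall>X\<in>\<F>. M \<subseteq> X \<longrightarrow> X = M"
  proof (rule subset_Zorn_nonempty[OF assms(1)])
    fix C assume C: "C \<noteq> {}" "subset.chain \<F> C"
    have "subset.chain {I. ideal I R} C"
      using C assms(2) by (auto simp: subset_chain_def)
    from ideal_chain_is_trivial[OF C(1) this] C(2) show "\<Union>C \<in> \<F>"
      by (auto simp: subset_chain_def)
  qed
  then show ?thesis using that by blast
qed

lemma (in noetherian_ring) ideal_sequence_stabilizes:
  fixes K :: "nat \<Rightarrow> 'a set"
  assumes "\<And>n. ideal (K n) R" and "\<And>n. K n \<subseteq> K (Suc n)"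
  obtains N where "\<forall>n\<ge>N. K n = K N"
proof -
  obtain J where J: "J \<in> range K" "\<And>J'. J' \<in> range K \<Longrightarrow> J \<subseteq> J' \<Longrightarrow> J' = J"
    by (rule ideal_family_has_maximal[of "range K"]) (use assms in auto)
  then obtain N where "J = K N" by blast
  moreover have "K N \<subseteq> K n" if "N \<le> n" for n
    by (rule lift_Suc_mono_le[of K, OF assms(2) that])
  ultimately have "\<forall>n\<ge>N. K n = K N" using J(2) by simp
  then show ?thesis by (rule that)
qed

lemma (in primeideal) one_notin: "\<one> \<notin> I"
  using one_imp_carrier I_notcarr by blast

lemma (in primeideal) nat_pow_mem:
  assumes "a \<in> carrier R" "a [^] (n::nat) \<in> I"
  shows "a \<in> I"
  using assms(2)
proof (induction n)
  case 0
  then show ?case using one_notin by simp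
next
  case (Suc n)
  then show ?case using I_prime[of "a [^] n" a] assms(1) by auto
qed

text \<open>
  Primes contained in another prime of the family impose no extra condition, so the family may be
  taken to be an antichain. If \<open>x\<close> avoids all primes but \<open>P\<close> and lies in \<open>P\<close>, then adding an element
  of \<open>I\<close> that lies in all the other primes but not in \<open>P\<close> repairs it.
\<close>

lemma (in cring) prime_avoidance:
  assumes "finite \<P>" and "ideal I R"
    and "\<And>P. P \<in> \<P> \<Longrightarrow> primeideal P R" and "\<And>P. P \<in> \<P> \<Longrightarrow> \<not> I \<subseteq> P"
  shows "\<exists>x\<in>I. \<forall>P\<in>\<P>. x \<notin> P"
  using assms(1,3,4)
proof (induction \<P> rule: finite_psubset_induct)
  case (psubset \<P>)
  interpret I: ideal I R by fact
  have IH: "\<exists>x\<in>I. \<forall>P\<in>\<Q>. x \<notin> P" if "\<Q> \<subset> \<P>" for \<Q>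
    using psubset.IH[OF that] psubset.prems that by blast
  show ?case
  proof (cases "\<exists>P\<in>\<P>. \<exists>Q\<in>\<P>. P \<subset> Q")
    case True
    then obtain P Q where PQ: "P \<in> \<P>" "Q \<in> \<P>" "P \<subset> Q" by blast
    then obtain x where "x \<in> I" "\<forall>P'\<in>\<P> - {P}. x \<notin> P'" using IH[of "\<P> - {P}"] by blast
    then show ?thesis using PQ by blast
  next
    case antichain: False
    show ?thesis
    proof (cases "\<P> = {}")
      case True
      then show ?thesis using I.zero_closed by blast
    next
      case False
      then obtain P where P: "P \<in> \<P>" by blast
      interpret P: primeideal P R using psubset.prems P by blast
      obtain x where x: "x \<in> I" "\<forall>Q\<in>\<P> - {P}. x \<notin> Q" using IH[of "\<P> - {P}"] P by blast
      have "\<exists>y\<in>I. y \<notin> P \<and> (\<forall>Q\<in>\<Q>. y \<in> Q)" if "\<Q> \<subseteq> \<P> - {P}" for \<Q>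
      proof -
        have "finite \<Q>" using that psubset.hyps finite_subset by blast
        then show ?thesis using that
        proof (induction \<Q>)
          case empty
          then show ?case using psubset.prems P by blast
        next
          case (insert Q \<Q>)
          then obtain y where y: "y \<in> I" "y \<notin> P" "\<forall>Q\<in>\<Q>. y \<in> Q" by auto
          have "\<not> Q \<subseteq> P" using antichain insert.prems P by blast
          then obtain z where z: "z \<in> Q" "z \<notin> P" by blast
          interpret Q: primeideal Q R using psubset.prems insert.prems by blast
          have c: "y \<in> carrier R" "z \<in> carrier R" using y z I.Icarr Q.Icarr by auto
          have "y \<otimes> z \<in> I" using c y I.I_r_closed by blast
          moreover have "y \<otimes> z \<notin> P" using P.I_prime[of y z] c y z by blast
          moreover have "\<forall>Q'\<in>insert Q \<Q>. y \<otimes> z \<in> Q'"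
          proof
            fix Q' assume Q': "Q' \<in> insert Q \<Q>"
            then interpret Q': primeideal Q' R using psubset.prems insert.prems by blast
            show "y \<otimes> z \<in> Q'" using Q' y z c Q'.I_l_closed Q'.I_r_closed by blast
          qed
          ultimately show ?case by blast
        qed
      qed
      then obtain y where y: "y \<in> I" "y \<notin> P" "\<forall>Q\<in>\<P> - {P}. y \<in> Q" by blast
      have c: "x \<in> carrier R" "y \<in> carrier R" using x y I.Icarr by auto
      show ?thesis
      proof (cases "x \<in> P")
        case False
        then show ?thesis using x by blast
      next
        case True
        have "x \<oplus> y \<notin> Q" if "Q \<in> \<P>" for Q
        proof
          assume Q: "x \<oplus> y \<in> Q"
          interpret Q: primeideal Q R using psubset.prems that by blast
          have "(\<ominus> x) \<oplus> (x \<oplus> y) = y" "(x \<oplus> y) \<oplus> (\<ominus> y) = x" using c by (simp_all add: r_neg1 a_assoc r_neg)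
          then show False
            using that Q x y True
            by (metis Diff_iff P.a_closed P.a_inv_closed Q.a_closed Q.a_inv_closed singletonD)
        qed
        then show ?thesis using x y I.a_closed by blast
      qed
    qed
  qed
qed

section \<open>Associated primes and support of subquotients\<close>

locale noetherian_module = module R M + noetherian_ring R for R (structure) and M (structure)

text \<open>
  Quotients \<open>U/V\<close> of submodules are never formed in the inductive part of the proof: their
  associated primes and their support are read off from conductors into \<open>V\<close> of elements of \<open>U\<close>.
\<close>

definition conductor :: "('r, 'b) ring_scheme \<Rightarrow> ('r, 'm, 'c) module_scheme \<Rightarrow> 'm set \<Rightarrow> 'm \<Rightarrow> 'r set"
  where "conductor R M B x = {a \<in> carrier R. a \<odot>\<^bsub>M\<^esub> x \<in> B}"

definition Ass_subq :: "('r, 'b) ring_scheme \<Rightarrow> ('r, 'm, 'c) module_scheme \<Rightarrow> 'm set \<Rightarrow> 'm set \<Rightarrow> 'r set set"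
  where "Ass_subq R M U V = {P \<in> Spec R. \<exists>u\<in>U. P = conductor R M V u}"

definition Supp_subq :: "('r, 'b) ring_scheme \<Rightarrow> ('r, 'm, 'c) module_scheme \<Rightarrow> 'm set \<Rightarrow> 'm set \<Rightarrow> 'r set set"
  where "Supp_subq R M U V = {P \<in> Spec R. \<exists>u\<in>U. \<forall>s\<in>carrier R - P. s \<odot>\<^bsub>M\<^esub> u \<notin> V}"

text \<open>
  The preimage in \<open>M\<close> of the \<open>I\<close>-torsion of \<open>M/B\<close>. Torsion is taken element by element of \<open>I\<close>, which
  over a Noetherian ring agrees with being killed by a power of \<open>I\<close> (\<open>torsion_carrier\<close> below).
\<close>

definition saturation :: "('r, 'b) ring_scheme \<Rightarrow> 'r set \<Rightarrow> ('r, 'm, 'c) module_scheme \<Rightarrow> 'm set \<Rightarrow> 'm set"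
  where "saturation R I M B = {x \<in> carrier M. \<forall>a\<in>I. \<exists>n::nat. (a [^]\<^bsub>R\<^esub> n) \<odot>\<^bsub>M\<^esub> x \<in> B}"

lemma saturationE:
  assumes "z \<in> saturation R I M B" "a \<in> I"
  obtains n :: nat where "(a [^]\<^bsub>R\<^esub> n) \<odot>\<^bsub>M\<^esub> z \<in> B"
  using assms by (auto simp: saturation_def)

context module
begin

lemma smodD:
  assumes "submodule B R M"
  shows "\<zero>\<^bsub>M\<^esub> \<in> B" "\<And>x. x \<in> B \<Longrightarrow> x \<in> carrier M"
    "\<And>x y. x \<in> B \<Longrightarrow> y \<in> B \<Longrightarrow> x \<oplus>\<^bsub>M\<^esub> y \<in> B"
    "\<And>x. x \<in> B \<Longrightarrow> \<ominus>\<^bsub>M\<^esub> x \<in> B"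
    "\<And>x y. x \<in> B \<Longrightarrow> y \<in> B \<Longrightarrow> x \<ominus>\<^bsub>M\<^esub> y \<in> B"
    "\<And>a x. a \<in> carrier R \<Longrightarrow> x \<in> B \<Longrightarrow> a \<odot>\<^bsub>M\<^esub> x \<in> B"
proof -
  interpret B: submodule B R M by fact
  show "\<zero>\<^bsub>M\<^esub> \<in> B" using B.one_closed by simp
  show c: "\<And>x. x \<in> B \<Longrightarrow> x \<in> carrier M" using submoduleE(1)[OF assms] by auto
  show a: "\<And>x y. x \<in> B \<Longrightarrow> y \<in> B \<Longrightarrow> x \<oplus>\<^bsub>M\<^esub> y \<in> B"
    and n: "\<And>x. x \<in> B \<Longrightarrow> \<ominus>\<^bsub>M\<^esub> x \<in> B"
    and "\<And>a x. a \<in> carrier R \<Longrightarrow> x \<in> B \<Longrightarrow> a \<odot>\<^bsub>M\<^esub> x \<in> B"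
    using submoduleE[OF assms] by auto
  show "\<And>x y. x \<in> B \<Longrightarrow> y \<in> B \<Longrightarrow> x \<ominus>\<^bsub>M\<^esub> y \<in> B" using a n by (simp add: a_minus_def)
qed

lemma smod_cancel:
  assumes "submodule B R M" "x \<in> B" "y \<in> carrier M" "x \<oplus>\<^bsub>M\<^esub> y \<in> B \<or> y \<oplus>\<^bsub>M\<^esub> x \<in> B \<or> y \<ominus>\<^bsub>M\<^esub> x \<in> B"
  shows "y \<in> B"
proof -
  note B = smodD[OF assms(1)]
  have x: "x \<in> carrier M" using B assms by auto
  have "(\<ominus>\<^bsub>M\<^esub> x) \<oplus>\<^bsub>M\<^esub> (x \<oplus>\<^bsub>M\<^esub> y) = y" "(y \<oplus>\<^bsub>M\<^esub> x) \<ominus>\<^bsub>M\<^esub> x = y" "(y \<ominus>\<^bsub>M\<^esub> x) \<oplus>\<^bsub>M\<^esub> x = y"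
    using x assms(3) by (simp_all add: M.r_neg1 M.a_assoc a_minus_def M.r_neg M.l_neg)
  then show ?thesis using B assms by metis
qed

lemma smoduleI:
  assumes "B \<subseteq> carrier M" "\<zero>\<^bsub>M\<^esub> \<in> B" "\<And>x y. x \<in> B \<Longrightarrow> y \<in> B \<Longrightarrow> x \<oplus>\<^bsub>M\<^esub> y \<in> B"
    "\<And>a x. a \<in> carrier R \<Longrightarrow> x \<in> B \<Longrightarrow> a \<odot>\<^bsub>M\<^esub> x \<in> B"
  shows "submodule B R M"
proof (rule submoduleI)
  fix x assume x: "x \<in> B"
  then have "(\<ominus> \<one>) \<odot>\<^bsub>M\<^esub> x \<in> B" using assms(4) by blast
  then show "\<ominus>\<^bsub>M\<^esub> x \<in> B" using x assms(1) by (simp add: smult_l_minus subset_iff)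
qed (use assms in auto)

lemma zero_smod: "submodule {\<zero>\<^bsub>M\<^esub>} R M"
  by (rule smoduleI) auto

lemma conductor_ideal:
  assumes "submodule B R M" "x \<in> carrier M"
  shows "ideal (conductor R M B x) R"
proof -
  note B = smodD[OF assms(1)]
  show ?thesis
  proof (rule idealI[OF R.ring_axioms])
    show "subgroup (conductor R M B x) (add_monoid R)"
    proof (rule R.add.subgroupI)
      show "conductor R M B x \<noteq> {}" using B(1) assms by (auto simp: conductor_def intro!: exI[of _ \<zero>])
    qed (use B assms in \<open>auto simp: conductor_def smult_l_minus smult_l_distr\<close>)
  qed (use B assms in \<open>auto simp: conductor_def smult_assoc1\<close>, metis B(6) R.m_comm smult_assoc1)
qed

lemma smult_comm:
  assumes "a \<in> carrier R" "b \<in> carrier R" "x \<in> carrier M"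
  shows "a \<odot>\<^bsub>M\<^esub> (b \<odot>\<^bsub>M\<^esub> x) = b \<odot>\<^bsub>M\<^esub> (a \<odot>\<^bsub>M\<^esub> x)"
  using assms by (metis R.m_comm smult_assoc1)

lemma pow_smult:
  assumes "a \<in> carrier R" "x \<in> carrier M"
  shows "(a [^] (n + m :: nat)) \<odot>\<^bsub>M\<^esub> x = (a [^] n) \<odot>\<^bsub>M\<^esub> ((a [^] m) \<odot>\<^bsub>M\<^esub> x)"
  using assms by (simp flip: smult_assoc1 R.nat_pow_mult)

lemma pow_smult_mono:
  assumes "submodule B R M" "a \<in> carrier R" "x \<in> carrier M" "(a [^] (n::nat)) \<odot>\<^bsub>M\<^esub> x \<in> B" "n \<le> m"
  shows "(a [^] m) \<odot>\<^bsub>M\<^esub> x \<in> B"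
proof -
  have "(a [^] m) \<odot>\<^bsub>M\<^esub> x = (a [^] (m - n)) \<odot>\<^bsub>M\<^esub> ((a [^] n) \<odot>\<^bsub>M\<^esub> x)"
    using pow_smult[of a x "m - n" n] assms by simp
  then show ?thesis using smodD[OF assms(1)] assms by simp
qed

lemma saturation_smod:
  assumes B: "submodule B R M" and I: "I \<subseteq> carrier R"
  shows "submodule (saturation R I M B) R M"
proof (rule smoduleI)
  note BD = smodD[OF B]
  show "\<zero>\<^bsub>M\<^esub> \<in> saturation R I M B" using BD I by (auto simp: saturation_def)
  fix x y assume xy: "x \<in> saturation R I M B" "y \<in> saturation R I M B"
  show "x \<oplus>\<^bsub>M\<^esub> y \<in> saturation R I M B"
  proof -
    have "\<exists>n::nat. (a [^] n) \<odot>\<^bsub>M\<^esub> (x \<oplus>\<^bsub>M\<^esub> y) \<in> B" if a: "a \<in> I" for a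
    proof -
      obtain n m :: nat where nm: "(a [^] n) \<odot>\<^bsub>M\<^esub> x \<in> B" "(a [^] m) \<odot>\<^bsub>M\<^esub> y \<in> B"
        using xy a unfolding saturation_def by blast
      have c: "a \<in> carrier R" "x \<in> carrier M" "y \<in> carrier M" using xy a I by (auto simp: saturation_def)
      have "(a [^] (max n m)) \<odot>\<^bsub>M\<^esub> (x \<oplus>\<^bsub>M\<^esub> y) = (a [^] (max n m)) \<odot>\<^bsub>M\<^esub> x \<oplus>\<^bsub>M\<^esub> (a [^] (max n m)) \<odot>\<^bsub>M\<^esub> y"
        using c by (simp add: smult_r_distr)
      moreover have "(a [^] (max n m)) \<odot>\<^bsub>M\<^esub> x \<in> B" "(a [^] (max n m)) \<odot>\<^bsub>M\<^esub> y \<in> B"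
        using pow_smult_mono[OF B c(1)] c nm by auto
      ultimately show ?thesis using BD by metis
    qed
    then show ?thesis using xy by (auto simp: saturation_def)
  qed
next
  fix r x assume r: "r \<in> carrier R" and x: "x \<in> saturation R I M B"
  note BD = smodD[OF B]
  have "\<exists>n::nat. (a [^] n) \<odot>\<^bsub>M\<^esub> (r \<odot>\<^bsub>M\<^esub> x) \<in> B" if a: "a \<in> I" for a
  proof -
    obtain n :: nat where n: "(a [^] n) \<odot>\<^bsub>M\<^esub> x \<in> B" using x a by (auto simp: saturation_def)
    have c: "a [^] n \<in> carrier R" "x \<in> carrier M" using a x I by (auto simp: saturation_def)
    then have "(a [^] n) \<odot>\<^bsub>M\<^esub> (r \<odot>\<^bsub>M\<^esub> x) = r \<odot>\<^bsub>M\<^esub> ((a [^] n) \<odot>\<^bsub>M\<^esub> x)"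
      using r smult_comm by blast
    then show ?thesis using BD n r by metis
  qed
  then show "r \<odot>\<^bsub>M\<^esub> x \<in> saturation R I M B" using r x by (auto simp: saturation_def)
qed (auto simp: saturation_def)

lemma subset_saturation: "submodule B R M \<Longrightarrow> B \<subseteq> saturation R I M B"
  using smodD(2)[of B] by (auto simp: saturation_def intro!: exI[of _ "0::nat"])

lemma saturation_saturation:
  assumes I: "I \<subseteq> carrier R"
  shows "saturation R I M (saturation R I M B) \<subseteq> saturation R I M B"
proof
  fix x assume x: "x \<in> saturation R I M (saturation R I M B)"
  have "\<exists>n::nat. (a [^] n) \<odot>\<^bsub>M\<^esub> x \<in> B" if a: "a \<in> I" for a
  proof -
    obtain n :: nat where "(a [^] n) \<odot>\<^bsub>M\<^esub> x \<in> saturation R I M B" using x a by (auto simp: saturation_def)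
    then obtain m :: nat where "(a [^] m) \<odot>\<^bsub>M\<^esub> ((a [^] n) \<odot>\<^bsub>M\<^esub> x) \<in> B"
      using a by (auto simp: saturation_def)
    moreover have "a \<in> carrier R" "x \<in> carrier M" using a x I by (auto simp: saturation_def)
    ultimately show ?thesis using pow_smult[of a x m n] by metis
  qed
  then show "x \<in> saturation R I M B" using x by (auto simp: saturation_def)
qed

end

context noetherian_module
begin

text \<open>
  The usual argument for the existence of associated primes, made relative to a multiplicatively
  closed set \<open>S\<close>: a conductor that is maximal among those disjoint from \<open>S\<close> is prime. With \<open>S = {1}\<close>
  this yields associated primes, and with \<open>S\<close> the complement of a prime \<open>P\<close> it yields associated
  primes contained in \<open>P\<close>.
\<close>

lemma prime_conductor_exists:
  assumes B: "submodule B R M" and x: "x \<in> carrier M"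
    and S: "S \<subseteq> carrier R" "\<one> \<in> S" "\<And>s t. s \<in> S \<Longrightarrow> t \<in> S \<Longrightarrow> s \<otimes> t \<in> S"
    and xS: "\<And>s. s \<in> S \<Longrightarrow> s \<odot>\<^bsub>M\<^esub> x \<notin> B"
  obtains r where "r \<in> carrier R" "primeideal (conductor R M B (r \<odot>\<^bsub>M\<^esub> x)) R"
    "conductor R M B (r \<odot>\<^bsub>M\<^esub> x) \<inter> S = {}"
proof -
  note BD = smodD[OF B]
  define \<F> where "\<F> = {conductor R M B (r \<odot>\<^bsub>M\<^esub> x) | r. r \<in> carrier R \<and> conductor R M B (r \<odot>\<^bsub>M\<^esub> x) \<inter> S = {}}"
  have "conductor R M B (\<one> \<odot>\<^bsub>M\<^esub> x) \<in> \<F>"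
    unfolding \<F>_def using xS x by (intro CollectI exI[of _ \<one>]) (auto simp: conductor_def)
  then have "\<F> \<noteq> {}" by blast
  moreover have "ideal J R" if "J \<in> \<F>" for J
    using that conductor_ideal[OF B] x by (auto simp: \<F>_def)
  ultimately obtain Q where Q: "Q \<in> \<F>" "\<And>J. J \<in> \<F> \<Longrightarrow> Q \<subseteq> J \<Longrightarrow> J = Q"
    using ideal_family_has_maximal by blast
  then obtain r where r: "r \<in> carrier R" "Q = conductor R M B (r \<odot>\<^bsub>M\<^esub> x)" "Q \<inter> S = {}"
    unfolding \<F>_def by blast
  define y where "y = r \<odot>\<^bsub>M\<^esub> x"
  have y: "y \<in> carrier M" "Q = conductor R M B y" using r x by (auto simp: y_def)
  have bigger: "Q \<subseteq> conductor R M B (c \<odot>\<^bsub>M\<^esub> y)" if "c \<in> carrier R" for c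
    using that y BD(6) smult_comm[of _ c y] by (auto simp: conductor_def)
  have maxi: "conductor R M B (c \<odot>\<^bsub>M\<^esub> y) = Q"
    if "c \<in> carrier R" "conductor R M B (c \<odot>\<^bsub>M\<^esub> y) \<inter> S = {}" for c
  proof (rule Q(2)[OF _ bigger])
    have "c \<odot>\<^bsub>M\<^esub> y = (c \<otimes> r) \<odot>\<^bsub>M\<^esub> x" using that r x by (simp add: y_def smult_assoc1)
    then show "conductor R M B (c \<odot>\<^bsub>M\<^esub> y) \<in> \<F>"
      unfolding \<F>_def using that r by auto
  qed (use that in auto)
  have "primeideal Q R"
  proof (rule primeidealI)
    show "ideal Q R" using y conductor_ideal[OF B] by simp
    show "cring R" by (rule R.is_cring)
    have "\<one> \<notin> Q" using r(3) S(2) by blast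
    then show "carrier R \<noteq> Q" by auto
    fix a b assume ab: "a \<in> carrier R" "b \<in> carrier R" "a \<otimes> b \<in> Q"
    show "a \<in> Q \<or> b \<in> Q"
    proof (rule disjCI)
      assume b: "b \<notin> Q"
      show "a \<in> Q"
      proof (cases "conductor R M B (a \<odot>\<^bsub>M\<^esub> y) \<inter> S = {}")
        case True
        have "b \<odot>\<^bsub>M\<^esub> (a \<odot>\<^bsub>M\<^esub> y) \<in> B"
          using ab y by (auto simp: conductor_def smult_assoc1 smult_comm[of b a])
        then have "b \<in> Q" using maxi[OF ab(1) True] ab by (auto simp: conductor_def)
        with b show ?thesis by blast
      next
        case False
        \<comment> \<open>The conductor of \<open>s y\<close> is still disjoint from \<open>S\<close>, so it equals \<open>Q\<close> by maximality, and it contains \<open>a\<close>.\<close>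
        then obtain s where s: "s \<in> S" "s \<in> carrier R" "s \<odot>\<^bsub>M\<^esub> (a \<odot>\<^bsub>M\<^esub> y) \<in> B" by (auto simp: conductor_def)
        have "conductor R M B (s \<odot>\<^bsub>M\<^esub> y) \<inter> S = {}"
        proof (rule ccontr)
          assume "\<not> ?thesis"
          then obtain t where t: "t \<in> S" "t \<odot>\<^bsub>M\<^esub> (s \<odot>\<^bsub>M\<^esub> y) \<in> B" by (auto simp: conductor_def)
          then have "t \<otimes> s \<in> Q" using y s S(1) by (auto simp: conductor_def smult_assoc1)
          then show False using r(3) S(3)[OF t(1) s(1)] by blast
        qed
        then have eq: "conductor R M B (s \<odot>\<^bsub>M\<^esub> y) = Q" by (rule maxi[OF s(2)])
        have "a \<odot>\<^bsub>M\<^esub> (s \<odot>\<^bsub>M\<^esub> y) \<in> B" using s y ab smult_comm by metis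
        then show ?thesis using eq ab by (auto simp: conductor_def)
      qed
    qed
  qed
  then show ?thesis using that r by blast
qed

lemma Supp_subq_self:
  assumes U: "submodule U R M"
  shows "Supp_subq R M U U = {}"
proof -
  have "\<exists>s\<in>carrier R - P. s \<odot>\<^bsub>M\<^esub> u \<in> U" if "primeideal P R" "u \<in> U" for P u
    using primeideal.one_notin[OF that(1)] that(2) smodD(2)[OF U] by (intro bexI[of _ \<one>]) auto
  then show ?thesis unfolding Supp_subq_def Spec_def by blast
qed

lemma Ass_subq_subset_Supp_subq: "Ass_subq R M U V \<subseteq> Supp_subq R M U V"
  by (auto simp: Ass_subq_def Supp_subq_def conductor_def)

lemma Supp_subq_contains_Ass_subq:
  assumes U: "submodule U R M" and V: "submodule V R M" and P: "P \<in> Supp_subq R M U V"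
  shows "\<exists>Q\<in>Ass_subq R M U V. Q \<subseteq> P"
proof -
  interpret P: primeideal P R using P by (auto simp: Supp_subq_def Spec_def)
  obtain u where u: "u \<in> U" "\<forall>s\<in>carrier R - P. s \<odot>\<^bsub>M\<^esub> u \<notin> V" using P by (auto simp: Supp_subq_def)
  obtain r where "r \<in> carrier R" "primeideal (conductor R M V (r \<odot>\<^bsub>M\<^esub> u)) R"
    "conductor R M V (r \<odot>\<^bsub>M\<^esub> u) \<inter> (carrier R - P) = {}"
    by (rule prime_conductor_exists[OF V, of u "carrier R - P"])
      (use u P.I_prime P.one_notin smodD(2)[OF U] in auto)
  then show ?thesis using smodD(6)[OF U] u(1)
    by (auto simp: Ass_subq_def Spec_def conductor_def intro!: bexI[of _ "conductor R M V (r \<odot>\<^bsub>M\<^esub> u)"] bexI[of _ "r \<odot>\<^bsub>M\<^esub> u"])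
qed

lemma zero_divisor_in_Ass_subq:
  assumes U: "submodule U R M" and V: "submodule V R M" and u: "u \<in> U" "u \<notin> V"
    and a: "a \<in> carrier R" "a \<odot>\<^bsub>M\<^esub> u \<in> V"
  shows "\<exists>Q\<in>Ass_subq R M U V. a \<in> Q"
proof -
  have uc: "u \<in> carrier M" using u smodD(2)[OF U] by blast
  obtain r where r: "r \<in> carrier R" "primeideal (conductor R M V (r \<odot>\<^bsub>M\<^esub> u)) R"
    by (rule prime_conductor_exists[OF V uc, of "{\<one>}"]) (use u uc in auto)
  have "a \<odot>\<^bsub>M\<^esub> (r \<odot>\<^bsub>M\<^esub> u) = r \<odot>\<^bsub>M\<^esub> (a \<odot>\<^bsub>M\<^esub> u)" using a r uc smult_comm by blast
  then have "a \<in> conductor R M V (r \<odot>\<^bsub>M\<^esub> u)" using a r smodD(6)[OF V] by (auto simp: conductor_def)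
  then show ?thesis using smodD(6)[OF U] u(1) r
    by (auto simp: Ass_subq_def Spec_def)
qed

lemma Supp_subq_empty_imp_subset:
  assumes U: "submodule U R M" and V: "submodule V R M" and "Supp_subq R M U V = {}"
  shows "U \<subseteq> V"
proof
  fix u assume u: "u \<in> U"
  show "u \<in> V"
  proof (rule ccontr)
    assume "u \<notin> V"
    moreover have "\<zero> \<odot>\<^bsub>M\<^esub> u \<in> V" using u smodD(2)[OF U] smodD(1)[OF V] by auto
    ultimately show False
      using zero_divisor_in_Ass_subq[OF U V u] Ass_subq_subset_Supp_subq assms(3) R.zero_closed by blast
  qed
qed

end

text \<open>
  Serves to move associated primes and support along maps \<open>U'/V' \<rightarrow> U/V\<close> that are bijective, without
  mentioning the maps.
\<close>

lemma Ass_Supp_subq_transfer: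
  assumes "\<And>w. w \<in> U \<Longrightarrow> \<exists>u\<in>U'. \<forall>a\<in>carrier R. a \<odot>\<^bsub>M\<^esub> w \<in> V \<longleftrightarrow> a \<odot>\<^bsub>M'\<^esub> u \<in> V'"
  shows "Ass_subq R M U V \<subseteq> Ass_subq R M' U' V'" "Supp_subq R M U V \<subseteq> Supp_subq R M' U' V'"
proof -
  show "Ass_subq R M U V \<subseteq> Ass_subq R M' U' V'"
  proof
    fix P assume P: "P \<in> Ass_subq R M U V"
    then obtain w where w: "w \<in> U" "P = conductor R M V w" by (auto simp: Ass_subq_def)
    obtain u where u: "u \<in> U'" "\<forall>a\<in>carrier R. a \<odot>\<^bsub>M\<^esub> w \<in> V \<longleftrightarrow> a \<odot>\<^bsub>M'\<^esub> u \<in> V'"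
      using assms[OF w(1)] by blast
    have "P = conductor R M' V' u" unfolding w(2) conductor_def using u(2) by blast
    then show "P \<in> Ass_subq R M' U' V'" using P u(1) by (simp add: Ass_subq_def) blast
  qed
  show "Supp_subq R M U V \<subseteq> Supp_subq R M' U' V'"
  proof
    fix P assume P: "P \<in> Supp_subq R M U V"
    then obtain w where w: "w \<in> U" "\<forall>s\<in>carrier R - P. s \<odot>\<^bsub>M\<^esub> w \<notin> V" by (auto simp: Supp_subq_def)
    obtain u where u: "u \<in> U'" "\<forall>a\<in>carrier R. a \<odot>\<^bsub>M\<^esub> w \<in> V \<longleftrightarrow> a \<odot>\<^bsub>M'\<^esub> u \<in> V'"
      using assms[OF w(1)] by blast
    then have "\<forall>s\<in>carrier R - P. s \<odot>\<^bsub>M'\<^esub> u \<notin> V'" using w(2) by blast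
    moreover have "P \<in> Spec R" using P by (simp add: Supp_subq_def)
    ultimately show "P \<in> Supp_subq R M' U' V'" using u(1) unfolding Supp_subq_def by blast
  qed
qed

lemma Supp_subq_antimono: "V \<subseteq> V' \<Longrightarrow> Supp_subq R M U V' \<subseteq> Supp_subq R M U V"
  unfolding Supp_subq_def by blast

definition has_chain :: "'a set set \<Rightarrow> nat \<Rightarrow> bool"
  where "has_chain X n \<longleftrightarrow> (\<exists>P. (\<forall>i\<le>n. P i \<in> X) \<and> (\<forall>i<n. P i \<subset> P (Suc i)))"

lemma has_chain_mono: "has_chain X n \<Longrightarrow> X \<subseteq> Y \<Longrightarrow> has_chain Y n"
  unfolding has_chain_def by blast

lemma has_chain_extend:
  assumes "has_chain X n" "X \<subseteq> Y" "\<And>P. P \<in> X \<Longrightarrow> \<exists>Q\<in>Y. Q \<subset> P"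
  shows "has_chain Y (Suc n)"
proof -
  obtain P where P: "\<forall>i\<le>n. P i \<in> X" "\<forall>i<n. P i \<subset> P (Suc i)" using assms(1) by (auto simp: has_chain_def)
  have "P 0 \<in> X" using P(1) by simp
  then obtain Q where Q: "Q \<in> Y" "Q \<subset> P 0" using assms(3) by blast
  have "\<forall>i\<le>Suc n. case_nat Q P i \<in> Y" "\<forall>i<Suc n. case_nat Q P i \<subset> case_nat Q P (Suc i)"
    using P Q assms(2) by (auto split: nat.split)
  then show ?thesis unfolding has_chain_def by blast
qed

lemma has_chain_0: "has_chain X 0 \<longleftrightarrow> X \<noteq> {}"
  by (auto simp: has_chain_def)

lemma has_chain_1: "P \<in> X \<Longrightarrow> Q \<in> X \<Longrightarrow> Q \<subset> P \<Longrightarrow> has_chain X (Suc 0)"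
  unfolding has_chain_def by (intro exI[of _ "case_nat Q (\<lambda>_. P)"]) (auto split: nat.split)

context noetherian_module
begin

text \<open>
  In dimension zero every prime of the support is minimal in it, hence associated.
\<close>

lemma finite_Supp_subq_dim0:
  assumes U: "submodule U R M" and V: "submodule V R M" and fin: "finite (Ass_subq R M U V)"
    and "\<not> has_chain (Supp_subq R M U V) (Suc 0)"
  shows "finite (Supp_subq R M U V)"
proof -
  have "Supp_subq R M U V \<subseteq> Ass_subq R M U V"
  proof
    fix P assume P: "P \<in> Supp_subq R M U V"
    then obtain Q where "Q \<in> Ass_subq R M U V" "Q \<subseteq> P" using Supp_subq_contains_Ass_subq[OF U V] by blast
    then show "P \<in> Ass_subq R M U V"
      using has_chain_1[OF P, of Q] Ass_subq_subset_Supp_subq assms(4) by blast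
  qed
  then show ?thesis using fin finite_subset by blast
qed

end

section \<open>Homomorphisms and sums of submodules\<close>

lemma mod_homD:
  assumes "module R M" "module R N" "f \<in> mod_hom R M N"
  shows "\<And>x. x \<in> carrier M \<Longrightarrow> f x \<in> carrier N"
    "\<And>x y. x \<in> carrier M \<Longrightarrow> y \<in> carrier M \<Longrightarrow> f (x \<oplus>\<^bsub>M\<^esub> y) = f x \<oplus>\<^bsub>N\<^esub> f y"
    "\<And>a x. a \<in> carrier R \<Longrightarrow> x \<in> carrier M \<Longrightarrow> f (a \<odot>\<^bsub>M\<^esub> x) = a \<odot>\<^bsub>N\<^esub> f x"
    "f \<zero>\<^bsub>M\<^esub> = \<zero>\<^bsub>N\<^esub>"
    "\<And>x. x \<in> carrier M \<Longrightarrow> f (\<ominus>\<^bsub>M\<^esub> x) = \<ominus>\<^bsub>N\<^esub> f x"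
    "\<And>x y. x \<in> carrier M \<Longrightarrow> y \<in> carrier M \<Longrightarrow> f (x \<ominus>\<^bsub>M\<^esub> y) = f x \<ominus>\<^bsub>N\<^esub> f y"
proof -
  interpret M: module R M by fact
  interpret N: module R N by fact
  show c: "\<And>x. x \<in> carrier M \<Longrightarrow> f x \<in> carrier N"
    and a: "\<And>x y. x \<in> carrier M \<Longrightarrow> y \<in> carrier M \<Longrightarrow> f (x \<oplus>\<^bsub>M\<^esub> y) = f x \<oplus>\<^bsub>N\<^esub> f y"
    and s: "\<And>a x. a \<in> carrier R \<Longrightarrow> x \<in> carrier M \<Longrightarrow> f (a \<odot>\<^bsub>M\<^esub> x) = a \<odot>\<^bsub>N\<^esub> f x"
    using assms(3) by (auto simp: mod_hom_def)
  have "f (\<zero>\<^bsub>R\<^esub> \<odot>\<^bsub>M\<^esub> \<zero>\<^bsub>M\<^esub>) = \<zero>\<^bsub>R\<^esub> \<odot>\<^bsub>N\<^esub> f \<zero>\<^bsub>M\<^esub>" using s by blast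
  then show "f \<zero>\<^bsub>M\<^esub> = \<zero>\<^bsub>N\<^esub>" using c by simp
  show n: "f (\<ominus>\<^bsub>M\<^esub> x) = \<ominus>\<^bsub>N\<^esub> f x" if "x \<in> carrier M" for x
  proof -
    have "f ((\<ominus>\<^bsub>R\<^esub> \<one>\<^bsub>R\<^esub>) \<odot>\<^bsub>M\<^esub> x) = (\<ominus>\<^bsub>R\<^esub> \<one>\<^bsub>R\<^esub>) \<odot>\<^bsub>N\<^esub> f x" using s that by blast
    then show ?thesis using that c by (simp add: M.smult_l_minus N.smult_l_minus)
  qed
  show "f (x \<ominus>\<^bsub>M\<^esub> y) = f x \<ominus>\<^bsub>N\<^esub> f y" if "x \<in> carrier M" "y \<in> carrier M" for x y
    using that a n by (simp add: a_minus_def)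
qed

lemma image_submodule:
  assumes M: "module R M" and N: "module R N" and f: "f \<in> mod_hom R M N" and Y: "submodule Y R M"
  shows "submodule (f ` Y) R N"
proof -
  interpret M: module R M by fact
  interpret N: module R N by fact
  note h = mod_homD[OF M N f] and YD = M.smodD[OF Y]
  show ?thesis
  proof (rule N.smoduleI)
    show "\<zero>\<^bsub>N\<^esub> \<in> f ` Y" using h(4) YD(1) by (metis image_eqI)
    fix x y assume "x \<in> f ` Y" "y \<in> f ` Y"
    then show "x \<oplus>\<^bsub>N\<^esub> y \<in> f ` Y" using h(2) YD(2,3) by (auto simp flip: h(2) intro!: imageI)
  next
    fix a x assume "a \<in> carrier R" "x \<in> f ` Y"
    then show "a \<odot>\<^bsub>N\<^esub> x \<in> f ` Y" using YD(2,6) by (auto simp flip: h(3) intro!: imageI)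
  qed (use h(1) YD(2) in auto)
qed

lemma preimage_submodule:
  assumes M: "module R M" and N: "module R N" and f: "f \<in> mod_hom R M N" and Y: "submodule Y R N"
  shows "submodule {x \<in> carrier M. f x \<in> Y} R M"
proof -
  interpret M: module R M by fact
  interpret N: module R N by fact
  note h = mod_homD[OF M N f] and YD = N.smodD[OF Y]
  show ?thesis by (rule M.smoduleI) (use h YD in auto)
qed

context module
begin

lemma in_set_add: "x \<in> A <+>\<^bsub>M\<^esub> B \<longleftrightarrow> (\<exists>a\<in>A. \<exists>b\<in>B. x = a \<oplus>\<^bsub>M\<^esub> b)"
  by (auto simp: set_add_def')

lemma set_addI: "a \<in> A \<Longrightarrow> b \<in> B \<Longrightarrow> a \<oplus>\<^bsub>M\<^esub> b \<in> A <+>\<^bsub>M\<^esub> B"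
  by (auto simp: in_set_add)

lemma set_add_submodule:
  assumes A: "submodule A R M" and B: "submodule B R M"
  shows "submodule (A <+>\<^bsub>M\<^esub> B) R M" "A \<subseteq> A <+>\<^bsub>M\<^esub> B" "B \<subseteq> A <+>\<^bsub>M\<^esub> B"
proof -
  note AD = smodD[OF A] and BD = smodD[OF B]
  show "A \<subseteq> A <+>\<^bsub>M\<^esub> B"
  proof
    fix a assume "a \<in> A"
    then have "a = a \<oplus>\<^bsub>M\<^esub> \<zero>\<^bsub>M\<^esub>" using AD by auto
    then show "a \<in> A <+>\<^bsub>M\<^esub> B" using BD(1) \<open>a \<in> A\<close> unfolding in_set_add by blast
  qed
  show "B \<subseteq> A <+>\<^bsub>M\<^esub> B"
  proof
    fix b assume "b \<in> B"
    then have "b = \<zero>\<^bsub>M\<^esub> \<oplus>\<^bsub>M\<^esub> b" using BD by auto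
    then show "b \<in> A <+>\<^bsub>M\<^esub> B" using AD(1) \<open>b \<in> B\<close> unfolding in_set_add by blast
  qed
  show "submodule (A <+>\<^bsub>M\<^esub> B) R M"
  proof (rule smoduleI)
    show "A <+>\<^bsub>M\<^esub> B \<subseteq> carrier M" using AD BD by (auto simp: in_set_add)
    show "\<zero>\<^bsub>M\<^esub> \<in> A <+>\<^bsub>M\<^esub> B" using \<open>A \<subseteq> A <+>\<^bsub>M\<^esub> B\<close> AD by blast
    fix x y assume "x \<in> A <+>\<^bsub>M\<^esub> B" "y \<in> A <+>\<^bsub>M\<^esub> B"
    then obtain a b a' b' where *: "a \<in> A" "b \<in> B" "a' \<in> A" "b' \<in> B" "x = a \<oplus>\<^bsub>M\<^esub> b" "y = a' \<oplus>\<^bsub>M\<^esub> b'"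
      by (auto simp: in_set_add)
    then have "x \<oplus>\<^bsub>M\<^esub> y = (a \<oplus>\<^bsub>M\<^esub> a') \<oplus>\<^bsub>M\<^esub> (b \<oplus>\<^bsub>M\<^esub> b')"
      using AD(2) BD(2) by (simp add: M.a_ac)
    then show "x \<oplus>\<^bsub>M\<^esub> y \<in> A <+>\<^bsub>M\<^esub> B" using AD(3) BD(3) * by (simp add: set_addI)
  next
    fix r x assume r: "r \<in> carrier R" and "x \<in> A <+>\<^bsub>M\<^esub> B"
    then obtain a b where *: "a \<in> A" "b \<in> B" "x = a \<oplus>\<^bsub>M\<^esub> b" by (auto simp: in_set_add)
    then have "r \<odot>\<^bsub>M\<^esub> x = r \<odot>\<^bsub>M\<^esub> a \<oplus>\<^bsub>M\<^esub> r \<odot>\<^bsub>M\<^esub> b" using AD(2) BD(2) r by (simp add: smult_r_distr)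
    then show "r \<odot>\<^bsub>M\<^esub> x \<in> A <+>\<^bsub>M\<^esub> B" using AD(6) BD(6) * r by (simp add: set_addI)
  qed
qed

lemma neg_zero: "\<ominus>\<^bsub>M\<^esub> \<zero>\<^bsub>M\<^esub> = \<zero>\<^bsub>M\<^esub>"
  by (metis M.minus_equality M.l_zero M.zero_closed)

lemma diff_eq_zero:
  assumes "x \<in> carrier M" "y \<in> carrier M" "x \<ominus>\<^bsub>M\<^esub> y = \<zero>\<^bsub>M\<^esub>"
  shows "x = y"
  using assms by (metis M.add.inv_solve_right' M.l_zero M.minus_eq M.zero_closed)

lemma add_diff_cancel:
  assumes "x \<in> carrier M" "y \<in> carrier M"
  shows "y \<oplus>\<^bsub>M\<^esub> (x \<ominus>\<^bsub>M\<^esub> y) = x" "(x \<ominus>\<^bsub>M\<^esub> y) \<oplus>\<^bsub>M\<^esub> y = x" "(y \<oplus>\<^bsub>M\<^esub> x) \<ominus>\<^bsub>M\<^esub> y = x" "(x \<oplus>\<^bsub>M\<^esub> y) \<ominus>\<^bsub>M\<^esub> y = x"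
proof -
  show *: "(x \<ominus>\<^bsub>M\<^esub> y) \<oplus>\<^bsub>M\<^esub> y = x" using assms by (simp add: a_minus_def M.a_assoc M.l_neg)
  then show "y \<oplus>\<^bsub>M\<^esub> (x \<ominus>\<^bsub>M\<^esub> y) = x" using assms by (simp add: M.a_comm)
  show "(x \<oplus>\<^bsub>M\<^esub> y) \<ominus>\<^bsub>M\<^esub> y = x" using assms by (simp add: a_minus_def M.a_assoc M.r_neg)
  then show "(y \<oplus>\<^bsub>M\<^esub> x) \<ominus>\<^bsub>M\<^esub> y = x" using assms by (simp add: M.a_comm)
qed

lemma add_add_swap:
  assumes "a \<in> carrier M" "b \<in> carrier M" "c \<in> carrier M" "d \<in> carrier M"
  shows "(a \<oplus>\<^bsub>M\<^esub> b) \<oplus>\<^bsub>M\<^esub> (c \<oplus>\<^bsub>M\<^esub> d) = (a \<oplus>\<^bsub>M\<^esub> c) \<oplus>\<^bsub>M\<^esub> (b \<oplus>\<^bsub>M\<^esub> d)"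
  using assms by (simp add: M.a_ac)

lemma diff_add_diff:
  assumes "a \<in> carrier M" "b \<in> carrier M" "c \<in> carrier M" "d \<in> carrier M"
  shows "(a \<oplus>\<^bsub>M\<^esub> b) \<ominus>\<^bsub>M\<^esub> (c \<oplus>\<^bsub>M\<^esub> d) = (a \<ominus>\<^bsub>M\<^esub> c) \<oplus>\<^bsub>M\<^esub> (b \<ominus>\<^bsub>M\<^esub> d)"
  using assms by (simp add: a_minus_def M.minus_add add_add_swap)

lemma direct_sum_unique:
  assumes A: "submodule A R M" and B: "submodule B R M" and "A \<inter> B = {\<zero>\<^bsub>M\<^esub>}"
    and "a \<in> A" "a' \<in> A" "b \<in> B" "b' \<in> B" "a \<oplus>\<^bsub>M\<^esub> b = a' \<oplus>\<^bsub>M\<^esub> b'"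
  shows "a = a'" "b = b'"
proof -
  note AD = smodD[OF A] and BD = smodD[OF B]
  have c: "a \<in> carrier M" "a' \<in> carrier M" "b \<in> carrier M" "b' \<in> carrier M" using assms AD BD by auto
  have "(a \<ominus>\<^bsub>M\<^esub> a') \<oplus>\<^bsub>M\<^esub> (b \<ominus>\<^bsub>M\<^esub> b') = \<zero>\<^bsub>M\<^esub>"
    using c diff_add_diff[of a b a' b'] unfolding assms(8) by (simp add: a_minus_def M.r_neg)
  then have "a \<ominus>\<^bsub>M\<^esub> a' = \<ominus>\<^bsub>M\<^esub> (b \<ominus>\<^bsub>M\<^esub> b')"
    using c by (metis M.minus_closed M.minus_equality M.minus_minus)
  then have "a \<ominus>\<^bsub>M\<^esub> a' = \<zero>\<^bsub>M\<^esub>" using AD(5) BD(4,5) assms(3-7) by (metis IntI singletonD)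
  then show "a = a'" using c diff_eq_zero by blast
  then show "b = b'" using assms(8) c by auto
qed

end

section \<open>Baer injectivity\<close>

definition ideal_hom :: "('r, 'b) ring_scheme \<Rightarrow> ('r, 'm, 'c) module_scheme \<Rightarrow> 'r set \<Rightarrow> 'm set \<Rightarrow> ('r \<Rightarrow> 'm) set"
  where "ideal_hom R M J B = {g \<in> J \<rightarrow> B. (\<forall>r\<in>J. \<forall>s\<in>J. g (r \<oplus>\<^bsub>R\<^esub> s) = g r \<oplus>\<^bsub>M\<^esub> g s) \<and>
    (\<forall>a\<in>carrier R. \<forall>r\<in>J. g (a \<otimes>\<^bsub>R\<^esub> r) = a \<odot>\<^bsub>M\<^esub> g r)}"

text \<open>
  Injectivity of a submodule \<open>B\<close> in the form of Baer's criterion: homomorphisms from ideals into \<open>B\<close>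
  are multiplications by elements of \<open>B\<close>.
\<close>

definition baer_injective :: "('r, 'b) ring_scheme \<Rightarrow> ('r, 'm, 'c) module_scheme \<Rightarrow> 'm set \<Rightarrow> bool"
  where "baer_injective R M B \<longleftrightarrow> submodule B R M \<and>
    (\<forall>J g. ideal J R \<and> g \<in> ideal_hom R M J B \<longrightarrow> (\<exists>b\<in>B. \<forall>r\<in>J. g r = r \<odot>\<^bsub>M\<^esub> b))"

lemma baer_injectiveD: "baer_injective R M B \<Longrightarrow> submodule B R M"
  by (simp add: baer_injective_def)

lemma baer_injectiveE:
  assumes "baer_injective R M B" "ideal J R" "g \<in> ideal_hom R M J B"
  obtains b where "b \<in> B" "\<And>r. r \<in> J \<Longrightarrow> g r = r \<odot>\<^bsub>M\<^esub> b"
  using assms unfolding baer_injective_def by blast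

lemma (in cring) ideal_module:
  assumes "ideal J R"
  shows "module R ((regular_module R)\<lparr>carrier := J\<rparr>)"
proof -
  interpret J: ideal J R by fact
  have reg: "module R (regular_module R)"
  proof (rule moduleI)
    show "abelian_group (regular_module R)"
      by (rule abelian_groupI) (auto simp: regular_module_def a_ac l_distr r_distr m_assoc intro!: bexI[of _ "\<ominus> x" for x] l_neg)
  qed (auto simp: regular_module_def l_distr r_distr m_assoc is_cring)
  interpret reg: module R "regular_module R" by fact
  have "submodule J R (regular_module R)"
    by (rule reg.smoduleI) (auto simp: regular_module_def J.I_l_closed)
  then show ?thesis using submodule.submodule_is_module reg by blast
qed

text \<open>
  The test maps are the inclusions of ideals into \<open>R\<close>.
\<close>

lemma injective_module_baer_injective:
  assumes "injective_module R E"
  shows "baer_injective R E (carrier E)"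
proof -
  interpret E: module R E using assms by (simp add: injective_module_def)
  show ?thesis unfolding baer_injective_def
  proof (intro conjI allI impI E.carrier_is_submodule)
    fix J g assume *: "ideal J R \<and> g \<in> ideal_hom R E J (carrier E)"
    let ?A = "(regular_module R)\<lparr>carrier := J\<rparr>" and ?B = "(regular_module R)\<lparr>carrier := carrier R\<rparr>"
    interpret J: ideal J R using * by blast
    have "module R ?A" "module R ?B" using E.R.ideal_module * E.R.oneideal by blast+
    moreover have "id \<in> mod_hom R ?A ?B" "inj_on id (carrier ?A)"
      using J.Icarr by (auto simp: mod_hom_def regular_module_def)
    moreover have "g \<in> mod_hom R ?A E"
      using * by (auto simp: mod_hom_def regular_module_def ideal_hom_def)
    ultimately obtain h where h: "h \<in> mod_hom R ?B E" "\<forall>a\<in>carrier ?A. h (id a) = g a"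
      using assms unfolding injective_module_def by blast
    have "g r = r \<odot>\<^bsub>E\<^esub> h \<one>\<^bsub>R\<^esub>" if "r \<in> J" for r
    proof -
      have "h (r \<otimes>\<^bsub>R\<^esub> \<one>\<^bsub>R\<^esub>) = r \<odot>\<^bsub>E\<^esub> h \<one>\<^bsub>R\<^esub>"
        using h(1) J.Icarr[OF that] E.R.one_closed by (simp add: mod_hom_def regular_module_def del: E.R.r_one)
      then show ?thesis using h(2) that J.Icarr by (simp add: regular_module_def)
    qed
    moreover have "h \<one>\<^bsub>R\<^esub> \<in> carrier E" using h(1) by (auto simp: mod_hom_def regular_module_def)
    ultimately show "\<exists>b\<in>carrier E. \<forall>r\<in>J. g r = r \<odot>\<^bsub>E\<^esub> b" by blast
  qed
qed

context module
begin

lemma ideal_homD: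
  assumes "ideal J R" "submodule B R M" "g \<in> ideal_hom R M J B"
  shows "\<And>r. r \<in> J \<Longrightarrow> g r \<in> B" "\<And>r. r \<in> J \<Longrightarrow> g r \<in> carrier M"
    "\<And>r s. r \<in> J \<Longrightarrow> s \<in> J \<Longrightarrow> g (r \<oplus> s) = g r \<oplus>\<^bsub>M\<^esub> g s"
    "\<And>a r. a \<in> carrier R \<Longrightarrow> r \<in> J \<Longrightarrow> g (a \<otimes> r) = a \<odot>\<^bsub>M\<^esub> g r"
    "\<And>a r. a \<in> carrier R \<Longrightarrow> r \<in> J \<Longrightarrow> g (r \<otimes> a) = a \<odot>\<^bsub>M\<^esub> g r"
    "g \<zero> = \<zero>\<^bsub>M\<^esub>"
proof -
  interpret J: ideal J R by fact
  note BD = smodD[OF assms(2)]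
  show B: "\<And>r. r \<in> J \<Longrightarrow> g r \<in> B" and "\<And>r s. r \<in> J \<Longrightarrow> s \<in> J \<Longrightarrow> g (r \<oplus> s) = g r \<oplus>\<^bsub>M\<^esub> g s"
    and m: "\<And>a r. a \<in> carrier R \<Longrightarrow> r \<in> J \<Longrightarrow> g (a \<otimes> r) = a \<odot>\<^bsub>M\<^esub> g r"
    using assms(3) by (auto simp: ideal_hom_def)
  show c: "g r \<in> carrier M" if "r \<in> J" for r by (rule BD(2)[OF B[OF that]])
  show "g (r \<otimes> a) = a \<odot>\<^bsub>M\<^esub> g r" if "a \<in> carrier R" "r \<in> J" for a r
    using m[OF that] R.m_comm[OF that(1) J.Icarr[OF that(2)]] by simp
  have "g (\<zero> \<otimes> \<zero>) = \<zero> \<odot>\<^bsub>M\<^esub> g \<zero>" by (rule m) auto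
  then show "g \<zero> = \<zero>\<^bsub>M\<^esub>" using c by simp
qed

text \<open>
  An injective submodule is a direct summand. The complement is a submodule \<open>Y\<close> maximal with
  \<open>B \<inter> Y = 0\<close>. For \<open>e\<close> outside \<open>B + Y\<close>, the \<open>B\<close>-components of the multiples of \<open>e\<close> in \<open>B + Y\<close> define a
  homomorphism from an ideal to \<open>B\<close>, hence are the multiples of some \<open>b \<in> B\<close>; then \<open>Y + R(e - b)\<close> still
  meets \<open>B\<close> trivially and contradicts maximality.
\<close>

lemma complement_exists:
  assumes B: "baer_injective R M B"
  obtains Y where "submodule Y R M" "B \<inter> Y = {\<zero>\<^bsub>M\<^esub>}" "B <+>\<^bsub>M\<^esub> Y = carrier M"
proof -
  have Bs: "submodule B R M" using B by (rule baer_injectiveD)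
  note BD = smodD[OF Bs]
  define \<Y> where "\<Y> = {Y. submodule Y R M \<and> B \<inter> Y = {\<zero>\<^bsub>M\<^esub>}}"
  have ex: "\<exists>Y\<in>\<Y>. \<forall>X\<in>\<Y>. Y \<subseteq> X \<longrightarrow> X = Y"
  proof (rule subset_Zorn_nonempty)
    show "\<Y> \<noteq> {}" using zero_smod BD(1) by (auto simp: \<Y>_def)
    fix C assume C: "C \<noteq> {}" "subset.chain \<Y> C"
    have sub: "submodule Y R M" "B \<inter> Y = {\<zero>\<^bsub>M\<^esub>}" if "Y \<in> C" for Y
      using that C(2) by (auto simp: subset_chain_def \<Y>_def)
    have tot: "X \<subseteq> Y \<or> Y \<subseteq> X" if "X \<in> C" "Y \<in> C" for X Y
      using that C(2) by (auto simp: subset_chain_def)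
    have "submodule (\<Union>C) R M"
    proof (rule smoduleI)
      show "\<Union>C \<subseteq> carrier M" using sub smodD(2) by blast
      show "\<zero>\<^bsub>M\<^esub> \<in> \<Union>C" using C(1) sub smodD(1) by blast
      show "x \<oplus>\<^bsub>M\<^esub> y \<in> \<Union>C" if xy: "x \<in> \<Union>C" "y \<in> \<Union>C" for x y
      proof -
        obtain X Y where "X \<in> C" "Y \<in> C" "x \<in> X" "y \<in> Y" using xy by blast
        then obtain Z where "Z \<in> C" "x \<in> Z" "y \<in> Z" using tot by blast
        then show ?thesis using smodD(3)[OF sub(1)] by blast
      qed
      show "a \<odot>\<^bsub>M\<^esub> x \<in> \<Union>C" if "a \<in> carrier R" "x \<in> \<Union>C" for a x
        using that smodD(6)[OF sub(1)] by blast
    qed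
    moreover have "B \<inter> \<Union>C = {\<zero>\<^bsub>M\<^esub>}" using sub(2) C(1) by blast
    ultimately show "\<Union>C \<in> \<Y>" by (simp add: \<Y>_def)
  qed
  then obtain Y where Y': "Y \<in> \<Y>" "\<And>X. X \<in> \<Y> \<Longrightarrow> Y \<subseteq> X \<Longrightarrow> X = Y" by blast
  then have Y: "submodule Y R M" "B \<inter> Y = {\<zero>\<^bsub>M\<^esub>}" by (simp_all add: \<Y>_def)
  have maxi: "X = Y" if "submodule X R M" "B \<inter> X = {\<zero>\<^bsub>M\<^esub>}" "Y \<subseteq> X" for X
    using Y'(2)[of X] that by (simp add: \<Y>_def)
  note YD = smodD[OF Y(1)]
  note sum = set_add_submodule[OF Bs Y(1)] and uniq = direct_sum_unique[OF Bs Y]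
  note SD = smodD[OF sum(1)]
  have "e \<in> B <+>\<^bsub>M\<^esub> Y" if e: "e \<in> carrier M" for e
  proof -
    define J where "J = conductor R M (B <+>\<^bsub>M\<^esub> Y) e"
    have J: "ideal J R" unfolding J_def by (rule conductor_ideal[OF sum(1) e])
    have "\<forall>r\<in>J. \<exists>b\<in>B. \<exists>y\<in>Y. r \<odot>\<^bsub>M\<^esub> e = b \<oplus>\<^bsub>M\<^esub> y"
      unfolding J_def conductor_def in_set_add by blast
    then obtain g h where gh: "\<forall>r\<in>J. g r \<in> B \<and> h r \<in> Y \<and> r \<odot>\<^bsub>M\<^esub> e = g r \<oplus>\<^bsub>M\<^esub> h r" by metis
    then have c: "g r \<in> carrier M" "h r \<in> carrier M" if "r \<in> J" for r using that BD(2) YD(2) by auto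
    interpret J: ideal J R by fact
    have "g \<in> ideal_hom R M J B"
      unfolding ideal_hom_def
    proof (intro CollectI conjI ballI)
      show "g \<in> J \<rightarrow> B" using gh by auto
      fix r s assume rs: "r \<in> J" "s \<in> J"
      have "g (r \<oplus> s) \<oplus>\<^bsub>M\<^esub> h (r \<oplus> s) = (r \<oplus> s) \<odot>\<^bsub>M\<^esub> e" using gh rs by simp
      also have "\<dots> = (g r \<oplus>\<^bsub>M\<^esub> h r) \<oplus>\<^bsub>M\<^esub> (g s \<oplus>\<^bsub>M\<^esub> h s)"
        using bspec[OF gh rs(1)] bspec[OF gh rs(2)] e J.Icarr[OF rs(1)] J.Icarr[OF rs(2)]
        by (simp add: smult_l_distr)
      also have "\<dots> = (g r \<oplus>\<^bsub>M\<^esub> g s) \<oplus>\<^bsub>M\<^esub> (h r \<oplus>\<^bsub>M\<^esub> h s)"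
        using c rs by (simp add: M.a_ac)
      finally show "g (r \<oplus> s) = g r \<oplus>\<^bsub>M\<^esub> g s"
        by (rule uniq(1)[rotated -1]) (use gh rs BD YD in auto)
    next
      fix a r assume ar: "a \<in> carrier R" "r \<in> J"
      then have "a \<otimes> r \<in> J" using J.I_l_closed by blast
      then have "g (a \<otimes> r) \<oplus>\<^bsub>M\<^esub> h (a \<otimes> r) = (a \<otimes> r) \<odot>\<^bsub>M\<^esub> e" using gh by simp
      also have "\<dots> = a \<odot>\<^bsub>M\<^esub> g r \<oplus>\<^bsub>M\<^esub> a \<odot>\<^bsub>M\<^esub> h r"
        using bspec[OF gh ar(2)] ar e J.Icarr[OF ar(2)] c[OF ar(2)] by (simp add: smult_assoc1 smult_r_distr)
      finally show "g (a \<otimes> r) = a \<odot>\<^bsub>M\<^esub> g r"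
        by (rule uniq(1)[rotated -1]) (use gh ar \<open>a \<otimes> r \<in> J\<close> BD YD in auto)
    qed
    then obtain b where b: "b \<in> B" "\<And>r. r \<in> J \<Longrightarrow> g r = r \<odot>\<^bsub>M\<^esub> b"
      using baer_injectiveE[OF B J] by blast
    define e' where "e' = e \<ominus>\<^bsub>M\<^esub> b"
    have e': "e' \<in> carrier M" "e = b \<oplus>\<^bsub>M\<^esub> e'"
      using e b BD(2) by (auto simp: e'_def add_diff_cancel)
    have re': "r \<odot>\<^bsub>M\<^esub> e' \<in> Y" if r: "r \<in> J" for r
    proof -
      have rc: "r \<in> carrier R" using r J.Icarr by blast
      have bc: "b \<in> carrier M" using b BD by blast
      have "g r \<oplus>\<^bsub>M\<^esub> h r = r \<odot>\<^bsub>M\<^esub> (b \<oplus>\<^bsub>M\<^esub> e')" using gh r e'(2) by auto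
      also have "\<dots> = g r \<oplus>\<^bsub>M\<^esub> r \<odot>\<^bsub>M\<^esub> e'" using rc bc e' b r by (simp add: smult_r_distr)
      finally have "h r = r \<odot>\<^bsub>M\<^esub> e'" using c r rc e' by simp
      then show ?thesis using gh r by auto
    qed
    define X where "X = {y \<oplus>\<^bsub>M\<^esub> r \<odot>\<^bsub>M\<^esub> e' | y r. y \<in> Y \<and> r \<in> carrier R}"
    have X: "y \<oplus>\<^bsub>M\<^esub> r \<odot>\<^bsub>M\<^esub> e' \<in> X" if "y \<in> Y" "r \<in> carrier R" for y r
      using that unfolding X_def by blast
    have "submodule X R M"
    proof (rule smoduleI)
      show "X \<subseteq> carrier M" using YD e' by (auto simp: X_def)
      have "\<zero>\<^bsub>M\<^esub> = \<zero>\<^bsub>M\<^esub> \<oplus>\<^bsub>M\<^esub> \<zero> \<odot>\<^bsub>M\<^esub> e'" using e' by simp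
      then show "\<zero>\<^bsub>M\<^esub> \<in> X" using X[OF YD(1) R.zero_closed] by simp
      fix u v assume "u \<in> X" "v \<in> X"
      then obtain y r z s where *: "y \<in> Y" "r \<in> carrier R" "z \<in> Y" "s \<in> carrier R"
        "u = y \<oplus>\<^bsub>M\<^esub> r \<odot>\<^bsub>M\<^esub> e'" "v = z \<oplus>\<^bsub>M\<^esub> s \<odot>\<^bsub>M\<^esub> e'" by (auto simp: X_def)
      then have "u \<oplus>\<^bsub>M\<^esub> v = (y \<oplus>\<^bsub>M\<^esub> z) \<oplus>\<^bsub>M\<^esub> (r \<oplus> s) \<odot>\<^bsub>M\<^esub> e'"
        using YD(2) e' by (simp add: smult_l_distr M.a_ac)
      then show "u \<oplus>\<^bsub>M\<^esub> v \<in> X" using X YD(3) * by simp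
    next
      fix a u assume a: "a \<in> carrier R" and "u \<in> X"
      then obtain y r where *: "y \<in> Y" "r \<in> carrier R" "u = y \<oplus>\<^bsub>M\<^esub> r \<odot>\<^bsub>M\<^esub> e'" by (auto simp: X_def)
      then have "a \<odot>\<^bsub>M\<^esub> u = a \<odot>\<^bsub>M\<^esub> y \<oplus>\<^bsub>M\<^esub> (a \<otimes> r) \<odot>\<^bsub>M\<^esub> e'"
        using YD(2) e' a by (simp add: smult_r_distr smult_assoc1)
      then show "a \<odot>\<^bsub>M\<^esub> u \<in> X" using X YD(6) * a by simp
    qed
    moreover have YX: "Y \<subseteq> X"
    proof
      fix y assume "y \<in> Y"
      moreover then have "y = y \<oplus>\<^bsub>M\<^esub> \<zero> \<odot>\<^bsub>M\<^esub> e'" using e' YD by simp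
      ultimately show "y \<in> X" using X[OF _ R.zero_closed, of y] by simp
    qed
    moreover have "B \<inter> X = {\<zero>\<^bsub>M\<^esub>}"
    proof
      show "{\<zero>\<^bsub>M\<^esub>} \<subseteq> B \<inter> X" using YX YD(1) BD(1) by blast
      show "B \<inter> X \<subseteq> {\<zero>\<^bsub>M\<^esub>}"
      proof
        fix x assume x: "x \<in> B \<inter> X"
        then obtain y r where *: "y \<in> Y" "r \<in> carrier R" "x = y \<oplus>\<^bsub>M\<^esub> r \<odot>\<^bsub>M\<^esub> e'" by (auto simp: X_def)
        have "r \<odot>\<^bsub>M\<^esub> e' \<in> B <+>\<^bsub>M\<^esub> Y"
          by (rule smod_cancel[OF sum(1), of y]) (use * x e' sum(2,3) in auto)
        then have "r \<odot>\<^bsub>M\<^esub> b \<oplus>\<^bsub>M\<^esub> r \<odot>\<^bsub>M\<^esub> e' \<in> B <+>\<^bsub>M\<^esub> Y"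
          by (rule SD(3)[OF subsetD[OF sum(2) BD(6)[OF *(2) b(1)]]])
        then have "r \<in> J" unfolding J_def conductor_def e'(2) using * e' b BD(2) by (simp add: smult_r_distr)
        then have "x \<in> Y" using re' * YD by auto
        then show "x \<in> {\<zero>\<^bsub>M\<^esub>}" using x Y(2) by blast
      qed
    qed
    ultimately have "X = Y" using maxi by blast
    moreover have "e' \<in> X"
      using X[OF YD(1) R.one_closed] e' by simp
    ultimately show "e \<in> B <+>\<^bsub>M\<^esub> Y" using b(1) set_addI unfolding e'(2) by blast
  qed
  then have "B <+>\<^bsub>M\<^esub> Y = carrier M" using SD(2) by blast
  then show ?thesis using that Y by blast
qed

lemma baer_injective_summand:
  assumes M: "baer_injective R M (carrier M)" and B: "submodule B R M" and Y: "submodule Y R M"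
    and dir: "B \<inter> Y = {\<zero>\<^bsub>M\<^esub>}" "B <+>\<^bsub>M\<^esub> Y = carrier M"
  shows "baer_injective R M Y"
  unfolding baer_injective_def
proof (intro conjI allI impI Y)
  fix J g assume *: "ideal J R \<and> g \<in> ideal_hom R M J Y"
  then interpret J: ideal J R by blast
  note BD = smodD[OF B] and YD = smodD[OF Y]
  have "g \<in> ideal_hom R M J (carrier M)" using * YD(2) by (auto simp: ideal_hom_def)
  then obtain e where e: "e \<in> carrier M" "\<And>r. r \<in> J \<Longrightarrow> g r = r \<odot>\<^bsub>M\<^esub> e"
    using baer_injectiveE[OF M] * by blast
  then obtain b y where bY: "b \<in> B" "y \<in> Y" "e = b \<oplus>\<^bsub>M\<^esub> y" using dir(2) in_set_add by blast
  have "g r = r \<odot>\<^bsub>M\<^esub> y" if r: "r \<in> J" for r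
  proof -
    have c: "r \<in> carrier R" "b \<in> carrier M" "y \<in> carrier M" "g r \<in> Y" "g r \<in> carrier M"
      using ideal_homD(1,2)[OF _ Y conjunct2[OF *]] r J.Icarr[OF r] BD(2) YD(2) bY * by blast+
    have "\<zero>\<^bsub>M\<^esub> \<oplus>\<^bsub>M\<^esub> g r = r \<odot>\<^bsub>M\<^esub> b \<oplus>\<^bsub>M\<^esub> r \<odot>\<^bsub>M\<^esub> y" using e(2) r bY c by (simp add: smult_r_distr)
    then show ?thesis
      by (rule direct_sum_unique(2)[OF B Y dir(1), rotated -1]) (use c BD YD bY in auto)
  qed
  then show "\<exists>b\<in>Y. \<forall>r\<in>J. g r = r \<odot>\<^bsub>M\<^esub> b" using bY by blast
qed

lemma baer_injective_direct_sum:
  assumes A: "baer_injective R M A" and B: "baer_injective R M B" and dir: "A \<inter> B = {\<zero>\<^bsub>M\<^esub>}"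
  shows "baer_injective R M (A <+>\<^bsub>M\<^esub> B)"
  unfolding baer_injective_def
proof (intro conjI allI impI)
  note As = baer_injectiveD[OF A] and Bs = baer_injectiveD[OF B]
  note AD = smodD[OF As] and BD = smodD[OF Bs] and sum = set_add_submodule[OF As Bs]
  show "submodule (A <+>\<^bsub>M\<^esub> B) R M" by fact
  fix J f assume *: "ideal J R \<and> f \<in> ideal_hom R M J (A <+>\<^bsub>M\<^esub> B)"
  then have J: "ideal J R" by blast
  interpret J: ideal J R by fact
  note f = ideal_homD[OF J sum(1) conjunct2[OF *]]
  note uniq = direct_sum_unique[OF As Bs dir]
  have "\<forall>r\<in>J. \<exists>a\<in>A. \<exists>b\<in>B. f r = a \<oplus>\<^bsub>M\<^esub> b" using f(1) by (auto simp: in_set_add)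
  then obtain g h where gh: "\<forall>r\<in>J. g r \<in> A \<and> h r \<in> B \<and> f r = g r \<oplus>\<^bsub>M\<^esub> h r" by metis
  then have c: "g r \<in> carrier M" "h r \<in> carrier M" if "r \<in> J" for r using that AD(2) BD(2) by auto
  have add: "g (r \<oplus> s) = g r \<oplus>\<^bsub>M\<^esub> g s" "h (r \<oplus> s) = h r \<oplus>\<^bsub>M\<^esub> h s" if rs: "r \<in> J" "s \<in> J" for r s
  proof -
    have "g (r \<oplus> s) \<oplus>\<^bsub>M\<^esub> h (r \<oplus> s) = (g r \<oplus>\<^bsub>M\<^esub> h r) \<oplus>\<^bsub>M\<^esub> (g s \<oplus>\<^bsub>M\<^esub> h s)" using gh rs f(3) by (metis J.a_closed)
    also have "\<dots> = (g r \<oplus>\<^bsub>M\<^esub> g s) \<oplus>\<^bsub>M\<^esub> (h r \<oplus>\<^bsub>M\<^esub> h s)" using c rs by (simp add: M.a_ac)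
    finally have eq: "g (r \<oplus> s) \<oplus>\<^bsub>M\<^esub> h (r \<oplus> s) = \<dots>" .
    show "g (r \<oplus> s) = g r \<oplus>\<^bsub>M\<^esub> g s" "h (r \<oplus> s) = h r \<oplus>\<^bsub>M\<^esub> h s"
      by (rule uniq[OF _ _ _ _ eq]; use gh rs AD BD in auto)+
  qed
  have mul: "g (a \<otimes> r) = a \<odot>\<^bsub>M\<^esub> g r" "h (a \<otimes> r) = a \<odot>\<^bsub>M\<^esub> h r" if ar: "a \<in> carrier R" "r \<in> J" for a r
  proof -
    have ar': "a \<otimes> r \<in> J" using ar J.I_l_closed by blast
    have "g (a \<otimes> r) \<oplus>\<^bsub>M\<^esub> h (a \<otimes> r) = a \<odot>\<^bsub>M\<^esub> (g r \<oplus>\<^bsub>M\<^esub> h r)" using gh ar ar' f(4) by metis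
    also have "\<dots> = a \<odot>\<^bsub>M\<^esub> g r \<oplus>\<^bsub>M\<^esub> a \<odot>\<^bsub>M\<^esub> h r" using c ar by (simp add: smult_r_distr)
    finally have eq: "g (a \<otimes> r) \<oplus>\<^bsub>M\<^esub> h (a \<otimes> r) = \<dots>" .
    show "g (a \<otimes> r) = a \<odot>\<^bsub>M\<^esub> g r" "h (a \<otimes> r) = a \<odot>\<^bsub>M\<^esub> h r"
      by (rule uniq[OF _ _ _ _ eq]; use gh ar ar' AD BD in auto)+
  qed
  have "g \<in> ideal_hom R M J A" "h \<in> ideal_hom R M J B" using gh add mul by (auto simp: ideal_hom_def)
  then obtain a b where "a \<in> A" "\<And>r. r \<in> J \<Longrightarrow> g r = r \<odot>\<^bsub>M\<^esub> a" "b \<in> B" "\<And>r. r \<in> J \<Longrightarrow> h r = r \<odot>\<^bsub>M\<^esub> b"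
    using baer_injectiveE[OF A J] baer_injectiveE[OF B J] by metis
  then have "a \<oplus>\<^bsub>M\<^esub> b \<in> A <+>\<^bsub>M\<^esub> B" "\<forall>r\<in>J. f r = r \<odot>\<^bsub>M\<^esub> (a \<oplus>\<^bsub>M\<^esub> b)"
    using gh AD(2) BD(2) J.Icarr by (auto simp: set_addI smult_r_distr)
  then show "\<exists>b\<in>A <+>\<^bsub>M\<^esub> B. \<forall>r\<in>J. f r = r \<odot>\<^bsub>M\<^esub> b" by blast
qed

end

lemma baer_injective_image:
  assumes M: "module R M" and N: "module R N" and f: "f \<in> mod_hom R M N" and Y: "baer_injective R M Y"
    and inj: "\<And>y. y \<in> Y \<Longrightarrow> f y = \<zero>\<^bsub>N\<^esub> \<Longrightarrow> y = \<zero>\<^bsub>M\<^esub>"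
  shows "baer_injective R N (f ` Y)"
  unfolding baer_injective_def
proof (intro conjI allI impI)
  interpret M: module R M by fact
  interpret N: module R N by fact
  note Ys = baer_injectiveD[OF Y]
  note h = mod_homD[OF M N f] and YD = M.smodD[OF Ys]
  show sub: "submodule (f ` Y) R N" by (rule image_submodule[OF M N f Ys])
  fix J g assume *: "ideal J R \<and> g \<in> ideal_hom R N J (f ` Y)"
  then have J: "ideal J R" by blast
  interpret J: ideal J R by fact
  note g = N.ideal_homD[OF J sub conjunct2[OF *]]
  have uniq: "y = z" if "y \<in> Y" "z \<in> Y" "f y = f z" for y z
  proof -
    have c: "y \<in> carrier M" "z \<in> carrier M" using that YD by auto
    then have "f (y \<ominus>\<^bsub>M\<^esub> z) = \<zero>\<^bsub>N\<^esub>" using that(3) h(1,6) by (simp add: N.r_neg a_minus_def)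
    then have "y \<ominus>\<^bsub>M\<^esub> z = \<zero>\<^bsub>M\<^esub>" using inj YD(5) that by blast
    then show ?thesis using c M.diff_eq_zero by blast
  qed
  have "\<forall>r\<in>J. \<exists>y\<in>Y. g r = f y" using g(1) by auto
  then obtain k where k: "\<forall>r\<in>J. k r \<in> Y \<and> g r = f (k r)" by metis
  then have c: "k r \<in> carrier M" if "r \<in> J" for r using that YD by auto
  have "k \<in> ideal_hom R M J Y" unfolding ideal_hom_def
  proof (intro CollectI conjI ballI)
    show "k \<in> J \<rightarrow> Y" using k by auto
    show "k (r \<oplus>\<^bsub>R\<^esub> s) = k r \<oplus>\<^bsub>M\<^esub> k s" if "r \<in> J" "s \<in> J" for r s
      using that k J.a_closed[OF that] g(3)[OF that] by (intro uniq) (simp_all add: YD(3) h(2) c)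
    show "k (a \<otimes>\<^bsub>R\<^esub> r) = a \<odot>\<^bsub>M\<^esub> k r" if "a \<in> carrier R" "r \<in> J" for a r
      using that k J.I_l_closed[OF that(2,1)] g(4)[OF that] by (intro uniq) (simp_all add: YD(6) h(3) c)
  qed
  then obtain y where "y \<in> Y" "\<And>r. r \<in> J \<Longrightarrow> k r = r \<odot>\<^bsub>M\<^esub> y"
    using baer_injectiveE[OF Y J] by blast
  then show "\<exists>b\<in>f ` Y. \<forall>r\<in>J. g r = r \<odot>\<^bsub>N\<^esub> b"
    using k h(3) YD(2) J.Icarr by (metis imageI)
qed

text \<open>
  If an injective submodule \<open>B\<close> contains all torsion, then \<open>M/B\<close> is torsion-free, since it is
  isomorphic to a complement of \<open>B\<close>.
\<close>

lemma (in module) saturation_baer_injective: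
  assumes B: "baer_injective R M B" and T: "saturation R I M {\<zero>\<^bsub>M\<^esub>} \<subseteq> B" and I: "I \<subseteq> carrier R"
  shows "saturation R I M B \<subseteq> B"
proof
  fix e assume e: "e \<in> saturation R I M B"
  note Bs = baer_injectiveD[OF B]
  note BD = smodD[OF Bs]
  obtain Y where Y: "submodule Y R M" "B \<inter> Y = {\<zero>\<^bsub>M\<^esub>}" "B <+>\<^bsub>M\<^esub> Y = carrier M"
    by (rule complement_exists[OF B])
  note YD = smodD[OF Y(1)]
  have "e \<in> carrier M" using e by (simp add: saturation_def)
  then obtain b y where *: "b \<in> B" "y \<in> Y" "e = b \<oplus>\<^bsub>M\<^esub> y" using Y(3) in_set_add by blast
  have c: "b \<in> carrier M" "y \<in> carrier M" using * BD YD by auto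
  have "\<exists>n::nat. (a [^] n) \<odot>\<^bsub>M\<^esub> y \<in> {\<zero>\<^bsub>M\<^esub>}" if a: "a \<in> I" for a
  proof -
    have ac: "a \<in> carrier R" using a I by blast
    obtain n :: nat where n: "(a [^] n) \<odot>\<^bsub>M\<^esub> e \<in> B" using e a by (auto simp: saturation_def)
    then have "(a [^] n) \<odot>\<^bsub>M\<^esub> b \<oplus>\<^bsub>M\<^esub> (a [^] n) \<odot>\<^bsub>M\<^esub> y \<in> B"
      using * c ac by (simp add: smult_r_distr)
    then have "(a [^] n) \<odot>\<^bsub>M\<^esub> y \<in> B"
      using smod_cancel[OF Bs] BD(6) *(1) c ac by (metis R.nat_pow_closed smult_closed)
    moreover have "(a [^] n) \<odot>\<^bsub>M\<^esub> y \<in> Y" using YD(6) * ac by blast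
    ultimately show ?thesis using Y(2) by blast
  qed
  then have "y \<in> B" using T c by (auto simp: saturation_def)
  then show "e \<in> B" using * BD by blast
qed

section \<open>The torsion part of an injective module\<close>

text \<open>
  A homomorphism on \<open>J\<close> that vanishes on \<open>J \<inter> Q\<close> extends by zero on \<open>Q\<close> to \<open>J + Q\<close>, and then to \<open>R\<close>.
\<close>

lemma (in noetherian_module) ideal_extension_killing:
  assumes M: "baer_injective R M (carrier M)" and J: "ideal J R" and g: "g \<in> ideal_hom R M J (carrier M)"
    and Q: "ideal Q R" and kill: "\<And>r. r \<in> J \<Longrightarrow> r \<in> Q \<Longrightarrow> g r = \<zero>\<^bsub>M\<^esub>"
  obtains e where "e \<in> carrier M" "\<And>r. r \<in> J \<Longrightarrow> g r = r \<odot>\<^bsub>M\<^esub> e" "\<And>q. q \<in> Q \<Longrightarrow> q \<odot>\<^bsub>M\<^esub> e = \<zero>\<^bsub>M\<^esub>"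
proof -
  interpret J: ideal J R by fact
  interpret Q: ideal Q R by fact
  note g = ideal_homD[OF J carrier_is_submodule g]
  \<comment> \<open>The extension to \<open>J + Q\<close>; the value does not depend on the representative \<open>j\<close>.\<close>
  define h where "h w = g (SOME j. j \<in> J \<and> w \<ominus> j \<in> Q)" for w
  have h: "h w = g j" if "j \<in> J" "w \<in> carrier R" "w \<ominus> j \<in> Q" for w j
  proof -
    define j' where "j' = (SOME j. j \<in> J \<and> w \<ominus> j \<in> Q)"
    have j': "j' \<in> J" "w \<ominus> j' \<in> Q" unfolding j'_def using that by (metis (mono_tags, lifting) someI_ex)+
    have c: "j \<in> carrier R" "j' \<in> carrier R" using that(1) j'(1) J.Icarr by auto
    have "(w \<ominus> j) \<oplus> \<ominus> (w \<ominus> j') \<in> Q" using that(3) j'(2) Q.a_closed Q.a_inv_closed by blast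
    also have "(w \<ominus> j) \<oplus> \<ominus> (w \<ominus> j') = j' \<ominus> j"
      using c that(2) by algebra
    finally have "g (j' \<ominus> j) = \<zero>\<^bsub>M\<^esub>"
      using kill that(1) j'(1) J.a_closed J.a_inv_closed by (simp add: a_minus_def)
    moreover have "g j' = g ((j' \<ominus> j) \<oplus> j)" using c by (simp add: a_minus_def R.a_assoc R.l_neg)
    moreover have "g ((j' \<ominus> j) \<oplus> j) = g (j' \<ominus> j) \<oplus>\<^bsub>M\<^esub> g j"
      using that(1) j'(1) by (intro g(3)) (auto simp: a_minus_def)
    ultimately have "g j' = g j" using g(2)[OF that(1)] by simp
    then show ?thesis by (simp add: h_def j'_def)
  qed
  define K where "K = set_add R J Q"
  have K: "ideal K R" unfolding K_def using J Q by (rule R.add_ideals)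
  interpret K: ideal K R by fact
  have inK: "\<exists>j\<in>J. w \<ominus> j \<in> Q" if w: "w \<in> K" for w
  proof -
    obtain j q where jq: "j \<in> J" "q \<in> Q" "w = j \<oplus> q" using w by (auto simp: K_def set_add_def')
    have c: "j \<in> carrier R" "q \<in> carrier R" using jq J.Icarr Q.Icarr by auto
    have "w \<ominus> j = q" unfolding jq(3) using c by algebra
    then show ?thesis using jq by metis
  qed
  have "h \<in> ideal_hom R M K (carrier M)"
    unfolding ideal_hom_def
  proof (intro CollectI conjI ballI)
    show "h \<in> K \<rightarrow> carrier M" using inK h g(2) K.Icarr by (metis Pi_I)
    fix v w assume vw: "v \<in> K" "w \<in> K"
    then obtain i j where ij: "i \<in> J" "v \<ominus> i \<in> Q" "j \<in> J" "w \<ominus> j \<in> Q" using inK by meson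
    have c: "v \<in> carrier R" "w \<in> carrier R" "i \<in> carrier R" "j \<in> carrier R"
      using vw ij K.Icarr J.Icarr by auto
    have "(v \<ominus> i) \<oplus> (w \<ominus> j) \<in> Q" using ij by blast
    also have "(v \<ominus> i) \<oplus> (w \<ominus> j) = (v \<oplus> w) \<ominus> (i \<oplus> j)" using c by algebra
    finally have "h (v \<oplus> w) = g (i \<oplus> j)" using ij c h[of "i \<oplus> j" "v \<oplus> w"] by blast
    then show "h (v \<oplus> w) = h v \<oplus>\<^bsub>M\<^esub> h w" using h[OF ij(1) c(1) ij(2)] h[OF ij(3) c(2) ij(4)] g(3) ij by simp
  next
    fix a w assume a: "a \<in> carrier R" and w: "w \<in> K"
    then obtain j where j: "j \<in> J" "w \<ominus> j \<in> Q" using inK by meson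
    have c: "w \<in> carrier R" "j \<in> carrier R" using w j K.Icarr J.Icarr by auto
    have "a \<otimes> (w \<ominus> j) \<in> Q" using a j Q.I_l_closed by blast
    also have "a \<otimes> (w \<ominus> j) = a \<otimes> w \<ominus> a \<otimes> j" using c a by algebra
    finally have "h (a \<otimes> w) = g (a \<otimes> j)" using h[of "a \<otimes> j" "a \<otimes> w"] a c j J.I_l_closed by blast
    then show "h (a \<otimes> w) = a \<odot>\<^bsub>M\<^esub> h w" using h[OF j(1) c(1) j(2)] g(4) a j by simp
  qed
  then obtain e where e: "e \<in> carrier M" "\<And>w. w \<in> K \<Longrightarrow> h w = w \<odot>\<^bsub>M\<^esub> e"
    using baer_injectiveE[OF M K] by blast
  have "g r = r \<odot>\<^bsub>M\<^esub> e" if r: "r \<in> J" for r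
  proof -
    have "r \<oplus> \<zero> \<in> K" using r Q.zero_closed unfolding K_def set_add_def' by blast
    then have "r \<in> K" using J.Icarr[OF r] by simp
    moreover have "h r = g r" by (rule h) (use r J.Icarr Q.zero_closed in \<open>auto simp: a_minus_def R.r_neg\<close>)
    ultimately show ?thesis using e by simp
  qed
  moreover have "q \<odot>\<^bsub>M\<^esub> e = \<zero>\<^bsub>M\<^esub>" if q: "q \<in> Q" for q
  proof -
    have "\<zero> \<oplus> q \<in> K" using q J.zero_closed unfolding K_def set_add_def' by blast
    then have "q \<in> K" using Q.Icarr[OF q] by simp
    moreover have "h q = g \<zero>" by (rule h) (use q Q.Icarr J.zero_closed in \<open>auto simp: a_minus_def\<close>)
    ultimately show ?thesis using e g(6) by simp
  qed
  ultimately show ?thesis using that e(1) by blast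
qed

text \<open>
  Let \<open>g\<close> map an ideal \<open>J\<close> to the torsion part, with kernel \<open>L\<close>, and choose an ideal \<open>Q\<close> maximal
  with \<open>Q \<inter> J = L\<close>. For \<open>a \<in> I\<close> multiplication by some power \<open>b\<close> of \<open>a\<close>
  takes \<open>J\<close> into \<open>L\<close>. If \<open>m\<close> is such that the conductors
  \<open>(Q : b\<^sup>n)\<close> are constant for \<open>n \<ge> m\<close>, then \<open>(Q + R b\<^sup>m) \<inter> J = L\<close>, so \<open>b\<^sup>m \<in> Q\<close>. Hence \<open>Q\<close> contains a power of
  every element of \<open>I\<close>, and an extension of \<open>g\<close> to \<open>R\<close> that vanishes on \<open>Q\<close> has torsion values.
\<close>

lemma (in noetherian_module) torsion_baer_injective:
  assumes M: "baer_injective R M (carrier M)" and I: "I \<subseteq> carrier R"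
  shows "baer_injective R M (saturation R I M {\<zero>\<^bsub>M\<^esub>})"
  unfolding baer_injective_def
proof (intro conjI allI impI)
  let ?T = "saturation R I M {\<zero>\<^bsub>M\<^esub>}"
  show T: "submodule ?T R M" using saturation_smod[OF zero_smod I] .
  fix J g assume *: "ideal J R \<and> g \<in> ideal_hom R M J ?T"
  then have J: "ideal J R" by blast
  interpret J: ideal J R by fact
  note g = ideal_homD[OF J T conjunct2[OF *]]
  have gM: "g \<in> ideal_hom R M J (carrier M)" using * smodD(2)[OF T] by (auto simp: ideal_hom_def)
  define L where "L = {r \<in> J. g r = \<zero>\<^bsub>M\<^esub>}"
  have kernel_ideal: "ideal {r \<in> J. c \<odot>\<^bsub>M\<^esub> g r = \<zero>\<^bsub>M\<^esub>} R" if c: "c \<in> carrier R" for c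
  proof (rule idealI[OF R.ring_axioms])
    show "subgroup {r \<in> J. c \<odot>\<^bsub>M\<^esub> g r = \<zero>\<^bsub>M\<^esub>} (add_monoid R)"
    proof (rule R.add.subgroupI)
      have "\<zero> \<in> {r \<in> J. c \<odot>\<^bsub>M\<^esub> g r = \<zero>\<^bsub>M\<^esub>}" using g(6) c J.zero_closed by simp
      then show "{r \<in> J. c \<odot>\<^bsub>M\<^esub> g r = \<zero>\<^bsub>M\<^esub>} \<noteq> {}" by blast
      fix r assume r: "r \<in> {r \<in> J. c \<odot>\<^bsub>M\<^esub> g r = \<zero>\<^bsub>M\<^esub>}"
      then have "g (\<ominus> r) = (\<ominus> \<one>) \<odot>\<^bsub>M\<^esub> g r" using g(4)[of "\<ominus> \<one>" r] J.Icarr by (simp add: R.l_minus)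
      then show "\<ominus> r \<in> {r \<in> J. c \<odot>\<^bsub>M\<^esub> g r = \<zero>\<^bsub>M\<^esub>}"
        using r c g(2) smult_comm[of c "\<ominus> \<one>" "g r"] by auto
    qed (use J.Icarr g(2,3) c in \<open>auto simp: smult_r_distr\<close>)
  qed (use J.I_l_closed J.I_r_closed g(2,4,5) c in \<open>auto simp: smult_comm[of c]\<close>)
  have "L = {r \<in> J. \<one> \<odot>\<^bsub>M\<^esub> g r = \<zero>\<^bsub>M\<^esub>}" using g(2) by (auto simp: L_def)
  then have L: "ideal L R" using kernel_ideal by simp
  define \<F> where "\<F> = {Q. ideal Q R \<and> Q \<inter> J = L}"
  have "L \<in> \<F>" using L by (auto simp: \<F>_def L_def)
  then have "\<F> \<noteq> {}" by blast
  then obtain Q where Q: "Q \<in> \<F>" "\<And>Q'. Q' \<in> \<F> \<Longrightarrow> Q \<subseteq> Q' \<Longrightarrow> Q' = Q"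
    by (rule ideal_family_has_maximal) (simp_all add: \<F>_def)
  have Qi: "ideal Q R" and QJ: "Q \<inter> J = L" using Q(1) by (simp_all add: \<F>_def)
  interpret Q: ideal Q R by fact
  have powQ: "\<exists>n::nat. a [^] n \<in> Q" if a: "a \<in> I" for a
  proof -
    have ac: "a \<in> carrier R" using a I by blast
    define K where "K n = {r \<in> J. (a [^] n) \<odot>\<^bsub>M\<^esub> g r = \<zero>\<^bsub>M\<^esub>}" for n :: nat
    have "ideal (K n) R" for n unfolding K_def by (rule kernel_ideal[OF R.nat_pow_closed[OF ac]])
    moreover have "K n \<subseteq> K (Suc n)" for n
      using pow_smult_mono[OF zero_smod ac g(2), of _ n "Suc n"] by (auto simp: K_def)
    ultimately obtain N where N: "\<forall>n\<ge>N. K n = K N" by (rule ideal_sequence_stabilizes)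
    define b where "b = a [^] N"
    have bc: "b \<in> carrier R" using ac by (simp add: b_def)
    have bJ: "b \<odot>\<^bsub>M\<^esub> g r = \<zero>\<^bsub>M\<^esub>" if r: "r \<in> J" for r
    proof -
      obtain n :: nat where "(a [^] n) \<odot>\<^bsub>M\<^esub> g r = \<zero>\<^bsub>M\<^esub>" using g(1)[OF r] a by (auto simp: saturation_def)
      then have "(a [^] (max n N)) \<odot>\<^bsub>M\<^esub> g r = \<zero>\<^bsub>M\<^esub>"
        using pow_smult_mono[OF zero_smod ac g(2)[OF r], of n "max n N"] by simp
      then have "r \<in> K (max n N)" using r by (simp add: K_def)
      then have "r \<in> K N" using N by (metis max.cobounded2)
      then show ?thesis by (simp add: b_def K_def)
    qed
    have Qc: "ideal {r \<in> carrier R. c \<otimes> r \<in> Q} R" if "c \<in> carrier R" for c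
    proof (rule idealI[OF R.ring_axioms])
      show "subgroup {r \<in> carrier R. c \<otimes> r \<in> Q} (add_monoid R)"
      proof (rule R.add.subgroupI)
        show "{r \<in> carrier R. c \<otimes> r \<in> Q} \<noteq> {}" using that Q.zero_closed by (auto intro!: exI[of _ \<zero>])
      qed (use that in \<open>auto simp: R.r_minus R.r_distr\<close>)
      fix r x assume rx: "r \<in> {r \<in> carrier R. c \<otimes> r \<in> Q}" "x \<in> carrier R"
      then have "c \<otimes> (x \<otimes> r) = x \<otimes> (c \<otimes> r)" "c \<otimes> (r \<otimes> x) = x \<otimes> (c \<otimes> r)"
        using that by (simp_all add: R.m_ac)
      then show "x \<otimes> r \<in> {r \<in> carrier R. c \<otimes> r \<in> Q}" "r \<otimes> x \<in> {r \<in> carrier R. c \<otimes> r \<in> Q}"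
        using rx Q.I_l_closed by auto
    qed
    define D where "D n = {r \<in> carrier R. (b [^] n) \<otimes> r \<in> Q}" for n :: nat
    have "ideal (D n) R" for n unfolding D_def by (rule Qc[OF R.nat_pow_closed[OF bc]])
    moreover have "D n \<subseteq> D (Suc n)" for n
    proof (clarsimp simp: D_def)
      fix r assume r: "r \<in> carrier R" "(b [^] n) \<otimes> r \<in> Q"
      have "(b [^] n) \<otimes> b \<otimes> r = b \<otimes> ((b [^] n) \<otimes> r)" using r bc by (simp add: R.m_ac)
      then show "(b [^] n) \<otimes> b \<otimes> r \<in> Q" using r bc Q.I_l_closed by simp
    qed
    ultimately obtain m where m: "\<forall>n\<ge>m. D n = D m" by (rule ideal_sequence_stabilizes)
    define c where "c = b [^] m"
    have cc: "c \<in> carrier R" using bc by (simp add: c_def)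
    define Q2 where "Q2 = set_add R Q (PIdl c)"
    have Q2: "ideal Q2 R" unfolding Q2_def using Qi R.cgenideal_ideal[OF cc] by (rule R.add_ideals)
    have QQ2: "Q \<subseteq> Q2"
    proof
      fix q assume q: "q \<in> Q"
      have "\<zero> \<in> PIdl c" using R.cgenideal_ideal[OF cc] additive_subgroup.zero_closed ideal.axioms(1) by blast
      then have "q \<oplus> \<zero> \<in> Q2" using q unfolding Q2_def set_add_def' by blast
      then show "q \<in> Q2" using Q.Icarr[OF q] by simp
    qed
    have "Q2 \<inter> J \<subseteq> L"
    proof
      fix y assume y: "y \<in> Q2 \<inter> J"
      then obtain q r where qr: "q \<in> Q" "r \<in> carrier R" "y = q \<oplus> r \<otimes> c"
        by (auto simp: Q2_def set_add_def' cgenideal_def)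
      have qc: "q \<in> carrier R" using qr Q.Icarr by blast
      have "g (b \<otimes> y) = \<zero>\<^bsub>M\<^esub>" using bJ y g(4) bc by auto
      then have "b \<otimes> y \<in> Q" using y J.I_l_closed bc QJ by (auto simp: L_def)
      moreover have "b \<otimes> q \<in> Q" using qr bc Q.I_l_closed by blast
      ultimately have "b \<otimes> y \<oplus> \<ominus> (b \<otimes> q) \<in> Q" by blast
      also have "b \<otimes> y \<oplus> \<ominus> (b \<otimes> q) = c \<otimes> b \<otimes> r"
        unfolding qr(3) using qc qr(2) bc cc by algebra
      also have "c \<otimes> b = b [^] Suc m" by (simp add: c_def)
      finally have "r \<in> D (Suc m)" using qr(2) by (simp add: D_def)
      then have "r \<in> D m" using m by (metis le_SucI order_refl)
      then have "c \<otimes> r \<in> Q" by (simp add: c_def D_def)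
      then have "y \<in> Q" using qr cc by (simp add: R.m_comm)
      then show "y \<in> L" using y QJ by blast
    qed
    then have "Q2 \<inter> J = L" using QQ2 QJ by blast
    then have "Q2 = Q" using Q(2)[of Q2] Q2 QQ2 by (simp add: \<F>_def)
    moreover have "\<zero> \<oplus> c \<in> Q2"
      using Q.zero_closed R.cgenideal_self[OF cc] unfolding Q2_def set_add_def' by blast
    ultimately have "c \<in> Q" using cc by simp
    moreover have "c = a [^] (N * m)" using ac by (simp add: c_def b_def R.nat_pow_pow)
    ultimately show ?thesis by auto
  qed
  obtain e where e: "e \<in> carrier M" "\<And>r. r \<in> J \<Longrightarrow> g r = r \<odot>\<^bsub>M\<^esub> e" "\<And>q. q \<in> Q \<Longrightarrow> q \<odot>\<^bsub>M\<^esub> e = \<zero>\<^bsub>M\<^esub>"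
    by (rule ideal_extension_killing[OF M J gM Qi]) (use QJ in \<open>auto simp: L_def\<close>)
  have "\<exists>n::nat. (a [^] n) \<odot>\<^bsub>M\<^esub> e \<in> {\<zero>\<^bsub>M\<^esub>}" if "a \<in> I" for a
    using powQ[OF that] e(3) by blast
  then have "e \<in> ?T" using e(1) by (simp add: saturation_def)
  then show "\<exists>b\<in>?T. \<forall>r\<in>J. g r = r \<odot>\<^bsub>M\<^esub> b" using e(2) by blast
qed

section \<open>Complexes of injectives modulo torsion\<close>

abbreviation torsion_part :: "('r, 'b) ring_scheme \<Rightarrow> 'r set \<Rightarrow> ('r, 'm, 'c) module_scheme \<Rightarrow> 'm set"
  where "torsion_part R I M \<equiv> saturation R I M {\<zero>\<^bsub>M\<^esub>}"

definition injective_complex :: "('r, 'b) ring_scheme \<Rightarrow> (nat \<Rightarrow> ('r, 'e, 'c) module_scheme) \<Rightarrow> (nat \<Rightarrow> 'e \<Rightarrow> 'e) \<Rightarrow> bool"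
  where "injective_complex R E \<delta> \<longleftrightarrow> (\<forall>i. module R (E i) \<and> baer_injective R (E i) (carrier (E i)) \<and>
     \<delta> i \<in> mod_hom R (E i) (E (Suc i)) \<and> (\<forall>e\<in>carrier (E i). \<delta> (Suc i) (\<delta> i e) = \<zero>\<^bsub>E (Suc (Suc i))\<^esub>))"

text \<open>
  \<open>Z_mod_tor\<close> and \<open>B_mod_tor\<close> are the preimages in \<open>E i\<close> of the cocycles and coboundaries of the complex of the
  modules \<open>E i\<close> modulo their torsion. If \<open>E\<close> is an injective resolution of \<open>N\<close>, then \<open>Z_mod_tor/B_mod_tor\<close> in degree
  \<open>i \<ge> 1\<close> is the local cohomology of \<open>N\<close> in degree \<open>i + 1\<close>, and in degree \<open>0\<close> it contains \<open>N\<close> modulo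
  torsion with cokernel the first local cohomology of \<open>N\<close>.
\<close>

definition Z_mod_tor :: "('r, 'b) ring_scheme \<Rightarrow> 'r set \<Rightarrow> (nat \<Rightarrow> ('r, 'e, 'c) module_scheme) \<Rightarrow> (nat \<Rightarrow> 'e \<Rightarrow> 'e) \<Rightarrow> nat \<Rightarrow> 'e set"
  where "Z_mod_tor R I E \<delta> i = {e \<in> carrier (E i). \<delta> i e \<in> torsion_part R I (E (Suc i))}"

definition B_mod_tor :: "('r, 'b) ring_scheme \<Rightarrow> 'r set \<Rightarrow> (nat \<Rightarrow> ('r, 'e, 'c) module_scheme) \<Rightarrow> (nat \<Rightarrow> 'e \<Rightarrow> 'e) \<Rightarrow> nat \<Rightarrow> 'e set"
  where "B_mod_tor R I E \<delta> i = coboundaries E \<delta> i <+>\<^bsub>E i\<^esub> torsion_part R I (E i)"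

locale torsion_complex = noetherian_ring R + cring R for R (structure) +
  fixes I :: "'a set" and E :: "nat \<Rightarrow> ('a, 'e, 'c) module_scheme" and \<delta> :: "nat \<Rightarrow> 'e \<Rightarrow> 'e"
  assumes I_ideal: "ideal I R" and cpx: "injective_complex R E \<delta>"
begin

lemma I: "I \<subseteq> carrier R"
  using ideal.Icarr[OF I_ideal] by blast

abbreviation "T i \<equiv> torsion_part R I (E i)"
abbreviation "Z i \<equiv> Z_mod_tor R I E \<delta> i"
abbreviation "B i \<equiv> B_mod_tor R I E \<delta> i"

lemma modE: "module R (E i)" and injE: "baer_injective R (E i) (carrier (E i))"
  and homE: "\<delta> i \<in> mod_hom R (E i) (E (Suc i))"
  and dd: "e \<in> carrier (E i) \<Longrightarrow> \<delta> (Suc i) (\<delta> i e) = \<zero>\<^bsub>E (Suc (Suc i))\<^esub>"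
  using cpx by (auto simp: injective_complex_def)

lemma nmodE: "noetherian_module R (E i)"
  using modE noetherian_ring_axioms by (simp add: noetherian_module_def)

lemmas d = mod_homD[OF modE modE homE]

lemma T_smod: "submodule (T i) R (E i)"
  using module.saturation_smod[OF modE module.zero_smod[OF modE] I] .

lemma Z_smod: "submodule (Z i) R (E i)"
  unfolding Z_mod_tor_def by (rule preimage_submodule[OF modE modE homE T_smod])

lemma coboundaries_smod: "submodule (coboundaries E \<delta> i) R (E i)"
  by (cases i) (auto simp: coboundaries_def intro: module.zero_smod[OF modE]
      image_submodule[OF modE modE homE] module.carrier_is_submodule[OF modE])

lemma B_smod: "submodule (B i) R (E i)"
  and coboundaries_B: "coboundaries E \<delta> i \<subseteq> B i" and T_B: "T i \<subseteq> B i"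
  using module.set_add_submodule[OF modE coboundaries_smod T_smod] by (auto simp: B_mod_tor_def)

lemmas TD = module.smodD[OF modE T_smod]
lemmas ZD = module.smodD[OF modE Z_smod]
lemmas BD = module.smodD[OF modE B_smod]

lemma d_T: "t \<in> T i \<Longrightarrow> \<delta> i t \<in> T (Suc i)"
proof -
  assume t: "t \<in> T i"
  have "\<exists>n::nat. (a [^] n) \<odot>\<^bsub>E (Suc i)\<^esub> \<delta> i t = \<zero>\<^bsub>E (Suc i)\<^esub>" if a: "a \<in> I" for a
  proof -
    obtain n :: nat where "(a [^] n) \<odot>\<^bsub>E i\<^esub> t = \<zero>\<^bsub>E i\<^esub>" using t a by (auto simp: saturation_def)
    moreover have "a [^] n \<in> carrier R" "t \<in> carrier (E i)" using a I t by (auto simp: saturation_def)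
    ultimately show ?thesis using d(3,4) by metis
  qed
  then show ?thesis using t d(1) by (auto simp: saturation_def)
qed

lemma B_0: "B 0 = T 0"
proof -
  interpret module R "E 0" by (rule modE)
  show ?thesis using TD(2) by (auto simp: B_mod_tor_def coboundaries_def set_add_def')
qed

lemma in_B_Suc: "x \<in> B (Suc i) \<longleftrightarrow> (\<exists>e\<in>carrier (E i). \<exists>t\<in>T (Suc i). x = \<delta> i e \<oplus>\<^bsub>E (Suc i)\<^esub> t)"
  by (auto simp: B_mod_tor_def coboundaries_def module.in_set_add[OF modE])

lemma B_Z: "B i \<subseteq> Z i"
proof (cases i)
  case 0
  then show ?thesis using B_0 d_T TD(2) by (auto simp: Z_mod_tor_def)
next
  case (Suc j)
  show ?thesis
  proof
    interpret module R "E (Suc (Suc j))" by (rule modE)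
    fix x assume "x \<in> B i"
    then obtain e t where *: "e \<in> carrier (E j)" "t \<in> T (Suc j)" "x = \<delta> j e \<oplus>\<^bsub>E (Suc j)\<^esub> t"
      using in_B_Suc Suc by blast
    then have "\<delta> (Suc j) x = \<delta> (Suc j) t" using d TD(2) dd by simp
    then show "x \<in> Z i" using * d_T d(1) TD(2) Suc BD(2) \<open>x \<in> B i\<close> by (auto simp: Z_mod_tor_def)
  qed
qed

text \<open>
  Modulo torsion, a complex of injectives whose cohomology is torsion below degree \<open>k\<close> is exact below
  degree \<open>k\<close>, and \<open>E k\<close> has no torsion modulo the coboundaries. By induction the coboundaries \<open>B j\<close> are
  injective: \<open>E j\<close> is the direct sum of \<open>B j\<close> and some \<open>Y\<close>, on which the differential is injective modulo
  torsion, and \<open>B (j + 1)\<close> is the direct sum of the injective modules \<open>\<delta> Y\<close> and \<open>T (j + 1)\<close>. As \<open>E j/B j\<close> is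
  therefore torsion-free, its torsion submodule \<open>Z j/B j\<close> vanishes.
\<close>

lemma exact_below:
  assumes "\<And>j. j < k \<Longrightarrow> Z j \<subseteq> saturation R I (E j) (B j)"
  shows "saturation R I (E k) (B k) \<subseteq> B k" "\<And>j. j < k \<Longrightarrow> Z j = B j"
proof -
  have saturation: "saturation R I (E j) (B j) \<subseteq> B j" if "baer_injective R (E j) (B j)" for j
    by (rule module.saturation_baer_injective[OF modE that T_B I])
  have inj: "baer_injective R (E j) (B j)" if "j \<le> k" for j
    using that
  proof (induction j)
    case 0
    show ?case unfolding B_0 by (rule noetherian_module.torsion_baer_injective[OF nmodE injE I])
  next
    case (Suc j)
    interpret M: module R "E j" by (rule modE)
    interpret N: noetherian_module R "E (Suc j)" by (rule nmodE)
    have BT: "Z j \<subseteq> B j" using assms[of j] saturation Suc by auto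
    have IH: "baer_injective R (E j) (B j)" using Suc by simp
    obtain Y where Y: "submodule Y R (E j)" "B j \<inter> Y = {\<zero>\<^bsub>E j\<^esub>}" "B j <+>\<^bsub>E j\<^esub> Y = carrier (E j)"
      by (rule M.complement_exists[OF IH])
    note YD = M.smodD[OF Y(1)]
    have dY: "y = \<zero>\<^bsub>E j\<^esub>" if "y \<in> Y" "\<delta> j y \<in> T (Suc j)" for y
    proof -
      have "y \<in> Z j" using that YD by (auto simp: Z_mod_tor_def)
      then show ?thesis using BT Y(2) that by blast
    qed
    have "baer_injective R (E (Suc j)) (\<delta> j ` Y)"
      by (rule baer_injective_image[OF modE modE homE M.baer_injective_summand[OF injE B_smod Y]])
        (use dY TD(1) in auto)
    moreover have "baer_injective R (E (Suc j)) (T (Suc j))" by (rule N.torsion_baer_injective[OF injE I])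
    moreover have "\<delta> j ` Y \<inter> T (Suc j) = {\<zero>\<^bsub>E (Suc j)\<^esub>}"
    proof
      show "\<delta> j ` Y \<inter> T (Suc j) \<subseteq> {\<zero>\<^bsub>E (Suc j)\<^esub>}" using dY d(4) by auto
      show "{\<zero>\<^bsub>E (Suc j)\<^esub>} \<subseteq> \<delta> j ` Y \<inter> T (Suc j)" using YD(1) d(4) TD(1) by (metis IntI empty_subsetI image_eqI insert_subset)
    qed
    ultimately have "baer_injective R (E (Suc j)) (\<delta> j ` Y <+>\<^bsub>E (Suc j)\<^esub> T (Suc j))"
      by (rule N.baer_injective_direct_sum)
    also have "\<delta> j ` Y <+>\<^bsub>E (Suc j)\<^esub> T (Suc j) = B (Suc j)"
    proof
      show "\<delta> j ` Y <+>\<^bsub>E (Suc j)\<^esub> T (Suc j) \<subseteq> B (Suc j)"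
        using YD(2) unfolding in_B_Suc N.in_set_add subset_iff by blast
      show "B (Suc j) \<subseteq> \<delta> j ` Y <+>\<^bsub>E (Suc j)\<^esub> T (Suc j)"
      proof
        fix x assume "x \<in> B (Suc j)"
        then obtain e t where et: "e \<in> carrier (E j)" "t \<in> T (Suc j)" "x = \<delta> j e \<oplus>\<^bsub>E (Suc j)\<^esub> t"
          using in_B_Suc by blast
        then obtain b y where by': "b \<in> B j" "y \<in> Y" "e = b \<oplus>\<^bsub>E j\<^esub> y" using Y(3) M.in_set_add by blast
        have c: "b \<in> carrier (E j)" "y \<in> carrier (E j)" using by' YD BD by auto
        have db: "\<delta> j b \<in> T (Suc j)" using B_Z by' by (auto simp: Z_mod_tor_def)
        have "x = \<delta> j y \<oplus>\<^bsub>E (Suc j)\<^esub> (\<delta> j b \<oplus>\<^bsub>E (Suc j)\<^esub> t)"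
          using et(2) TD(2) d c unfolding et(3) by'(3) by (simp add: N.M.a_ac)
        then show "x \<in> \<delta> j ` Y <+>\<^bsub>E (Suc j)\<^esub> T (Suc j)"
          using N.set_addI[of "\<delta> j y" "\<delta> j ` Y" "\<delta> j b \<oplus>\<^bsub>E (Suc j)\<^esub> t"] by' TD(3)[OF db et(2)] by simp
      qed
    qed
    finally show ?case .
  qed
  show "saturation R I (E k) (B k) \<subseteq> B k" using saturation inj by blast
  show "Z j = B j" if "j < k" for j
    using assms[OF that] saturation[OF inj[of j]] B_Z[of j] that by simp
qed

end

section \<open>Products of two modules\<close>

text \<open>
  The product of \<open>M\<close> and \<open>N\<close>, carried by the codes \<open>c (e, f)\<close> of pairs under an injection \<open>c\<close>. The code
  keeps the carrier type of iterated cones fixed, as the induction on the dimension requires.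
\<close>

definition pair_module :: "('m \<times> 'n \<Rightarrow> 'u) \<Rightarrow> ('r, 'm, 'c) module_scheme \<Rightarrow> ('r, 'n, 'd) module_scheme \<Rightarrow> ('r, 'u) module"
  where "pair_module c M N =
    \<lparr>carrier = c ` (carrier M \<times> carrier N), monoid.mult = undefined, one = undefined,
     zero = c (\<zero>\<^bsub>M\<^esub>, \<zero>\<^bsub>N\<^esub>),
     add = (\<lambda>u v. c (fst (inv_into UNIV c u) \<oplus>\<^bsub>M\<^esub> fst (inv_into UNIV c v), snd (inv_into UNIV c u) \<oplus>\<^bsub>N\<^esub> snd (inv_into UNIV c v))),
     smult = (\<lambda>a u. c (a \<odot>\<^bsub>M\<^esub> fst (inv_into UNIV c u), a \<odot>\<^bsub>N\<^esub> snd (inv_into UNIV c u)))\<rparr>"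

lemma pair_module_simps:
  assumes "inj c"
  shows "c (e, f) \<in> carrier (pair_module c M N) \<longleftrightarrow> e \<in> carrier M \<and> f \<in> carrier N"
    "\<zero>\<^bsub>pair_module c M N\<^esub> = c (\<zero>\<^bsub>M\<^esub>, \<zero>\<^bsub>N\<^esub>)"
    "c (e, f) \<oplus>\<^bsub>pair_module c M N\<^esub> c (e', f') = c (e \<oplus>\<^bsub>M\<^esub> e', f \<oplus>\<^bsub>N\<^esub> f')"
    "a \<odot>\<^bsub>pair_module c M N\<^esub> c (e, f) = c (a \<odot>\<^bsub>M\<^esub> e, a \<odot>\<^bsub>N\<^esub> f)"
  using assms by (simp_all add: pair_module_def inj_image_mem_iff inv_f_f inj_eq)

lemma inj_pair_eq: "inj c \<Longrightarrow> c (e, f) = c (e', f') \<longleftrightarrow> e = e' \<and> f = f'"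
  by (simp add: inj_eq)

lemma pair_module_cases:
  assumes "w \<in> carrier (pair_module c M N)"
  obtains e f where "w = c (e, f)" "e \<in> carrier M" "f \<in> carrier N"
  using assms by (auto simp: pair_module_def)

lemma pair_module_module:
  assumes M: "module R M" and N: "module R N" and c: "inj c"
  shows "module R (pair_module c M N)" (is "module R ?P")
proof -
  interpret M: module R M by fact
  interpret N: module R N by fact
  note s = pair_module_simps[OF c, where M = M and N = N] inj_pair_eq[OF c]
  show ?thesis
  proof (rule moduleI[OF M.R.is_cring])
    show "abelian_group ?P"
    proof (rule abelian_groupI)
      show "\<exists>y\<in>carrier ?P. y \<oplus>\<^bsub>?P\<^esub> x = \<zero>\<^bsub>?P\<^esub>" if x: "x \<in> carrier ?P" for x
      proof -
        obtain e f where "x = c (e, f)" "e \<in> carrier M" "f \<in> carrier N"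
          by (rule pair_module_cases[OF x])
        then show ?thesis by (intro bexI[of _ "c (\<ominus>\<^bsub>M\<^esub> e, \<ominus>\<^bsub>N\<^esub> f)"]) (auto simp: s M.l_neg N.l_neg)
      qed
    qed (auto elim!: pair_module_cases simp: s M.a_ac N.a_ac)
  qed (auto elim!: pair_module_cases simp: s M.smult_l_distr N.smult_l_distr
      M.smult_r_distr N.smult_r_distr M.smult_assoc1 N.smult_assoc1)
qed

lemma pair_module_baer_injective:
  assumes M: "module R M" and N: "module R N" and c: "inj c"
    and MI: "baer_injective R M (carrier M)" and NI: "baer_injective R N (carrier N)"
  shows "baer_injective R (pair_module c M N) (carrier (pair_module c M N))" (is "baer_injective R ?P _")
  unfolding baer_injective_def
proof (intro conjI allI impI)
  note s = pair_module_simps[OF c, where M = M and N = N] inj_pair_eq[OF c]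
  interpret P: module R ?P by (rule pair_module_module[OF M N c])
  show sub: "submodule (carrier ?P) R ?P" by (rule P.carrier_is_submodule)
  fix J g assume *: "ideal J R \<and> g \<in> ideal_hom R ?P J (carrier ?P)"
  then have J: "ideal J R" by blast
  interpret J: ideal J R by fact
  note g = P.ideal_homD[OF J sub conjunct2[OF *]]
  define g1 where "g1 r = fst (inv_into UNIV c (g r))" for r
  define g2 where "g2 r = snd (inv_into UNIV c (g r))" for r
  have g12: "g r = c (g1 r, g2 r)" "g1 r \<in> carrier M" "g2 r \<in> carrier N" if r: "r \<in> J" for r
  proof -
    obtain e f where "g r = c (e, f)" "e \<in> carrier M" "f \<in> carrier N"
      by (rule pair_module_cases[OF g(2)[OF r]])
    then show "g r = c (g1 r, g2 r)" "g1 r \<in> carrier M" "g2 r \<in> carrier N"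
      by (auto simp: g1_def g2_def inv_f_f[OF c])
  qed
  have add: "g1 (r \<oplus>\<^bsub>R\<^esub> t) = g1 r \<oplus>\<^bsub>M\<^esub> g1 t \<and> g2 (r \<oplus>\<^bsub>R\<^esub> t) = g2 r \<oplus>\<^bsub>N\<^esub> g2 t" if "r \<in> J" "t \<in> J" for r t
    using g(3)[OF that] g12(1)[OF that(1)] g12(1)[OF that(2)] g12(1)[OF J.a_closed[OF that]] by (simp add: s)
  have mul: "g1 (a \<otimes>\<^bsub>R\<^esub> r) = a \<odot>\<^bsub>M\<^esub> g1 r \<and> g2 (a \<otimes>\<^bsub>R\<^esub> r) = a \<odot>\<^bsub>N\<^esub> g2 r" if "a \<in> carrier R" "r \<in> J" for a r
    using g(4)[OF that] g12(1)[OF that(2)] g12(1)[OF J.I_l_closed[OF that(2,1)]] by (simp add: s)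
  have "g1 \<in> ideal_hom R M J (carrier M)" "g2 \<in> ideal_hom R N J (carrier N)"
    using g12 add mul by (auto simp: ideal_hom_def)
  then obtain e f where "e \<in> carrier M" "\<And>r. r \<in> J \<Longrightarrow> g1 r = r \<odot>\<^bsub>M\<^esub> e" "f \<in> carrier N" "\<And>r. r \<in> J \<Longrightarrow> g2 r = r \<odot>\<^bsub>N\<^esub> f"
    using baer_injectiveE[OF MI J] baer_injectiveE[OF NI J] by metis
  then show "\<exists>b\<in>carrier ?P. \<forall>r\<in>J. g r = r \<odot>\<^bsub>?P\<^esub> b"
    using g12(1) by (intro bexI[of _ "c (e, f)"]) (simp_all add: s)
qed

lemma torsion_part_pair_module:
  assumes M: "module R M" and N: "module R N" and c: "inj c" and I: "I \<subseteq> carrier R"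
  shows "c (e, f) \<in> torsion_part R I (pair_module c M N) \<longleftrightarrow> e \<in> torsion_part R I M \<and> f \<in> torsion_part R I N"
proof -
  interpret M: module R M by fact
  interpret N: module R N by fact
  note s = pair_module_simps[OF c, where M = M and N = N] inj_pair_eq[OF c]
  have "(\<exists>n::nat. (a [^]\<^bsub>R\<^esub> n) \<odot>\<^bsub>M\<^esub> e = \<zero>\<^bsub>M\<^esub> \<and> (a [^]\<^bsub>R\<^esub> n) \<odot>\<^bsub>N\<^esub> f = \<zero>\<^bsub>N\<^esub>) \<longleftrightarrow>
    (\<exists>n::nat. (a [^]\<^bsub>R\<^esub> n) \<odot>\<^bsub>M\<^esub> e = \<zero>\<^bsub>M\<^esub>) \<and> (\<exists>n::nat. (a [^]\<^bsub>R\<^esub> n) \<odot>\<^bsub>N\<^esub> f = \<zero>\<^bsub>N\<^esub>)" (is "?L \<longleftrightarrow> ?R")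
    if "a \<in> I" "e \<in> carrier M" "f \<in> carrier N" for a
  proof
    assume ?R
    then obtain n m :: nat where nm: "(a [^]\<^bsub>R\<^esub> n) \<odot>\<^bsub>M\<^esub> e = \<zero>\<^bsub>M\<^esub>" "(a [^]\<^bsub>R\<^esub> m) \<odot>\<^bsub>N\<^esub> f = \<zero>\<^bsub>N\<^esub>" by blast
    have "(a [^]\<^bsub>R\<^esub> max n m) \<odot>\<^bsub>M\<^esub> e \<in> {\<zero>\<^bsub>M\<^esub>}" "(a [^]\<^bsub>R\<^esub> max n m) \<odot>\<^bsub>N\<^esub> f \<in> {\<zero>\<^bsub>N\<^esub>}"
      using M.pow_smult_mono[OF M.zero_smod, of a e n "max n m"] N.pow_smult_mono[OF N.zero_smod, of a f m "max n m"]
        nm that I by auto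
    then show ?L by blast
  qed blast
  then show ?thesis by (auto simp: saturation_def s)
qed

section \<open>Complexes with one weakly Laskerian cohomology module\<close>

text \<open>
  The conclusion of the induction. The module in degree \<open>k\<close> is compared with the given submodule \<open>U\<close>
  instead of \<open>B_mod_tor\<close>, because \<open>U/B_mod_tor\<close> plays the part of \<open>N\<close> modulo torsion: for a resolution of \<open>N\<close>, where
  \<open>k = 0\<close>, the cohomology in degree \<open>i\<close> is local cohomology in degree \<open>i + 1\<close>. The two conjuncts state that
  local cohomology vanishes in positive degrees \<open>\<ge> n\<close> and has finite support in degree \<open>n - 1\<close> if that
  is positive; here \<open>n\<close> exceeds the dimension of \<open>U/B_mod_tor\<close>.
\<close>

definition vanishes_from :: "('r, 'b) ring_scheme \<Rightarrow> 'r set \<Rightarrow> (nat \<Rightarrow> ('r, 'e, 'c) module_scheme) \<Rightarrow> (nat \<Rightarrow> 'e \<Rightarrow> 'e)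
    \<Rightarrow> nat \<Rightarrow> 'e set \<Rightarrow> nat \<Rightarrow> bool"
  where "vanishes_from R I E \<delta> k U n \<longleftrightarrow>
    (\<forall>i. k + n \<le> Suc i \<longrightarrow> Z_mod_tor R I E \<delta> i \<subseteq> ((B_mod_tor R I E \<delta>)(k := U)) i) \<and>
    (\<forall>i. k + n = Suc (Suc i) \<longrightarrow> finite (Supp_subq R (E i) (Z_mod_tor R I E \<delta> i) (((B_mod_tor R I E \<delta>)(k := U)) i)))"

text \<open>
  Modulo torsion, all cohomology of \<open>E\<close> is torsion outside degree \<open>k\<close>, and in degree \<open>k\<close> it is the weakly
  Laskerian module \<open>U/B k\<close> up to a torsion cokernel. The finiteness of associated primes is required of
  the quotients \<open>U/V\<close>, which are the quotients of \<open>U/B k\<close>.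
\<close>

locale wl_complex = torsion_complex R I E \<delta> for R (structure) and I and E :: "nat \<Rightarrow> ('a, 'e, 'c) module_scheme" and \<delta> +
  fixes k :: nat and U :: "'e set"
  assumes U_smod: "submodule U R (E k)"
    and B_U: "B_mod_tor R I E \<delta> k \<subseteq> U" and U_Z: "U \<subseteq> Z_mod_tor R I E \<delta> k" and Z_U: "Z_mod_tor R I E \<delta> k \<subseteq> saturation R I (E k) U"
    and Z_B: "\<And>j. j \<noteq> k \<Longrightarrow> Z_mod_tor R I E \<delta> j \<subseteq> saturation R I (E j) (B_mod_tor R I E \<delta> j)"
    and fin_Ass: "\<And>V. submodule V R (E k) \<Longrightarrow> B_mod_tor R I E \<delta> k \<subseteq> V \<Longrightarrow> V \<subseteq> U \<Longrightarrow> finite (Ass_subq R (E k) U V)"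
begin

lemmas UD = module.smodD[OF modE U_smod]

lemma saturation_Bk: "saturation R I (E k) (B k) \<subseteq> B k" and exact_lt_k: "\<And>j. j < k \<Longrightarrow> Z j = B j"
  using exact_below[of k, OF Z_B] by auto

text \<open>
  As \<open>U/B k\<close> is torsion-free, none of its finitely many associated primes contains \<open>I\<close>.
\<close>

lemma regular_element_exists: "\<exists>x\<in>I. \<forall>u\<in>U. x \<odot>\<^bsub>E k\<^esub> u \<in> B k \<longrightarrow> u \<in> B k"
proof -
  interpret M: noetherian_module R "E k" by (rule nmodE)
  have "\<exists>x\<in>I. \<forall>P\<in>Ass_subq R (E k) U (B k). x \<notin> P"
  proof (rule prime_avoidance[OF fin_Ass[OF B_smod order_refl B_U] I_ideal])
    show "primeideal P R" if "P \<in> Ass_subq R (E k) U (B k)" for P using that by (simp add: Ass_subq_def Spec_def)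
    show "\<not> I \<subseteq> P" if P: "P \<in> Ass_subq R (E k) U (B k)" for P
    proof
      assume IP: "I \<subseteq> P"
      interpret P: primeideal P R using P by (simp add: Ass_subq_def Spec_def)
      obtain u where u: "u \<in> U" "P = conductor R (E k) (B k) u" using P by (auto simp: Ass_subq_def)
      have "(a [^] (1::nat)) \<odot>\<^bsub>E k\<^esub> u \<in> B k" if "a \<in> I" for a
      proof -
        have "a \<in> conductor R (E k) (B k) u" using IP u(2) that by blast
        then show ?thesis by (simp add: conductor_def)
      qed
      then have "u \<in> saturation R I (E k) (B k)" using u UD(2) unfolding saturation_def by blast
      then have "u \<in> B k" using saturation_Bk by blast
      then have "\<one> \<in> P" unfolding u(2) using u(1) UD(2) by (simp add: conductor_def)
      then show False using P.one_notin by blast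
    qed
  qed
  then obtain x where x: "x \<in> I" "\<forall>P\<in>Ass_subq R (E k) U (B k). x \<notin> P" by blast
  have "u \<in> B k" if "u \<in> U" "x \<odot>\<^bsub>E k\<^esub> u \<in> B k" for u
    using M.zero_divisor_in_Ass_subq[OF U_smod B_smod that(1), of x] that(2) x I by blast
  then show ?thesis using x(1) by blast
qed

text \<open>
  If \<open>U/B k\<close> has empty support, it is zero, so all cohomology is torsion and hence zero.
\<close>

lemma vanishes_from_0:
  assumes "\<not> has_chain (Supp_subq R (E k) U (B k)) 0"
  shows "vanishes_from R I E \<delta> k U 0"
proof -
  have "U \<subseteq> B k"
    by (rule noetherian_module.Supp_subq_empty_imp_subset[OF nmodE U_smod B_smod])
      (use assms in \<open>simp add: has_chain_0\<close>)
  then have UB: "U = B k" using B_U by blast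
  then have "Z j \<subseteq> saturation R I (E j) (B j)" for j using Z_B Z_U by (cases "j = k") auto
  then have Z: "Z i = B i" for i using exact_below(2)[of "Suc i" i] by blast
  have "Supp_subq R (E i) (B i) (B i) = {}" for i
    by (rule noetherian_module.Supp_subq_self[OF nmodE B_smod])
  then show ?thesis using Z UB by (simp add: vanishes_from_def)
qed

end

section \<open>The cone of multiplication by a regular element\<close>

locale wl_cone = wl_complex R I E \<delta> k U for R (structure) and I and E :: "nat \<Rightarrow> ('a, 'e) module" and \<delta> and k and U +
  fixes x :: 'a and c :: "'e \<times> 'e \<Rightarrow> 'u"
  assumes x: "x \<in> I" and regular: "\<And>u. u \<in> U \<Longrightarrow> x \<odot>\<^bsub>E k\<^esub> u \<in> B k \<Longrightarrow> u \<in> B k"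
    and inj_c: "inj c"
begin

text \<open>
  The cone of multiplication by \<open>x\<close>, with \<open>F i\<close> the product of \<open>E i\<close> and \<open>E (i - 1)\<close> and differential
  \<open>(e, f) \<mapsto> (\<delta> e, x e - \<delta> f)\<close>. The shifted complex \<open>E'\<close> has \<open>E' i = E (i - 1)\<close>, and \<open>E' 0\<close> is zero. If \<open>E\<close>
  resolves \<open>N\<close> up to torsion in degree \<open>k\<close>, then the cone resolves \<open>N/x N\<close> up to torsion in degree \<open>k + 1\<close>.
\<close>

definition "E' i = (case i of 0 \<Rightarrow> (E 0)\<lparr>carrier := {\<zero>\<^bsub>E 0\<^esub>}\<rparr> | Suc j \<Rightarrow> E j)"
definition "d' i = (case i of 0 \<Rightarrow> (\<lambda>_. \<zero>\<^bsub>E 0\<^esub>) | Suc j \<Rightarrow> \<delta> j)"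
definition "F i = pair_module c (E i) (E' i)"
definition "cone_d i w = (case inv_into UNIV c w of (e, f) \<Rightarrow> c (\<delta> i e, (x \<odot>\<^bsub>E i\<^esub> e) \<ominus>\<^bsub>E i\<^esub> d' i f))"

lemma cone_shift_Suc [simp]: "E' (Suc i) = E i" "d' (Suc i) = \<delta> i"
  by (simp_all add: E'_def d'_def)

lemma xR: "x \<in> carrier R" using x I by blast

lemma modE': "module R (E' i)"
  using submodule.submodule_is_module[OF module.zero_smod[OF modE] modE] modE
  by (cases i) (auto simp: E'_def)

lemma injE': "baer_injective R (E' i) (carrier (E' i))"
proof (cases i)
  case 0
  interpret M: module R "E' i" by (rule modE')
  have "carrier (E' i) = {\<zero>\<^bsub>E' i\<^esub>}" by (simp add: 0 E'_def)
  then show ?thesis using M.zero_smod by (auto simp: baer_injective_def ideal_hom_def Pi_def ideal.Icarr)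
qed (simp add: injE)

lemma homd': "d' i \<in> mod_hom R (E' i) (E i)"
proof (cases i)
  case 0
  interpret M: module R "E 0" by (rule modE)
  show ?thesis by (simp add: 0 mod_hom_def d'_def E'_def)
qed (simp add: homE)

lemmas dd' = mod_homD[OF modE' modE homd']

lemma d_d': "f \<in> carrier (E' i) \<Longrightarrow> \<delta> i (d' i f) = \<zero>\<^bsub>E (Suc i)\<^esub>"
  using dd d(4) by (cases i) (auto simp: d'_def)

lemma coboundaries_d': "coboundaries E \<delta> i = d' i ` carrier (E' i)"
  by (cases i) (auto simp: coboundaries_def d'_def E'_def)

lemma in_B: "b \<in> B i \<longleftrightarrow> (\<exists>f\<in>carrier (E' i). \<exists>t\<in>T i. b = d' i f \<oplus>\<^bsub>E i\<^esub> t)"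
  by (auto simp: B_mod_tor_def coboundaries_d' module.in_set_add[OF modE])

lemma cone_d: "cone_d i (c (e, f)) = c (\<delta> i e, (x \<odot>\<^bsub>E i\<^esub> e) \<ominus>\<^bsub>E i\<^esub> d' i f)"
  by (simp add: cone_d_def inv_f_f[OF inj_c])

lemmas Fs = pair_module_simps[OF inj_c, where M = "E i" and N = "E' i" for i, folded F_def] inj_pair_eq[OF inj_c]
lemmas F_cases = pair_module_cases[where c = c and M = "E i" and N = "E' i" for i, folded F_def]

lemma torsion_part_F: "c (e, f) \<in> torsion_part R I (F i) \<longleftrightarrow> e \<in> T i \<and> f \<in> torsion_part R I (E' i)"
  unfolding F_def by (rule torsion_part_pair_module[OF modE modE' inj_c I])

lemma cone_complex: "torsion_complex R I F cone_d"
proof (intro torsion_complex.intro torsion_complex_axioms.intro noetherian_ring_axioms is_cring I_ideal)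
  show "injective_complex R F cone_d"
    unfolding injective_complex_def
  proof (intro allI conjI ballI)
    fix i
    interpret M: module R "E i" by (rule modE)
    interpret N: module R "E (Suc i)" by (rule modE)
    show "module R (F i)" unfolding F_def by (rule pair_module_module[OF modE modE' inj_c])
    show "baer_injective R (F i) (carrier (F i))"
      unfolding F_def by (rule pair_module_baer_injective[OF modE modE' inj_c injE injE'])
    show "cone_d i \<in> mod_hom R (F i) (F (Suc i))"
      unfolding mod_hom_def
    proof (intro CollectI conjI ballI Pi_I)
      fix w assume "w \<in> carrier (F i)"
      then obtain e f where w: "w = c (e, f)" "e \<in> carrier (E i)" "f \<in> carrier (E' i)" by (rule F_cases)
      then show "cone_d i w \<in> carrier (F (Suc i))" using d(1) dd'(1) xR by (simp add: cone_d Fs)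
      show "cone_d i (a \<odot>\<^bsub>F i\<^esub> w) = a \<odot>\<^bsub>F (Suc i)\<^esub> cone_d i w" if a: "a \<in> carrier R" for a
        using w d(1,3) dd'(1,3) xR a
        by (simp add: cone_d Fs a_minus_def M.smult_r_distr M.smult_r_minus M.smult_comm[of x a])
      fix w' assume "w' \<in> carrier (F i)"
      then obtain e' f' where w': "w' = c (e', f')" "e' \<in> carrier (E i)" "f' \<in> carrier (E' i)" by (rule F_cases)
      show "cone_d i (w \<oplus>\<^bsub>F i\<^esub> w') = cone_d i w \<oplus>\<^bsub>F (Suc i)\<^esub> cone_d i w'"
        using w w' d(1,2) dd'(1,2) xR
        by (simp add: cone_d Fs M.smult_r_distr M.diff_add_diff)
    qed
    fix w assume "w \<in> carrier (F i)"
    then obtain e f where w: "w = c (e, f)" "e \<in> carrier (E i)" "f \<in> carrier (E' i)" by (rule F_cases)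
    then show "cone_d (Suc i) (cone_d i w) = \<zero>\<^bsub>F (Suc (Suc i))\<^esub>"
      using d(1,3,6) dd'(1) dd d_d' xR by (simp add: cone_d Fs a_minus_def N.M.r_neg N.neg_zero)
  qed
qed

sublocale C: torsion_complex R I F cone_d by (rule cone_complex)

lemma in_ZF: "c (e, f) \<in> C.Z i \<longleftrightarrow> e \<in> carrier (E i) \<and> f \<in> carrier (E' i) \<and> \<delta> i e \<in> T (Suc i) \<and>
    (x \<odot>\<^bsub>E i\<^esub> e) \<ominus>\<^bsub>E i\<^esub> d' i f \<in> T i"
  by (auto simp: Z_mod_tor_def cone_d torsion_part_F Fs(1))

text \<open>
  For \<open>V\<close> containing \<open>B j\<close>, the preimage in \<open>F (j + 1)\<close> of the image of \<open>V\<close> in \<open>F (j + 1)\<close> modulo coboundaries and torsion, where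
  \<open>v \<in> V\<close> is sent to \<open>(0, v)\<close>. For \<open>V = B j\<close> these are just the coboundaries modulo torsion (\<open>BF_Suc\<close>).
\<close>

definition "cone_ext j V = {c (\<delta> j e \<oplus>\<^bsub>E (Suc j)\<^esub> t, (x \<odot>\<^bsub>E j\<^esub> e) \<oplus>\<^bsub>E j\<^esub> v) | e t v.
    e \<in> carrier (E j) \<and> t \<in> T (Suc j) \<and> v \<in> V}"

lemma cone_extE:
  assumes "w \<in> cone_ext j V"
  obtains e t v where "e \<in> carrier (E j)" "t \<in> T (Suc j)" "v \<in> V"
    "w = c (\<delta> j e \<oplus>\<^bsub>E (Suc j)\<^esub> t, (x \<odot>\<^bsub>E j\<^esub> e) \<oplus>\<^bsub>E j\<^esub> v)"
  using assms by (auto simp: cone_ext_def)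

lemma cone_extI:
  assumes "e \<in> carrier (E j)" "t \<in> T (Suc j)" "v \<in> V"
  shows "c (\<delta> j e \<oplus>\<^bsub>E (Suc j)\<^esub> t, (x \<odot>\<^bsub>E j\<^esub> e) \<oplus>\<^bsub>E j\<^esub> v) \<in> cone_ext j V"
  using assms by (auto simp: cone_ext_def)

lemma cone_ext_fst:
  assumes "c (e, f) \<in> cone_ext j V" shows "e \<in> B (Suc j)"
  by (rule cone_extE[OF assms]) (auto simp: Fs(5) in_B_Suc)

lemma BF_Suc: "C.B (Suc j) = cone_ext j (B j)"
proof
  interpret M: module R "E j" by (rule modE)
  interpret N: module R "E (Suc j)" by (rule modE)
  show "C.B (Suc j) \<subseteq> cone_ext j (B j)"
  proof
    fix w assume "w \<in> C.B (Suc j)"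
    then obtain w1 w2 where w: "w1 \<in> carrier (F j)" "w2 \<in> torsion_part R I (F (Suc j))" "w = cone_d j w1 \<oplus>\<^bsub>F (Suc j)\<^esub> w2"
      using C.in_B_Suc by blast
    obtain e f where w1: "w1 = c (e, f)" "e \<in> carrier (E j)" "f \<in> carrier (E' j)" by (rule F_cases[OF w(1)])
    obtain t s where w2: "w2 = c (t, s)" "t \<in> carrier (E (Suc j))" "s \<in> carrier (E' (Suc j))"
      by (rule F_cases[OF C.TD(2)[OF w(2)]])
    have ts: "t \<in> T (Suc j)" "s \<in> T j" using w(2) unfolding w2(1) torsion_part_F by auto
    have "d' j (\<ominus>\<^bsub>E' j\<^esub> f) \<oplus>\<^bsub>E j\<^esub> s \<in> B j"
      unfolding in_B using ts w1(3) abelian_group.a_inv_closed[OF module.axioms(2)[OF modE']] by blast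
    then have b: "(\<ominus>\<^bsub>E j\<^esub> d' j f) \<oplus>\<^bsub>E j\<^esub> s \<in> B j" using dd'(5) w1 by simp
    have "w = c (\<delta> j e \<oplus>\<^bsub>E (Suc j)\<^esub> t, (x \<odot>\<^bsub>E j\<^esub> e) \<oplus>\<^bsub>E j\<^esub> ((\<ominus>\<^bsub>E j\<^esub> d' j f) \<oplus>\<^bsub>E j\<^esub> s))"
      using w(3) w1 w2 dd'(1) xR by (simp add: cone_d Fs a_minus_def M.a_assoc)
    then show "w \<in> cone_ext j (B j)" using cone_extI[OF w1(2) ts(1) b] by simp
  qed
  show "cone_ext j (B j) \<subseteq> C.B (Suc j)"
  proof
    fix w assume "w \<in> cone_ext j (B j)"
    then obtain e t b where w: "e \<in> carrier (E j)" "t \<in> T (Suc j)" "b \<in> B j"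
      "w = c (\<delta> j e \<oplus>\<^bsub>E (Suc j)\<^esub> t, (x \<odot>\<^bsub>E j\<^esub> e) \<oplus>\<^bsub>E j\<^esub> b)" by (rule cone_extE)
    then obtain f s where b: "f \<in> carrier (E' j)" "s \<in> T j" "b = d' j f \<oplus>\<^bsub>E j\<^esub> s" using in_B by blast
    have f': "\<ominus>\<^bsub>E' j\<^esub> f \<in> carrier (E' j)"
      using b abelian_group.a_inv_closed[OF module.axioms(2)[OF modE']] by blast
    have sc: "s \<in> carrier (E j)" "t \<in> carrier (E (Suc j))" using b w TD(2) by auto
    have "w = cone_d j (c (e, \<ominus>\<^bsub>E' j\<^esub> f)) \<oplus>\<^bsub>F (Suc j)\<^esub> c (t, s)"
      using w(1,4) b dd'(1,5) xR sc by (simp add: cone_d Fs a_minus_def M.a_assoc)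
    moreover have "c (e, \<ominus>\<^bsub>E' j\<^esub> f) \<in> carrier (F j)" using w(1) f' by (simp add: Fs)
    moreover have "c (t, s) \<in> torsion_part R I (F (Suc j))" using w(2) b(2) by (simp add: torsion_part_F)
    ultimately show "w \<in> C.B (Suc j)" using C.in_B_Suc by blast
  qed
qed

lemma cone_ext_smod:
  assumes V: "submodule V R (E j)"
  shows "submodule (cone_ext j V) R (F (Suc j))"
proof -
  interpret M: module R "E j" by (rule modE)
  interpret N: module R "E (Suc j)" by (rule modE)
  interpret P: module R "F (Suc j)" by (rule C.modE)
  note VD = M.smodD[OF V]
  show ?thesis
  proof (rule P.smoduleI)
    show "cone_ext j V \<subseteq> carrier (F (Suc j))"
      using VD(2) TD(2) d(1) xR by (auto elim!: cone_extE simp: Fs)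
    have "c (\<delta> j \<zero>\<^bsub>E j\<^esub> \<oplus>\<^bsub>E (Suc j)\<^esub> \<zero>\<^bsub>E (Suc j)\<^esub>, (x \<odot>\<^bsub>E j\<^esub> \<zero>\<^bsub>E j\<^esub>) \<oplus>\<^bsub>E j\<^esub> \<zero>\<^bsub>E j\<^esub>) \<in> cone_ext j V"
      using VD(1) TD(1) by (intro cone_extI) auto
    then show "\<zero>\<^bsub>F (Suc j)\<^esub> \<in> cone_ext j V" using d(4) xR by (simp add: Fs)
  next
    fix u w assume "u \<in> cone_ext j V" "w \<in> cone_ext j V"
    then obtain e t v e' t' v' where *: "e \<in> carrier (E j)" "t \<in> T (Suc j)" "v \<in> V"
      "u = c (\<delta> j e \<oplus>\<^bsub>E (Suc j)\<^esub> t, (x \<odot>\<^bsub>E j\<^esub> e) \<oplus>\<^bsub>E j\<^esub> v)"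
      "e' \<in> carrier (E j)" "t' \<in> T (Suc j)" "v' \<in> V"
      "w = c (\<delta> j e' \<oplus>\<^bsub>E (Suc j)\<^esub> t', (x \<odot>\<^bsub>E j\<^esub> e') \<oplus>\<^bsub>E j\<^esub> v')"
      by (metis cone_extE)
    then have "u \<oplus>\<^bsub>F (Suc j)\<^esub> w = c (\<delta> j (e \<oplus>\<^bsub>E j\<^esub> e') \<oplus>\<^bsub>E (Suc j)\<^esub> (t \<oplus>\<^bsub>E (Suc j)\<^esub> t'),
        (x \<odot>\<^bsub>E j\<^esub> (e \<oplus>\<^bsub>E j\<^esub> e')) \<oplus>\<^bsub>E j\<^esub> (v \<oplus>\<^bsub>E j\<^esub> v'))"
      using d(1,2) VD(2) TD(2) xR by (simp add: Fs M.smult_r_distr M.add_add_swap N.add_add_swap)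
    then show "u \<oplus>\<^bsub>F (Suc j)\<^esub> w \<in> cone_ext j V" using * VD(3) TD(3) by (simp add: cone_extI)
  next
    fix a w assume a: "a \<in> carrier R" and "w \<in> cone_ext j V"
    then obtain e t v where *: "e \<in> carrier (E j)" "t \<in> T (Suc j)" "v \<in> V"
      "w = c (\<delta> j e \<oplus>\<^bsub>E (Suc j)\<^esub> t, (x \<odot>\<^bsub>E j\<^esub> e) \<oplus>\<^bsub>E j\<^esub> v)" by (metis cone_extE)
    then have "a \<odot>\<^bsub>F (Suc j)\<^esub> w = c (\<delta> j (a \<odot>\<^bsub>E j\<^esub> e) \<oplus>\<^bsub>E (Suc j)\<^esub> (a \<odot>\<^bsub>E (Suc j)\<^esub> t),
        (x \<odot>\<^bsub>E j\<^esub> (a \<odot>\<^bsub>E j\<^esub> e)) \<oplus>\<^bsub>E j\<^esub> (a \<odot>\<^bsub>E j\<^esub> v))"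
      using d(1,3) VD(2) TD(2) xR a
      by (simp add: Fs M.smult_r_distr N.smult_r_distr M.smult_comm[of x a])
    then show "a \<odot>\<^bsub>F (Suc j)\<^esub> w \<in> cone_ext j V" using * VD(6) TD(6) a by (simp add: cone_extI)
  qed
qed

lemma cone_ext_mono: "V \<subseteq> V' \<Longrightarrow> cone_ext j V \<subseteq> cone_ext j V'"
  by (auto simp: cone_ext_def)

text \<open>
  If \<open>b e = \<delta> g + t\<close> for a power \<open>b\<close> of \<open>a\<close>, subtracting the coboundary of \<open>(g, 0)\<close> from \<open>b (e, f)\<close>
  leaves \<open>(t, b f - x g)\<close>. Here \<open>b f - x g\<close> is a cocycle modulo torsion, so that some power of \<open>a\<close> moves it into \<open>V\<close>.
\<close>

lemma saturation_cone_ext: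
  assumes V: "submodule V R (E i)" "Z i \<subseteq> saturation R I (E i) V"
    and w: "c (e, f) \<in> C.Z (Suc i)" and e: "e \<in> saturation R I (E (Suc i)) (B (Suc i))"
  shows "c (e, f) \<in> saturation R I (F (Suc i)) (cone_ext i V)"
proof -
  interpret M: module R "E i" by (rule modE)
  interpret N: module R "E (Suc i)" by (rule modE)
  interpret P: module R "F (Suc i)" by (rule C.modE)
  have c: "e \<in> carrier (E (Suc i))" "f \<in> carrier (E i)"
    and xe: "(x \<odot>\<^bsub>E (Suc i)\<^esub> e) \<ominus>\<^bsub>E (Suc i)\<^esub> \<delta> i f \<in> T (Suc i)"
    using w by (auto simp: in_ZF)
  have "\<exists>n::nat. (a [^] n) \<odot>\<^bsub>F (Suc i)\<^esub> c (e, f) \<in> cone_ext i V" if a: "a \<in> I" for a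
  proof -
    have ac: "a \<in> carrier R" using a I by blast
    obtain n :: nat where "(a [^] n) \<odot>\<^bsub>E (Suc i)\<^esub> e \<in> B (Suc i)" using e a by (auto simp: saturation_def)
    then obtain g t where gt: "g \<in> carrier (E i)" "t \<in> T (Suc i)"
      "(a [^] n) \<odot>\<^bsub>E (Suc i)\<^esub> e = \<delta> i g \<oplus>\<^bsub>E (Suc i)\<^esub> t" using in_B_Suc by blast
    define b where "b = a [^] n"
    have b: "b \<in> carrier R" "b \<odot>\<^bsub>E (Suc i)\<^esub> e = \<delta> i g \<oplus>\<^bsub>E (Suc i)\<^esub> t" using ac gt by (simp_all add: b_def)
    have tc: "t \<in> carrier (E (Suc i))" using gt TD(2) by blast
    define h where "h = (b \<odot>\<^bsub>E i\<^esub> f) \<ominus>\<^bsub>E i\<^esub> (x \<odot>\<^bsub>E i\<^esub> g)"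
    have h: "h \<in> carrier (E i)" using b c gt xR by (simp add: h_def)
    have dh: "\<delta> i h = (b \<odot>\<^bsub>E (Suc i)\<^esub> \<delta> i f) \<ominus>\<^bsub>E (Suc i)\<^esub> (x \<odot>\<^bsub>E (Suc i)\<^esub> \<delta> i g)"
      using b c gt xR d(3,6) by (simp add: h_def)
    have "b \<odot>\<^bsub>E (Suc i)\<^esub> ((x \<odot>\<^bsub>E (Suc i)\<^esub> e) \<ominus>\<^bsub>E (Suc i)\<^esub> \<delta> i f) =
        ((x \<odot>\<^bsub>E (Suc i)\<^esub> \<delta> i g) \<oplus>\<^bsub>E (Suc i)\<^esub> (x \<odot>\<^bsub>E (Suc i)\<^esub> t)) \<ominus>\<^bsub>E (Suc i)\<^esub> (b \<odot>\<^bsub>E (Suc i)\<^esub> \<delta> i f)"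
      using b c gt xR d(1) tc
      by (simp add: a_minus_def N.smult_r_distr N.smult_r_minus N.smult_comm[of b x] b(2))
    also have "\<dots> \<oplus>\<^bsub>E (Suc i)\<^esub> \<delta> i h = x \<odot>\<^bsub>E (Suc i)\<^esub> t"
    proof -
      have g: "(p \<oplus>\<^bsub>E (Suc i)\<^esub> q) \<ominus>\<^bsub>E (Suc i)\<^esub> r \<oplus>\<^bsub>E (Suc i)\<^esub> (r \<ominus>\<^bsub>E (Suc i)\<^esub> p) = q"
        if "p \<in> carrier (E (Suc i))" "q \<in> carrier (E (Suc i))" "r \<in> carrier (E (Suc i))" for p q r
      proof -
        have "(p \<oplus>\<^bsub>E (Suc i)\<^esub> q) \<ominus>\<^bsub>E (Suc i)\<^esub> r \<oplus>\<^bsub>E (Suc i)\<^esub> (r \<ominus>\<^bsub>E (Suc i)\<^esub> p) =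
          ((p \<oplus>\<^bsub>E (Suc i)\<^esub> q) \<ominus>\<^bsub>E (Suc i)\<^esub> r \<oplus>\<^bsub>E (Suc i)\<^esub> r) \<ominus>\<^bsub>E (Suc i)\<^esub> p"
          using that by (simp add: a_minus_def N.M.a_assoc)
        then show ?thesis using that by (simp add: N.add_diff_cancel)
      qed
      show ?thesis unfolding dh using b c gt xR d(1) tc by (intro g) auto
    qed
    finally have "b \<odot>\<^bsub>E (Suc i)\<^esub> ((x \<odot>\<^bsub>E (Suc i)\<^esub> e) \<ominus>\<^bsub>E (Suc i)\<^esub> \<delta> i f) \<oplus>\<^bsub>E (Suc i)\<^esub> \<delta> i h \<in> T (Suc i)"
      using TD(6) gt xR by simp
    then have "\<delta> i h \<in> T (Suc i)"
      using N.smod_cancel[OF T_smod TD(6)[OF b(1) xe] d(1)[OF h]] by blast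
    then have "h \<in> saturation R I (E i) V" using V(2) h by (auto simp: Z_mod_tor_def)
    then obtain m :: nat where m: "(a [^] m) \<odot>\<^bsub>E i\<^esub> h \<in> V" using a by (auto simp: saturation_def)
    define q where "q = a [^] m"
    have q: "q \<in> carrier R" "q \<odot>\<^bsub>E i\<^esub> h \<in> V" using ac m by (simp_all add: q_def)
    have f: "b \<odot>\<^bsub>E i\<^esub> f = (x \<odot>\<^bsub>E i\<^esub> g) \<oplus>\<^bsub>E i\<^esub> h"
      using b c gt xR by (simp add: h_def M.add_diff_cancel)
    have "(a [^] (m + n)) \<odot>\<^bsub>F (Suc i)\<^esub> c (e, f) = q \<odot>\<^bsub>F (Suc i)\<^esub> (b \<odot>\<^bsub>F (Suc i)\<^esub> c (e, f))"
      unfolding q_def b_def using ac c by (intro P.pow_smult) (auto simp: Fs)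
    also have "\<dots> = c (\<delta> i (q \<odot>\<^bsub>E i\<^esub> g) \<oplus>\<^bsub>E (Suc i)\<^esub> (q \<odot>\<^bsub>E (Suc i)\<^esub> t),
        (x \<odot>\<^bsub>E i\<^esub> (q \<odot>\<^bsub>E i\<^esub> g)) \<oplus>\<^bsub>E i\<^esub> (q \<odot>\<^bsub>E i\<^esub> h))"
      using q b c gt xR tc h d(1,3) by (simp add: Fs f M.smult_r_distr N.smult_r_distr M.smult_comm[of x q])
    also have "\<dots> \<in> cone_ext i V" using q gt TD(6) by (intro cone_extI) auto
    finally show ?thesis by blast
  qed
  then show ?thesis using c by (simp add: saturation_def Fs)
qed

text \<open>
  Multiplication by \<open>x\<close> is injective on \<open>Z k/B k\<close> as well: a power of each \<open>a \<in> I\<close> moves \<open>z\<close> into \<open>U\<close>, where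
  \<open>x\<close> is regular, and \<open>Z k/B k\<close> is torsion-free.
\<close>

lemma regular_Z:
  assumes z: "z \<in> Z k" "x \<odot>\<^bsub>E k\<^esub> z \<in> B k"
  shows "z \<in> B k"
proof -
  interpret M: module R "E k" by (rule modE)
  have zc: "z \<in> carrier (E k)" using z ZD(2) by blast
  have "\<exists>n::nat. (a [^] n) \<odot>\<^bsub>E k\<^esub> z \<in> B k" if a: "a \<in> I" for a
  proof -
    obtain n :: nat where n: "(a [^] n) \<odot>\<^bsub>E k\<^esub> z \<in> U" using z Z_U a by (auto simp: saturation_def)
    have ac: "a [^] n \<in> carrier R" using a I by auto
    have "x \<odot>\<^bsub>E k\<^esub> ((a [^] n) \<odot>\<^bsub>E k\<^esub> z) = (a [^] n) \<odot>\<^bsub>E k\<^esub> (x \<odot>\<^bsub>E k\<^esub> z)"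
      using M.smult_comm[OF xR ac zc] .
    also have "\<dots> \<in> B k" using BD(6) ac z by blast
    finally show ?thesis using regular[OF n] by blast
  qed
  then have "z \<in> saturation R I (E k) (B k)" using zc by (simp add: saturation_def)
  then show ?thesis using saturation_Bk by blast
qed

end

lemma (in module) smult_pow_Suc:
  assumes "a \<in> carrier R" "z \<in> carrier M"
  shows "a \<odot>\<^bsub>M\<^esub> ((a [^] (m::nat)) \<odot>\<^bsub>M\<^esub> z) = (a [^] Suc m) \<odot>\<^bsub>M\<^esub> z"
  using assms smult_assoc1[of "a [^] m" a z] smult_comm[of a "a [^] m" z] by simp

context wl_cone
begin

abbreviation "C0 u \<equiv> c (\<zero>\<^bsub>E (Suc k)\<^esub>, u)"

lemma C0_ext:
  assumes "v \<in> V" "v \<in> carrier (E k)" shows "C0 v \<in> cone_ext k V"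
proof -
  interpret M: module R "E k" by (rule modE)
  interpret N: module R "E (Suc k)" by (rule modE)
  have "c (\<delta> k \<zero>\<^bsub>E k\<^esub> \<oplus>\<^bsub>E (Suc k)\<^esub> \<zero>\<^bsub>E (Suc k)\<^esub>, (x \<odot>\<^bsub>E k\<^esub> \<zero>\<^bsub>E k\<^esub>) \<oplus>\<^bsub>E k\<^esub> v) \<in> cone_ext k V"
    using assms TD(1) by (intro cone_extI) auto
  then show ?thesis using d(4) xR assms by simp
qed

text \<open>
  Modulo coboundaries every element of \<open>cone_ext k U\<close> has the form \<open>(0, u)\<close>. Therefore the quotients of the
  new module \<open>cone_ext k U\<close> modulo coboundaries are quotients of \<open>U/B k\<close>.
\<close>

lemma cone_ext_represented:
  assumes V: "submodule V R (F (Suc k))" "C.B (Suc k) \<subseteq> V" and w: "w \<in> cone_ext k U"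
  shows "\<exists>u\<in>U. \<forall>a\<in>carrier R. a \<odot>\<^bsub>F (Suc k)\<^esub> w \<in> V \<longleftrightarrow> C0 (a \<odot>\<^bsub>E k\<^esub> u) \<in> V"
proof -
  interpret M: module R "E k" by (rule modE)
  interpret N: module R "E (Suc k)" by (rule modE)
  interpret P: module R "F (Suc k)" by (rule C.modE)
  note VD = P.smodD[OF V(1)]
  obtain e t u where *: "e \<in> carrier (E k)" "t \<in> T (Suc k)" "u \<in> U"
    "w = c (\<delta> k e \<oplus>\<^bsub>E (Suc k)\<^esub> t, (x \<odot>\<^bsub>E k\<^esub> e) \<oplus>\<^bsub>E k\<^esub> u)" by (rule cone_extE[OF w])
  define b where "b = c (\<delta> k e \<oplus>\<^bsub>E (Suc k)\<^esub> t, x \<odot>\<^bsub>E k\<^esub> e)"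
  have tc: "t \<in> carrier (E (Suc k))" and uc: "u \<in> carrier (E k)" using * TD(2) UD(2) by auto
  have "c (\<delta> k e \<oplus>\<^bsub>E (Suc k)\<^esub> t, (x \<odot>\<^bsub>E k\<^esub> e) \<oplus>\<^bsub>E k\<^esub> \<zero>\<^bsub>E k\<^esub>) \<in> cone_ext k (B k)"
    using * BD(1) by (intro cone_extI) auto
  then have b: "b \<in> V" using V(2) BF_Suc * xR by (auto simp: b_def)
  have bc: "b \<in> carrier (F (Suc k))" using VD(2)[OF b] .
  have "a \<odot>\<^bsub>F (Suc k)\<^esub> w \<in> V \<longleftrightarrow> C0 (a \<odot>\<^bsub>E k\<^esub> u) \<in> V" if a: "a \<in> carrier R" for a
  proof -
    have eq: "a \<odot>\<^bsub>F (Suc k)\<^esub> w = (a \<odot>\<^bsub>F (Suc k)\<^esub> b) \<oplus>\<^bsub>F (Suc k)\<^esub> C0 (a \<odot>\<^bsub>E k\<^esub> u)"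
      using * a tc uc d(1) xR by (simp add: b_def Fs M.smult_r_distr)
    have ab: "a \<odot>\<^bsub>F (Suc k)\<^esub> b \<in> V" using VD(6) a b by blast
    have "C0 (a \<odot>\<^bsub>E k\<^esub> u) \<in> carrier (F (Suc k))" using a uc by (simp add: Fs)
    then show ?thesis unfolding eq using VD(3)[OF ab] P.smod_cancel[OF V(1) ab] by blast
  qed
  then show ?thesis using *(3) by blast
qed

definition "pull_U V = {u \<in> U. C0 u \<in> V}"

lemma pull_U:
  assumes V: "submodule V R (F (Suc k))" "C.B (Suc k) \<subseteq> V"
  shows "submodule (pull_U V) R (E k)" "B k \<subseteq> pull_U V" "pull_U V \<subseteq> U"
    "Ass_subq R (F (Suc k)) (cone_ext k U) V \<subseteq> Ass_subq R (E k) U (pull_U V)"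
    "Supp_subq R (F (Suc k)) (cone_ext k U) V \<subseteq> Supp_subq R (E k) U (pull_U V)"
proof -
  interpret M: module R "E k" by (rule modE)
  interpret N: module R "E (Suc k)" by (rule modE)
  interpret P: module R "F (Suc k)" by (rule C.modE)
  note VD = P.smodD[OF V(1)]
  show "pull_U V \<subseteq> U" by (auto simp: pull_U_def)
  show Bp: "B k \<subseteq> pull_U V"
    using C0_ext[of _ "B k"] BD(2) B_U V(2) BF_Suc by (auto simp: pull_U_def)
  show "submodule (pull_U V) R (E k)"
  proof (rule M.smoduleI)
    show "pull_U V \<subseteq> carrier (E k)" using UD(2) by (auto simp: pull_U_def)
    show "\<zero>\<^bsub>E k\<^esub> \<in> pull_U V" using Bp BD(1) by blast
    show "u \<oplus>\<^bsub>E k\<^esub> v \<in> pull_U V" if uv: "u \<in> pull_U V" "v \<in> pull_U V" for u v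
      using VD(3)[of "C0 u" "C0 v"] uv UD(2,3) by (simp add: pull_U_def Fs)
    show "a \<odot>\<^bsub>E k\<^esub> u \<in> pull_U V" if au: "a \<in> carrier R" "u \<in> pull_U V" for a u
      using VD(6)[of a "C0 u"] au UD(2,6) by (simp add: pull_U_def Fs)
  qed
  have rep: "\<exists>u\<in>U. \<forall>a\<in>carrier R. a \<odot>\<^bsub>F (Suc k)\<^esub> w \<in> V \<longleftrightarrow> a \<odot>\<^bsub>E k\<^esub> u \<in> pull_U V" if w: "w \<in> cone_ext k U" for w
    using cone_ext_represented[OF V w] UD(6) unfolding pull_U_def by blast
  show "Ass_subq R (F (Suc k)) (cone_ext k U) V \<subseteq> Ass_subq R (E k) U (pull_U V)"
    "Supp_subq R (F (Suc k)) (cone_ext k U) V \<subseteq> Supp_subq R (E k) U (pull_U V)"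
    using Ass_Supp_subq_transfer[OF rep] by simp_all
qed

text \<open>
  \<open>U/W\<close> is \<open>N/x N\<close> when \<open>U/B k\<close> is \<open>N\<close>. The cone only has a quotient of it as cohomology, since the
  coboundaries involve \<open>x Z k\<close> rather than \<open>x U\<close>; both are needed below.
\<close>

definition "W = B k <+>\<^bsub>E k\<^esub> ((\<lambda>u. x \<odot>\<^bsub>E k\<^esub> u) ` U)"

lemma W: "submodule W R (E k)" "B k \<subseteq> W" "W \<subseteq> U"
  and in_W: "w \<in> W \<longleftrightarrow> (\<exists>b\<in>B k. \<exists>u\<in>U. w = b \<oplus>\<^bsub>E k\<^esub> (x \<odot>\<^bsub>E k\<^esub> u))"
proof -
  interpret M: module R "E k" by (rule modE)
  show "w \<in> W \<longleftrightarrow> (\<exists>b\<in>B k. \<exists>u\<in>U. w = b \<oplus>\<^bsub>E k\<^esub> (x \<odot>\<^bsub>E k\<^esub> u))" for w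
    by (simp add: W_def M.in_set_add)
  note in_W' = this
  show "W \<subseteq> U"
  proof
    fix w assume "w \<in> W"
    then obtain b u where "b \<in> B k" "u \<in> U" "w = b \<oplus>\<^bsub>E k\<^esub> (x \<odot>\<^bsub>E k\<^esub> u)" using in_W' by blast
    then show "w \<in> U" using UD(3)[OF subsetD[OF B_U] UD(6)[OF xR]] by simp
  qed
  have h: "(\<lambda>u. x \<odot>\<^bsub>E k\<^esub> u) \<in> mod_hom R (E k) (E k)"
    using xR by (auto simp: mod_hom_def M.smult_r_distr M.smult_comm[of x])
  have "submodule ((\<lambda>u. x \<odot>\<^bsub>E k\<^esub> u) ` U) R (E k)" by (rule image_submodule[OF modE modE h U_smod])
  then show "submodule W R (E k)" "B k \<subseteq> W"
    unfolding W_def using M.set_add_submodule[OF B_smod] by auto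
qed

lemma W_pull: "W \<subseteq> pull_U (C.B (Suc k))"
proof
  interpret M: module R "E k" by (rule modE)
  interpret N: module R "E (Suc k)" by (rule modE)
  fix w assume wW: "w \<in> W"
  then obtain b u where w: "b \<in> B k" "u \<in> U" "w = b \<oplus>\<^bsub>E k\<^esub> (x \<odot>\<^bsub>E k\<^esub> u)" using in_W by blast
  have c: "b \<in> carrier (E k)" "u \<in> carrier (E k)" using w UD(2) BD(2) by auto
  have du: "\<delta> k u \<in> T (Suc k)" using w U_Z by (auto simp: Z_mod_tor_def)
  have "c (\<delta> k u \<oplus>\<^bsub>E (Suc k)\<^esub> (\<ominus>\<^bsub>E (Suc k)\<^esub> \<delta> k u), (x \<odot>\<^bsub>E k\<^esub> u) \<oplus>\<^bsub>E k\<^esub> b) \<in> cone_ext k (B k)"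
    using c w TD(4)[OF du] by (intro cone_extI) auto
  then have "C0 w \<in> cone_ext k (B k)" using c w d(1) xR by (simp add: N.M.r_neg M.M.a_comm)
  then show "w \<in> pull_U (C.B (Suc k))" using wW W(3) BF_Suc by (auto simp: pull_U_def)
qed

text \<open>
  A prime in the support of \<open>N/x N\<close> contains \<open>x\<close>, while the associated prime of \<open>N\<close> below it does not.
  This is why the dimension drops.
\<close>

lemma Supp_W: "P \<in> Supp_subq R (E k) U W \<Longrightarrow> x \<in> P"
  "P \<in> Supp_subq R (E k) U W \<Longrightarrow> P \<in> Supp_subq R (E k) U (B k)"
  "P \<in> Supp_subq R (E k) U W \<Longrightarrow> \<exists>Q\<in>Supp_subq R (E k) U (B k). Q \<subset> P"
proof -
  interpret M: noetherian_module R "E k" by (rule nmodE)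
  assume P: "P \<in> Supp_subq R (E k) U W"
  then obtain u where u: "u \<in> U" "\<forall>s\<in>carrier R - P. s \<odot>\<^bsub>E k\<^esub> u \<notin> W" by (auto simp: Supp_subq_def)
  have "x \<odot>\<^bsub>E k\<^esub> u = \<zero>\<^bsub>E k\<^esub> \<oplus>\<^bsub>E k\<^esub> x \<odot>\<^bsub>E k\<^esub> u" using u(1) UD(2) xR by simp
  then have "x \<odot>\<^bsub>E k\<^esub> u \<in> W" unfolding in_W using u(1) BD(1) by blast
  then show xP: "x \<in> P" using u(2) xR by blast
  show PB: "P \<in> Supp_subq R (E k) U (B k)" using P W(2) by (auto simp: Supp_subq_def)
  then obtain Q where Q: "Q \<in> Ass_subq R (E k) U (B k)" "Q \<subseteq> P"
    using M.Supp_subq_contains_Ass_subq[OF U_smod B_smod] by blast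
  interpret Q: primeideal Q R using Q(1) by (simp add: Ass_subq_def Spec_def)
  obtain v where v: "v \<in> U" "Q = conductor R (E k) (B k) v" using Q(1) by (auto simp: Ass_subq_def)
  have "x \<notin> Q"
  proof
    assume "x \<in> Q"
    then have "x \<odot>\<^bsub>E k\<^esub> v \<in> B k" unfolding v(2) by (simp add: conductor_def)
    then have "v \<in> B k" using regular v(1) by blast
    then have "\<one> \<in> Q" unfolding v(2) using v(1) UD(2) by (simp add: conductor_def)
    then show False using Q.one_notin by blast
  qed
  then show "\<exists>Q\<in>Supp_subq R (E k) U (B k). Q \<subset> P"
    using xP Q M.Ass_subq_subset_Supp_subq by blast
qed

lemma no_chain_W:
  assumes "\<not> has_chain (Supp_subq R (E k) U (B k)) (Suc n)"
  shows "\<not> has_chain (Supp_subq R (E k) U W) n"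
  using has_chain_extend[of "Supp_subq R (E k) U W" n "Supp_subq R (E k) U (B k)"] Supp_W(2,3) assms by blast

text \<open>
  The cohomology of the cone in degree \<open>i\<close> is an extension of the kernel of \<open>x\<close> on the cohomology of \<open>E\<close>
  in degree \<open>i\<close> by the cokernel of \<open>x\<close> in degree \<open>i - 1\<close>. So it is torsion except possibly for \<open>i = k\<close>,
  where the kernel vanishes because \<open>x\<close> is regular, and for \<open>i = k + 1\<close>, where the cokernel receives \<open>U\<close>.
\<close>

lemma cone_wl: "wl_complex R I F cone_d (Suc k) (cone_ext k U)"
proof (intro wl_complex.intro cone_complex wl_complex_axioms.intro)
  interpret M: module R "E k" by (rule modE)
  show "submodule (cone_ext k U) R (F (Suc k))" by (rule cone_ext_smod[OF U_smod])
  show "C.B (Suc k) \<subseteq> cone_ext k U" unfolding BF_Suc by (rule cone_ext_mono[OF B_U])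
  show "cone_ext k U \<subseteq> C.Z (Suc k)"
  proof
    interpret N: module R "E (Suc k)" by (rule modE)
    interpret O: module R "E (Suc (Suc k))" by (rule modE)
    fix w assume "w \<in> cone_ext k U"
    then obtain e t u where *: "e \<in> carrier (E k)" "t \<in> T (Suc k)" "u \<in> U"
      "w = c (\<delta> k e \<oplus>\<^bsub>E (Suc k)\<^esub> t, (x \<odot>\<^bsub>E k\<^esub> e) \<oplus>\<^bsub>E k\<^esub> u)" by (rule cone_extE)
    have tc: "t \<in> carrier (E (Suc k))" and uc: "u \<in> carrier (E k)" using * TD(2) UD(2) by auto
    have du: "\<delta> k u \<in> T (Suc k)" using * U_Z by (auto simp: Z_mod_tor_def)
    have "\<delta> (Suc k) (\<delta> k e \<oplus>\<^bsub>E (Suc k)\<^esub> t) = \<delta> (Suc k) t" using * tc d(1,2) dd by simp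
    moreover have "(x \<odot>\<^bsub>E (Suc k)\<^esub> (\<delta> k e \<oplus>\<^bsub>E (Suc k)\<^esub> t)) \<ominus>\<^bsub>E (Suc k)\<^esub> \<delta> k ((x \<odot>\<^bsub>E k\<^esub> e) \<oplus>\<^bsub>E k\<^esub> u) =
        (x \<odot>\<^bsub>E (Suc k)\<^esub> t) \<ominus>\<^bsub>E (Suc k)\<^esub> \<delta> k u"
      using * tc uc d(1,2,3) xR by (simp add: N.smult_r_distr N.diff_add_diff) (simp add: a_minus_def N.M.r_neg)
    moreover have "(x \<odot>\<^bsub>E (Suc k)\<^esub> t) \<ominus>\<^bsub>E (Suc k)\<^esub> \<delta> k u \<in> T (Suc k)"
      using TD(5)[OF TD(6)[OF xR *(2)] du] .
    ultimately show "w \<in> C.Z (Suc k)" unfolding *(4) in_ZF using * tc uc d(1) d_T[OF *(2)] xR by simp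
  qed
  have e_sat: "e \<in> saturation R I (E j) (B j)" if w: "c (e, f) \<in> C.Z j" for j e f
  proof (cases "j = k")
    case False
    moreover have "e \<in> Z j" using w unfolding in_ZF by (simp add: Z_mod_tor_def)
    ultimately show ?thesis using Z_B by blast
  next
    case True
    have w': "e \<in> carrier (E k)" "f \<in> carrier (E' k)" "\<delta> k e \<in> T (Suc k)"
      "(x \<odot>\<^bsub>E k\<^esub> e) \<ominus>\<^bsub>E k\<^esub> d' k f \<in> T k" using w unfolding True in_ZF by auto
    have "x \<odot>\<^bsub>E k\<^esub> e = d' k f \<oplus>\<^bsub>E k\<^esub> ((x \<odot>\<^bsub>E k\<^esub> e) \<ominus>\<^bsub>E k\<^esub> d' k f)"
      using w' xR dd'(1) by (simp add: M.add_diff_cancel)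
    then have "x \<odot>\<^bsub>E k\<^esub> e \<in> B k" unfolding in_B using w' by blast
    then have "e \<in> B k" using regular_Z w' by (auto simp: Z_mod_tor_def)
    then show ?thesis unfolding True using M.subset_saturation[OF B_smod] by blast
  qed
  show "C.Z (Suc k) \<subseteq> saturation R I (F (Suc k)) (cone_ext k U)"
  proof
    fix w assume w: "w \<in> C.Z (Suc k)"
    then obtain e f where ef: "w = c (e, f)" using F_cases[OF C.ZD(2)] by metis
    show "w \<in> saturation R I (F (Suc k)) (cone_ext k U)"
      unfolding ef using saturation_cone_ext[OF U_smod Z_U] e_sat w ef by blast
  qed
  show "C.Z j \<subseteq> saturation R I (F j) (C.B j)" if j: "j \<noteq> Suc k" for j
  proof
    interpret P: module R "F j" by (rule C.modE)
    fix w assume w: "w \<in> C.Z j"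
    then obtain e f where ef: "w = c (e, f)" "e \<in> carrier (E j)" "f \<in> carrier (E' j)" using F_cases[OF C.ZD(2)] by metis
    show "w \<in> saturation R I (F j) (C.B j)"
    proof (cases j)
      case (Suc i)
      have "Z i \<subseteq> saturation R I (E i) (B i)" using Z_B[of i] j Suc by blast
      then show ?thesis using saturation_cone_ext[OF B_smod] e_sat w ef(1) BF_Suc Suc by metis
    next
      case 0
      have "f = \<zero>\<^bsub>E' 0\<^esub>" using ef(3) unfolding 0 by (simp add: E'_def)
      have "e \<in> saturation R I (E 0) (B 0)" using e_sat w ef(1) 0 by metis
      then have "e \<in> T 0" unfolding B_0 using module.saturation_saturation[OF modE I] by blast
      moreover have "f \<in> torsion_part R I (E' 0)"
        unfolding \<open>f = _\<close> using module.smodD(1)[OF modE' module.saturation_smod[OF modE' module.zero_smod[OF modE'] I]] .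
      ultimately have "w \<in> C.B 0" unfolding C.B_0 ef(1) torsion_part_F by blast
      then show ?thesis using P.subset_saturation[OF C.B_smod] 0 by blast
    qed
  qed
  show "finite (Ass_subq R (F (Suc k)) (cone_ext k U) V)"
    if "submodule V R (F (Suc k))" "C.B (Suc k) \<subseteq> V" "V \<subseteq> cone_ext k U" for V
    using pull_U[OF that(1,2)] fin_Ass finite_subset by blast
qed

lemma cone_no_chain:
  assumes "\<not> has_chain (Supp_subq R (E k) U (B k)) (Suc n)"
  shows "\<not> has_chain (Supp_subq R (F (Suc k)) (cone_ext k U) (C.B (Suc k))) n"
proof -
  have "Supp_subq R (E k) U (pull_U (C.B (Suc k))) \<subseteq> Supp_subq R (E k) U W" by (rule Supp_subq_antimono[OF W_pull])
  with pull_U(5)[OF C.B_smod order_refl]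
  have "Supp_subq R (F (Suc k)) (cone_ext k U) (C.B (Suc k)) \<subseteq> Supp_subq R (E k) U W" by (rule subset_trans)
  then show ?thesis using has_chain_mono no_chain_W[OF assms] by blast
qed

text \<open>
  Cohomology classes of \<open>E\<close> that are killed by \<open>x\<close> come from the cone.
\<close>

lemma lift_to_cone:
  assumes z: "z \<in> Z (Suc j)" "x \<odot>\<^bsub>E (Suc j)\<^esub> z \<in> B (Suc j)"
  shows "\<exists>f. c (z, f) \<in> C.Z (Suc j)"
proof -
  interpret M: module R "E (Suc j)" by (rule modE)
  obtain f t where ft: "f \<in> carrier (E j)" "t \<in> T (Suc j)" "x \<odot>\<^bsub>E (Suc j)\<^esub> z = \<delta> j f \<oplus>\<^bsub>E (Suc j)\<^esub> t"
    using z(2) in_B_Suc by blast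
  have "\<delta> (Suc j) z \<in> T (Suc (Suc j))" "z \<in> carrier (E (Suc j))" using z(1) by (simp_all add: Z_mod_tor_def)
  then have "c (z, f) \<in> C.Z (Suc j)"
    unfolding in_ZF using ft d(1) TD(2) by (simp add: M.add_diff_cancel)
  then show ?thesis by blast
qed

abbreviation "U' i \<equiv> (B(k := U)) i"
abbreviation "UF' i \<equiv> ((\<lambda>i. C.B i)(Suc k := cone_ext k U)) i"

lemma UF'_fst: "c (e, f) \<in> UF' (Suc j) \<Longrightarrow> e \<in> B (Suc j)"
  using cone_ext_fst BF_Suc by (auto split: if_splits)

text \<open>
  Every element of \<open>Z i\<close> is moved into \<open>U' i\<close> by a power of \<open>x\<close>, so vanishing and support can be tested
  on the elements that \<open>x\<close> itself moves there. Above degree \<open>k\<close> these lift to the cone. In degree \<open>k\<close>,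
  multiplication by \<open>x\<close> embeds the elements of \<open>Z k/U\<close> killed by \<open>x\<close> into \<open>U/W\<close>, whose dimension is less
  than \<open>n\<close>; this degree occurs only for \<open>n = 0\<close> (vanishing) and \<open>n = 1\<close> (support).
\<close>

lemma vanishes_from_cone:
  assumes nc: "\<not> has_chain (Supp_subq R (E k) U (B k)) (Suc n)"
    and van: "vanishes_from R I F cone_d (Suc k) (cone_ext k U) n"
  shows "vanishes_from R I E \<delta> k U (Suc n)"
  unfolding vanishes_from_def
proof (intro conjI allI impI)
  interpret K: noetherian_module R "E k" by (rule nmodE)
  have van1: "C.Z i \<subseteq> UF' i" if "Suc k + n \<le> Suc i" for i
    using van that by (simp add: vanishes_from_def)
  have van2: "finite (Supp_subq R (F i) (C.Z i) (UF' i))" if "Suc k + n = Suc (Suc i)" for i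
    using van that by (simp add: vanishes_from_def)
  have Z_U': "Z i \<subseteq> saturation R I (E i) (U' i)" for i using Z_U Z_B by auto
  have cancel: "v \<in> U" if v: "v \<in> Z k" "x \<odot>\<^bsub>E k\<^esub> v \<in> W" for v
  proof -
    obtain b u where bu: "b \<in> B k" "u \<in> U" "x \<odot>\<^bsub>E k\<^esub> v = b \<oplus>\<^bsub>E k\<^esub> (x \<odot>\<^bsub>E k\<^esub> u)"
      using v(2) in_W by blast
    have c: "b \<in> carrier (E k)" "u \<in> carrier (E k)" "v \<in> carrier (E k)" using bu BD(2) UD(2) ZD(2) v by auto
    have "x \<odot>\<^bsub>E k\<^esub> (v \<ominus>\<^bsub>E k\<^esub> u) = (x \<odot>\<^bsub>E k\<^esub> v) \<ominus>\<^bsub>E k\<^esub> (x \<odot>\<^bsub>E k\<^esub> u)"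
      using c xR by (simp add: a_minus_def K.smult_r_distr K.smult_r_minus)
    also have "\<dots> = b" unfolding bu(3) using c xR by (simp add: K.add_diff_cancel)
    finally have "x \<odot>\<^bsub>E k\<^esub> (v \<ominus>\<^bsub>E k\<^esub> u) \<in> B k" using bu(1) by simp
    then have "v \<ominus>\<^bsub>E k\<^esub> u \<in> B k" using regular_Z ZD(5) v(1) bu(2) U_Z by blast
    then have "(v \<ominus>\<^bsub>E k\<^esub> u) \<oplus>\<^bsub>E k\<^esub> u \<in> U" using B_U UD(3) bu(2) by blast
    then show ?thesis using c by (simp add: K.add_diff_cancel)
  qed
  show "Z i \<subseteq> U' i" if i: "k + Suc n \<le> Suc i" for i
  proof
    interpret M: module R "E i" by (rule modE)
    have step: "z \<in> U' i" if z: "z \<in> Z i" "x \<odot>\<^bsub>E i\<^esub> z \<in> U' i" for z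
    proof (cases "i = k")
      case True
      then have "n = 0" using i by simp
      then have "Supp_subq R (E k) U W = {}" using no_chain_W[OF nc] by (simp add: has_chain_0)
      then have "U \<subseteq> W" by (rule K.Supp_subq_empty_imp_subset[OF U_smod W(1)])
      then show ?thesis using cancel z True by auto
    next
      case False
      then obtain j where j: "i = Suc j" using i by (cases i) auto
      obtain f where "c (z, f) \<in> C.Z (Suc j)" using lift_to_cone[of z j] z False j by auto
      then have "c (z, f) \<in> UF' (Suc j)" using van1[of "Suc j"] i j by auto
      then show ?thesis using UF'_fst False j by auto
    qed
    fix z assume z: "z \<in> Z i"
    then obtain m :: nat where "(x [^] m) \<odot>\<^bsub>E i\<^esub> z \<in> U' i"
      using saturationE[OF subsetD[OF Z_U' z] x] by blast
    then show "z \<in> U' i"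
    proof (induction m)
      case 0
      then show ?case using z ZD(2) by simp
    next
      case (Suc m)
      have "x \<odot>\<^bsub>E i\<^esub> ((x [^] m) \<odot>\<^bsub>E i\<^esub> z) \<in> U' i"
        using Suc.prems M.smult_pow_Suc[OF xR ZD(2)[OF z]] by metis
      then have "(x [^] m) \<odot>\<^bsub>E i\<^esub> z \<in> U' i" by (rule step[OF ZD(6)[OF nat_pow_closed[OF xR] z]])
      then show ?case by (rule Suc.IH)
    qed
  qed
  show "finite (Supp_subq R (E i) (Z i) (U' i))" if i: "k + Suc n = Suc (Suc i)" for i
  proof -
    interpret M: module R "E i" by (rule modE)
    have wit: "\<exists>z\<in>Z i. x \<odot>\<^bsub>E i\<^esub> z \<in> U' i \<and> (\<forall>s\<in>carrier R - P. s \<odot>\<^bsub>E i\<^esub> z \<notin> U' i)"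
      if P: "P \<in> Supp_subq R (E i) (Z i) (U' i)" for P
    proof -
      interpret P: primeideal P R using P by (simp add: Supp_subq_def Spec_def)
      have one: "\<one> \<in> carrier R - P" using P.one_notin by blast
      obtain z where z: "z \<in> Z i" "\<forall>s\<in>carrier R - P. s \<odot>\<^bsub>E i\<^esub> z \<notin> U' i" using P by (auto simp: Supp_subq_def)
      have zc: "z \<in> carrier (E i)" using z ZD(2) by blast
      \<comment> \<open>Take the last multiple of \<open>z\<close> by a power of \<open>x\<close> that survives localization at \<open>P\<close>.\<close>
      define q where "q m = (\<exists>s\<in>carrier R - P. s \<odot>\<^bsub>E i\<^esub> ((x [^] m) \<odot>\<^bsub>E i\<^esub> z) \<in> U' i)" for m :: nat
      obtain m :: nat where "(x [^] m) \<odot>\<^bsub>E i\<^esub> z \<in> U' i"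
        using saturationE[OF subsetD[OF Z_U' z(1)] x] by blast
      then have "q m" unfolding q_def using one zc xR by (intro bexI[of _ \<one>]) auto
      moreover have "\<not> q 0" using z(2) zc by (simp add: q_def)
      ultimately obtain l where l: "\<not> q l" "q (Suc l)"
        using ex_least_nat_less[of q m] by auto
      then obtain s where s: "s \<in> carrier R - P" "s \<odot>\<^bsub>E i\<^esub> ((x [^] Suc l) \<odot>\<^bsub>E i\<^esub> z) \<in> U' i"
        by (auto simp: q_def)
      define y where "y = s \<odot>\<^bsub>E i\<^esub> ((x [^] l) \<odot>\<^bsub>E i\<^esub> z)"
      have pc: "x [^] l \<in> carrier R" "s \<in> carrier R" using xR s by auto
      have "y \<in> Z i" using ZD(6) z(1) pc by (simp add: y_def)
      moreover have "x \<odot>\<^bsub>E i\<^esub> y = s \<odot>\<^bsub>E i\<^esub> ((x [^] Suc l) \<odot>\<^bsub>E i\<^esub> z)"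
        unfolding y_def M.smult_pow_Suc[OF xR zc, symmetric] by (rule M.smult_comm[OF xR pc(2)]) (use pc zc in simp)
      moreover have "t \<odot>\<^bsub>E i\<^esub> y \<notin> U' i" if t: "t \<in> carrier R - P" for t
      proof -
        have "t \<otimes> s \<in> carrier R - P" using t s P.I_prime by auto
        then have "(t \<otimes> s) \<odot>\<^bsub>E i\<^esub> ((x [^] l) \<odot>\<^bsub>E i\<^esub> z) \<notin> U' i" using l(1) by (auto simp: q_def)
        then show ?thesis using t pc zc by (simp add: y_def M.smult_assoc1)
      qed
      ultimately show ?thesis using s(2) by metis
    qed
    consider "i = k" | "i > k" | "i < k" by linarith
    then show ?thesis
    proof cases
      case 1
      have n: "n = Suc 0" using i 1 by simp
      have "Supp_subq R (E i) (Z i) (U' i) \<subseteq> Supp_subq R (E k) U W"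
      proof
        fix P assume P: "P \<in> Supp_subq R (E i) (Z i) (U' i)"
        then obtain z where z: "z \<in> Z k" "x \<odot>\<^bsub>E k\<^esub> z \<in> U" "\<forall>s\<in>carrier R - P. s \<odot>\<^bsub>E k\<^esub> z \<notin> U"
          using wit[OF P] 1 by auto
        have "s \<odot>\<^bsub>E k\<^esub> (x \<odot>\<^bsub>E k\<^esub> z) \<notin> W" if s: "s \<in> carrier R - P" for s
        proof
          assume "s \<odot>\<^bsub>E k\<^esub> (x \<odot>\<^bsub>E k\<^esub> z) \<in> W"
          then have "x \<odot>\<^bsub>E k\<^esub> (s \<odot>\<^bsub>E k\<^esub> z) \<in> W" using K.smult_comm[of x s z] xR s z(1) ZD(2) by simp
          then have "s \<odot>\<^bsub>E k\<^esub> z \<in> U" using cancel ZD(6) s z(1) by blast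
          then show False using z(3) s by blast
        qed
        then show "P \<in> Supp_subq R (E k) U W" using P z(2) by (auto simp: Supp_subq_def)
      qed
      moreover have "finite (Supp_subq R (E k) U W)"
        using K.finite_Supp_subq_dim0[OF U_smod W(1) fin_Ass[OF W]] no_chain_W[OF nc] n by simp
      ultimately show ?thesis using finite_subset by blast
    next
      case 2
      then obtain j where j: "i = Suc j" by (cases i) auto
      have "Supp_subq R (E i) (Z i) (U' i) \<subseteq> Supp_subq R (F i) (C.Z i) (UF' i)"
      proof
        fix P assume P: "P \<in> Supp_subq R (E i) (Z i) (U' i)"
        then obtain z where z: "z \<in> Z i" "x \<odot>\<^bsub>E i\<^esub> z \<in> B i" "\<forall>s\<in>carrier R - P. s \<odot>\<^bsub>E i\<^esub> z \<notin> B i"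
          using wit[OF P] 2 by auto
        obtain f where f: "c (z, f) \<in> C.Z i" using lift_to_cone[of z j] z j by auto
        have "s \<odot>\<^bsub>F i\<^esub> c (z, f) \<notin> UF' i" if s: "s \<in> carrier R - P" for s
          using UF'_fst[of "s \<odot>\<^bsub>E i\<^esub> z" _ j] z(3) s unfolding j by (metis Fs(4))
        moreover have "P \<in> Spec R" using P by (simp add: Supp_subq_def)
        ultimately show "P \<in> Supp_subq R (F i) (C.Z i) (UF' i)" using f unfolding Supp_subq_def by blast
      qed
      moreover have "finite (Supp_subq R (F i) (C.Z i) (UF' i))" using van2 i by simp
      ultimately show ?thesis using finite_subset by blast
    next
      case 3
      have "Supp_subq R (E i) (B i) (B i) = {}" by (rule noetherian_module.Supp_subq_self[OF nmodE B_smod])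
      then show ?thesis using exact_lt_k 3 by simp
    qed
  qed
qed

end

section \<open>Induction on the dimension\<close>

text \<open>
  \<open>interleave\<close> encodes pairs of elements of a type of sequences in that type itself, so that the cone
  construction can be iterated on it; \<open>head_tail\<close> moves the first cone from an arbitrary type to a type
  of sequences.
\<close>

definition interleave :: "(nat \<Rightarrow> 'e) \<times> (nat \<Rightarrow> 'e) \<Rightarrow> nat \<Rightarrow> 'e"
  where "interleave p n = (if even n then fst p (n div 2) else snd p (n div 2))"

lemma inj_interleave: "inj interleave"
proof (rule injI)
  fix p q :: "(nat \<Rightarrow> 'e) \<times> (nat \<Rightarrow> 'e)"
  assume eq: "interleave p = interleave q"
  have "fst p n = fst q n" "snd p n = snd q n" for n
    using fun_cong[OF eq, of "2 * n"] fun_cong[OF eq, of "Suc (2 * n)"] by (auto simp: interleave_def)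
  then show "p = q" by (auto intro: prod_eqI)
qed

definition head_tail :: "'e \<times> 'e \<Rightarrow> nat \<Rightarrow> 'e"
  where "head_tail p n = (if n = 0 then fst p else snd p)"

lemma inj_head_tail: "inj head_tail"
proof (rule injI)
  fix p q :: "'e \<times> 'e"
  assume eq: "head_tail p = head_tail q"
  show "p = q" using fun_cong[OF eq, of 0] fun_cong[OF eq, of 1]
    by (cases p; cases q) (simp add: head_tail_def)
qed

text \<open>
  The inductive step passes from complexes carried by \<open>'e\<close> to cones carried by another type, so the
  carrier type is a parameter of the statement.
\<close>

definition vanishing_for_type :: "('r, 'b) ring_scheme \<Rightarrow> 'r set \<Rightarrow> 'e itself \<Rightarrow> nat \<Rightarrow> bool"
  where "vanishing_for_type R I t n \<longleftrightarrow> (\<forall>(E :: nat \<Rightarrow> ('r, 'e) module) \<delta> k U. wl_complex R I E \<delta> k U \<longrightarrow>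
    \<not> has_chain (Supp_subq R (E k) U (B_mod_tor R I E \<delta> k)) n \<longrightarrow> vanishes_from R I E \<delta> k U n)"

lemma vanishing_for_type_0: "vanishing_for_type R I t 0"
  unfolding vanishing_for_type_def using wl_complex.vanishes_from_0 by blast

lemma vanishing_for_type_Suc:
  fixes c :: "'e \<times> 'e \<Rightarrow> 'u"
  assumes c: "inj c" and IH: "vanishing_for_type R I TYPE('u) n"
  shows "vanishing_for_type R I TYPE('e) (Suc n)"
  unfolding vanishing_for_type_def
proof (intro allI impI)
  fix E :: "nat \<Rightarrow> ('a, 'e) module" and \<delta> k U
  assume wl: "wl_complex R I E \<delta> k U" and nc: "\<not> has_chain (Supp_subq R (E k) U (B_mod_tor R I E \<delta> k)) (Suc n)"
  interpret wl_complex R I E \<delta> k U by fact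
  obtain x where x: "x \<in> I" "\<forall>u\<in>U. x \<odot>\<^bsub>E k\<^esub> u \<in> B k \<longrightarrow> u \<in> B k"
    using regular_element_exists by blast
  interpret wl_cone R I E \<delta> k U x c by unfold_locales (use x c in auto)
  have "vanishes_from R I F cone_d (Suc k) (cone_ext k U) n"
    using IH cone_wl cone_no_chain[OF nc] unfolding vanishing_for_type_def by blast
  then show "vanishes_from R I E \<delta> k U (Suc n)" by (rule vanishes_from_cone[OF nc])
qed

lemma vanishing_for_function_type: "vanishing_for_type R I TYPE(nat \<Rightarrow> 'e) n"
proof (induction n)
  case 0
  show ?case by (rule vanishing_for_type_0)
next
  case (Suc n)
  then show ?case by (rule vanishing_for_type_Suc[OF inj_interleave])
qed

lemma vanishing: "vanishing_for_type R I TYPE('e) n"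
proof (cases n)
  case 0
  then show ?thesis by (simp add: vanishing_for_type_0)
next
  case (Suc m)
  then show ?thesis using vanishing_for_type_Suc[OF inj_head_tail vanishing_for_function_type] by simp
qed

section \<open>Quotient modules and cohomology\<close>

context module
begin

lemma in_coset: "y \<in> U +>\<^bsub>M\<^esub> x \<longleftrightarrow> (\<exists>u\<in>U. y = u \<oplus>\<^bsub>M\<^esub> x)"
  by (auto simp: a_r_coset_def')

lemma coset_eq_iff:
  assumes U: "submodule U R M" and x: "x \<in> carrier M" and y: "y \<in> carrier M"
  shows "U +>\<^bsub>M\<^esub> x = U +>\<^bsub>M\<^esub> y \<longleftrightarrow> x \<ominus>\<^bsub>M\<^esub> y \<in> U"
proof
  note UD = smodD[OF U]
  assume "U +>\<^bsub>M\<^esub> x = U +>\<^bsub>M\<^esub> y"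
  moreover have "\<zero>\<^bsub>M\<^esub> \<oplus>\<^bsub>M\<^esub> x \<in> U +>\<^bsub>M\<^esub> x" using UD(1) in_coset by blast
  ultimately obtain u where "u \<in> U" "x = u \<oplus>\<^bsub>M\<^esub> y" using x in_coset by auto
  then show "x \<ominus>\<^bsub>M\<^esub> y \<in> U" using y UD(2) by (simp add: add_diff_cancel)
next
  note UD = smodD[OF U]
  have sub: "U +>\<^bsub>M\<^esub> v \<subseteq> U +>\<^bsub>M\<^esub> w" if vw: "v \<in> carrier M" "w \<in> carrier M" "v \<ominus>\<^bsub>M\<^esub> w \<in> U" for v w
  proof
    fix z assume "z \<in> U +>\<^bsub>M\<^esub> v"
    then obtain u where u: "u \<in> U" "z = u \<oplus>\<^bsub>M\<^esub> v" using in_coset by blast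
    have "z = (u \<oplus>\<^bsub>M\<^esub> (v \<ominus>\<^bsub>M\<^esub> w)) \<oplus>\<^bsub>M\<^esub> w"
      using u vw UD(2) by (simp add: M.a_assoc add_diff_cancel)
    then show "z \<in> U +>\<^bsub>M\<^esub> w" unfolding in_coset using UD(3) u(1) vw(3) by blast
  qed
  assume xy: "x \<ominus>\<^bsub>M\<^esub> y \<in> U"
  have "y \<ominus>\<^bsub>M\<^esub> x = \<ominus>\<^bsub>M\<^esub> (x \<ominus>\<^bsub>M\<^esub> y)" using x y by (simp add: a_minus_def M.minus_add M.a_comm)
  then have "y \<ominus>\<^bsub>M\<^esub> x \<in> U" using UD(4) xy by simp
  then show "U +>\<^bsub>M\<^esub> x = U +>\<^bsub>M\<^esub> y" using sub x y xy by blast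
qed

lemma coset_zero_iff:
  assumes U: "submodule U R M" and x: "x \<in> carrier M"
  shows "U +>\<^bsub>M\<^esub> x = U \<longleftrightarrow> x \<in> U"
proof -
  have "U +>\<^bsub>M\<^esub> \<zero>\<^bsub>M\<^esub> = U" using smodD(2)[OF U] by (auto simp: in_coset)
  moreover have "x \<ominus>\<^bsub>M\<^esub> \<zero>\<^bsub>M\<^esub> = x" using x by (simp add: a_minus_def neg_zero)
  ultimately show ?thesis using coset_eq_iff[OF U x M.zero_closed] by simp
qed

lemma quot_module_simps:
  assumes U: "submodule U R M"
  shows "X \<in> carrier (quot_module M U) \<longleftrightarrow> (\<exists>x\<in>carrier M. X = U +>\<^bsub>M\<^esub> x)"
    "\<zero>\<^bsub>quot_module M U\<^esub> = U"
    "\<And>x y. x \<in> carrier M \<Longrightarrow> y \<in> carrier M \<Longrightarrow> (U +>\<^bsub>M\<^esub> x) \<oplus>\<^bsub>quot_module M U\<^esub> (U +>\<^bsub>M\<^esub> y) = U +>\<^bsub>M\<^esub> (x \<oplus>\<^bsub>M\<^esub> y)"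
    "\<And>a x. a \<in> carrier R \<Longrightarrow> x \<in> carrier M \<Longrightarrow> a \<odot>\<^bsub>quot_module M U\<^esub> (U +>\<^bsub>M\<^esub> x) = U +>\<^bsub>M\<^esub> (a \<odot>\<^bsub>M\<^esub> x)"
proof -
  note UD = smodD[OF U]
  show "X \<in> carrier (quot_module M U) \<longleftrightarrow> (\<exists>x\<in>carrier M. X = U +>\<^bsub>M\<^esub> x)"
    by (auto simp: quot_module_def A_RCOSETS_def')
  show "\<zero>\<^bsub>quot_module M U\<^esub> = U" by (simp add: quot_module_def)
  have "abelian_subgroup U M"
    by (rule abelian_subgroupI3) (use U M.abelian_group_axioms in \<open>auto simp: submodule_def additive_subgroup_def\<close>)
  then show "(U +>\<^bsub>M\<^esub> x) \<oplus>\<^bsub>quot_module M U\<^esub> (U +>\<^bsub>M\<^esub> y) = U +>\<^bsub>M\<^esub> (x \<oplus>\<^bsub>M\<^esub> y)"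
    if "x \<in> carrier M" "y \<in> carrier M" for x y
    using that abelian_subgroup.a_rcos_sum by (simp add: quot_module_def)
  show "a \<odot>\<^bsub>quot_module M U\<^esub> (U +>\<^bsub>M\<^esub> x) = U +>\<^bsub>M\<^esub> (a \<odot>\<^bsub>M\<^esub> x)"
    if ax: "a \<in> carrier R" "x \<in> carrier M" for a x
  proof -
    have eq: "U +>\<^bsub>M\<^esub> (a \<odot>\<^bsub>M\<^esub> y) = U +>\<^bsub>M\<^esub> (a \<odot>\<^bsub>M\<^esub> x)" if y: "y \<in> U +>\<^bsub>M\<^esub> x" for y
    proof -
      obtain u where u: "u \<in> U" "y = u \<oplus>\<^bsub>M\<^esub> x" using y in_coset by blast
      have "(a \<odot>\<^bsub>M\<^esub> y) \<ominus>\<^bsub>M\<^esub> (a \<odot>\<^bsub>M\<^esub> x) = a \<odot>\<^bsub>M\<^esub> u"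
        using u ax UD(2) by (simp add: smult_r_distr add_diff_cancel)
      then show ?thesis using coset_eq_iff[OF U] u ax UD(2,6) by simp
    qed
    have "\<zero>\<^bsub>M\<^esub> \<oplus>\<^bsub>M\<^esub> x \<in> U +>\<^bsub>M\<^esub> x" using UD(1) in_coset by blast
    then show ?thesis unfolding quot_module_def using eq by auto
  qed
qed

lemma quot_module_module:
  assumes U: "submodule U R M"
  shows "module R (quot_module M U)" (is "module R ?Q")
proof (rule moduleI[OF R.is_cring])
  note q = quot_module_simps[OF U]
  have U0: "U = U +>\<^bsub>M\<^esub> \<zero>\<^bsub>M\<^esub>" using coset_zero_iff[OF U M.zero_closed] smodD(1)[OF U] by simp
  show "abelian_group ?Q"
  proof (rule abelian_groupI)
    show "\<zero>\<^bsub>?Q\<^esub> \<in> carrier ?Q" unfolding q(1,2) using U0 by blast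
    show "\<zero>\<^bsub>?Q\<^esub> \<oplus>\<^bsub>?Q\<^esub> X = X" if X: "X \<in> carrier ?Q" for X
    proof -
      obtain x where x: "x \<in> carrier M" "X = U +>\<^bsub>M\<^esub> x" using X q(1) by blast
      have "(U +>\<^bsub>M\<^esub> \<zero>\<^bsub>M\<^esub>) \<oplus>\<^bsub>?Q\<^esub> X = X" unfolding x(2) using x(1) q(3) by simp
      then show ?thesis unfolding q(2) U0[symmetric] .
    qed
    show "\<exists>Y\<in>carrier ?Q. Y \<oplus>\<^bsub>?Q\<^esub> X = \<zero>\<^bsub>?Q\<^esub>" if X: "X \<in> carrier ?Q" for X
    proof -
      obtain x where x: "x \<in> carrier M" "X = U +>\<^bsub>M\<^esub> x" using X q(1) by blast
      have "(U +>\<^bsub>M\<^esub> (\<ominus>\<^bsub>M\<^esub> x)) \<oplus>\<^bsub>?Q\<^esub> X = \<zero>\<^bsub>?Q\<^esub>"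
        unfolding x(2) q(2) using x(1) q(3)[of "\<ominus>\<^bsub>M\<^esub> x" x] U0 by (simp add: M.l_neg)
      moreover have "U +>\<^bsub>M\<^esub> (\<ominus>\<^bsub>M\<^esub> x) \<in> carrier ?Q" unfolding q(1) using x(1) M.a_inv_closed by blast
      ultimately show ?thesis by blast
    qed
  qed (unfold q(1), safe, use q(3) in \<open>auto simp: M.a_ac\<close>)
qed (unfold quot_module_simps(1)[OF U], safe, use quot_module_simps(3,4)[OF U] in
    \<open>auto simp: smult_l_distr smult_r_distr smult_assoc1\<close>)

end

text \<open>
  The fraction \<open>u/1\<close> is zero iff some \<open>s\<close> outside \<open>P\<close> kills \<open>u\<close>, and the localization is zero iff all
  these fractions are.
\<close>

lemma Supp_eq_Supp_subq:
  assumes "module R M"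
  shows "Supp R M = Supp_subq R M (carrier M) {\<zero>\<^bsub>M\<^esub>}"
proof -
  interpret M: module R M by fact
  have "localization_carrier M (carrier R - P) \<noteq> {localization_zero R M (carrier R - P)} \<longleftrightarrow>
    (\<exists>u\<in>carrier M. \<forall>s\<in>carrier R - P. s \<odot>\<^bsub>M\<^esub> u \<noteq> \<zero>\<^bsub>M\<^esub>)" (is "?L \<longleftrightarrow> ?R") if P: "primeideal P R" for P
  proof
    interpret P: primeideal P R by fact
    let ?S = "carrier R - P"
    have one: "\<one>\<^bsub>R\<^esub> \<in> ?S" using P.one_notin by blast
    have mul: "s \<otimes>\<^bsub>R\<^esub> t \<in> ?S" if "s \<in> ?S" "t \<in> ?S" for s t using that P.I_prime by auto
    {
      assume ?L
      show ?R
      proof (rule ccontr)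
        assume "\<not> ?R"
        then have kill: "\<forall>u\<in>carrier M. \<exists>s\<in>?S. s \<odot>\<^bsub>M\<^esub> u = \<zero>\<^bsub>M\<^esub>" by blast
        have "\<exists>w\<in>?S. w \<odot>\<^bsub>M\<^esub> (t \<odot>\<^bsub>M\<^esub> u) = w \<odot>\<^bsub>M\<^esub> (s \<odot>\<^bsub>M\<^esub> v)"
          if uv: "u \<in> carrier M" "v \<in> carrier M" "s \<in> ?S" "t \<in> ?S" for u v s t
        proof -
          obtain p q where pq: "p \<in> ?S" "p \<odot>\<^bsub>M\<^esub> (t \<odot>\<^bsub>M\<^esub> u) = \<zero>\<^bsub>M\<^esub>" "q \<in> ?S" "q \<odot>\<^bsub>M\<^esub> (s \<odot>\<^bsub>M\<^esub> v) = \<zero>\<^bsub>M\<^esub>"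
            using kill uv by (metis Diff_iff M.smult_closed)
          have "(p \<otimes>\<^bsub>R\<^esub> q) \<odot>\<^bsub>M\<^esub> (t \<odot>\<^bsub>M\<^esub> u) = q \<odot>\<^bsub>M\<^esub> (p \<odot>\<^bsub>M\<^esub> (t \<odot>\<^bsub>M\<^esub> u))"
            "(p \<otimes>\<^bsub>R\<^esub> q) \<odot>\<^bsub>M\<^esub> (s \<odot>\<^bsub>M\<^esub> v) = p \<odot>\<^bsub>M\<^esub> (q \<odot>\<^bsub>M\<^esub> (s \<odot>\<^bsub>M\<^esub> v))"
            using pq(1,3) uv by (simp_all add: M.smult_assoc1 M.smult_comm[of p q])
          then have "(p \<otimes>\<^bsub>R\<^esub> q) \<odot>\<^bsub>M\<^esub> (t \<odot>\<^bsub>M\<^esub> u) = (p \<otimes>\<^bsub>R\<^esub> q) \<odot>\<^bsub>M\<^esub> (s \<odot>\<^bsub>M\<^esub> v)"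
            using pq by simp
          then show ?thesis using mul[OF pq(1,3)] by blast
        qed
        then have "frac_rel M ?S = (carrier M \<times> ?S) \<times> (carrier M \<times> ?S)"
          unfolding frac_rel_def by auto
        then have "localization_carrier M ?S = {localization_zero R M ?S}"
          using one by (auto simp: localization_carrier_def localization_zero_def quotient_def)
        with \<open>?L\<close> show False by blast
      qed
    next
      assume ?R
      then obtain u where u: "u \<in> carrier M" "\<forall>s\<in>?S. s \<odot>\<^bsub>M\<^esub> u \<noteq> \<zero>\<^bsub>M\<^esub>" by blast
      have "(u, \<one>\<^bsub>R\<^esub>) \<in> frac_rel M ?S `` {(u, \<one>\<^bsub>R\<^esub>)}" using u(1) one by (auto simp: frac_rel_def)
      moreover have "(u, \<one>\<^bsub>R\<^esub>) \<notin> localization_zero R M ?S"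
        using u by (auto simp: localization_zero_def frac_rel_def)
      moreover have "frac_rel M ?S `` {(u, \<one>\<^bsub>R\<^esub>)} \<in> localization_carrier M ?S"
        using u(1) one by (auto simp: localization_carrier_def quotient_def)
      ultimately show ?L by (metis singletonD)
    }
  qed
  then show ?thesis by (auto simp: Supp_def Supp_subq_def Spec_def)
qed

text \<open>
  Links the quotient modules in the statement to the description by conductors.
\<close>

lemma subquotient:
  assumes M: "module R M" and K: "submodule K R M" and U: "submodule U R M" "U \<subseteq> K"
  defines "Q \<equiv> quot_module (M\<lparr>carrier := K\<rparr>) U"
  shows "module R Q" "Supp R Q = Supp_subq R M K U" "Ass R Q = Ass_subq R M K U"
proof -
  interpret M: module R M by fact
  note KD = M.smodD[OF K] and UD = M.smodD[OF U(1)]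
  have MK: "module R (M\<lparr>carrier := K\<rparr>)" using submodule.submodule_is_module[OF K M] .
  interpret K: module R "M\<lparr>carrier := K\<rparr>" by (rule MK)
  have UK: "submodule U R (M\<lparr>carrier := K\<rparr>)"
    by (rule K.smoduleI) (use U(2) UD in auto)
  note q = K.quot_module_simps[OF UK, folded Q_def] and z = K.coset_zero_iff[OF UK]
  show Q: "module R Q" unfolding Q_def by (rule K.quot_module_module[OF UK])
  have zero: "a \<odot>\<^bsub>Q\<^esub> (U +>\<^bsub>M\<lparr>carrier := K\<rparr>\<^esub> x) = \<zero>\<^bsub>Q\<^esub> \<longleftrightarrow> a \<odot>\<^bsub>M\<^esub> x \<in> U" if "a \<in> carrier R" "x \<in> K" for a x
    using q(2,4) z[of "a \<odot>\<^bsub>M\<^esub> x"] that KD(6) by simp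
  show "Supp R Q = Supp_subq R M K U"
    unfolding Supp_eq_Supp_subq[OF Q] Supp_subq_def Bex_def q(1) using zero by auto
  show "Ass R Q = Ass_subq R M K U"
    unfolding Ass_def Ass_subq_def Bex_def q(1) conductor_def using zero by (auto cong: conj_cong)
qed

lemma Ass_quot_module:
  assumes "module R M" "submodule U R M"
  shows "Ass R (quot_module M U) = Ass_subq R M (carrier M) U"
proof -
  interpret M: module R M by fact
  show ?thesis
    using subquotient(3)[OF assms(1) M.carrier_is_submodule assms(2)] M.smodD(2)[OF assms(2)] by auto
qed

text \<open>
  Associated primes of a quotient of \<open>M\<close> lie in the support of \<open>M\<close>.
\<close>

lemma finite_Supp_imp_weakly_Laskerian:
  assumes M: "module R M" and fin: "finite (Supp R M)"
  shows "weakly_Laskerian R M"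
  unfolding weakly_Laskerian_def
proof (intro conjI allI impI M)
  interpret M: module R M by fact
  fix U assume U: "submodule U R M"
  have "Ass_subq R M (carrier M) U \<subseteq> Supp_subq R M (carrier M) {\<zero>\<^bsub>M\<^esub>}"
  proof
    fix P assume P: "P \<in> Ass_subq R M (carrier M) U"
    then obtain u where u: "u \<in> carrier M" "P = conductor R M U u" by (auto simp: Ass_subq_def)
    have "\<forall>s\<in>carrier R - P. s \<odot>\<^bsub>M\<^esub> u \<notin> {\<zero>\<^bsub>M\<^esub>}"
      using M.smodD(1)[OF U] unfolding u(2) by (auto simp: conductor_def)
    moreover have "P \<in> Spec R" using P by (simp add: Ass_subq_def)
    ultimately show "P \<in> Supp_subq R M (carrier M) {\<zero>\<^bsub>M\<^esub>}" using u(1) unfolding Supp_subq_def by blast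
  qed
  then show "finite (Ass R (quot_module M U))"
    using fin finite_subset Ass_quot_module[OF M U] Supp_eq_Supp_subq[OF M] by metis
qed

section \<open>Local cohomology of a weakly Laskerian module\<close>

text \<open>
  Let \<open>X\<close> be the submodule of elements killed by a power of \<open>I\<close>. It is closed in the sense that \<open>v \<in> X\<close>
  whenever \<open>I v \<subseteq> X\<close>, because the exponent can be chosen uniformly in \<open>a \<in> I\<close>. If \<open>P\<close> were an
  associated prime of the elementwise torsion modulo \<open>X\<close>, it would contain a power of each element of \<open>I\<close>,
  hence \<open>I\<close> itself, contradicting this.
\<close>

lemma (in noetherian_module) torsion_carrier:
  assumes I: "ideal I R"
  shows "carrier (torsion R I M) = saturation R I M {\<zero>\<^bsub>M\<^esub>}"
proof -
  define Pw where "Pw n = I [^]\<^bsub>ideals_set R\<^esub> (n::nat)" for n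
  have Pw_0: "Pw 0 = carrier R" by (simp add: Pw_def ideals_set_def)
  have Pw_Suc: "Pw (Suc n) = Pw n \<cdot> I" for n by (simp add: Pw_def ideals_set_def)
  have Pw_ideal: "ideal (Pw n) R" for n
    by (induction n) (simp_all add: Pw_0 Pw_Suc R.oneideal R.ideal_prod_is_ideal I)
  have Pw_mono: "Pw (n + m) \<subseteq> Pw n" for n m
  proof (induction m)
    case (Suc m)
    then show ?case using R.ideal_prod_inter[OF Pw_ideal I, of "n + m"] by (simp add: Pw_Suc) blast
  qed simp
  have kills_mono: "\<forall>b\<in>Pw m. b \<odot>\<^bsub>M\<^esub> v = \<zero>\<^bsub>M\<^esub>" if "\<forall>b\<in>Pw n. b \<odot>\<^bsub>M\<^esub> v = \<zero>\<^bsub>M\<^esub>" "n \<le> m" for n m v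
    using that Pw_mono[of n "m - n"] by auto
  define X where "X = {v \<in> carrier M. \<exists>n. \<forall>b\<in>Pw n. b \<odot>\<^bsub>M\<^esub> v = \<zero>\<^bsub>M\<^esub>}"
  have Pc: "b \<in> carrier R" if "b \<in> Pw n" for b n using ideal.Icarr[OF Pw_ideal that] .
  have Ic: "b \<in> carrier R" if "b \<in> I" for b using ideal.Icarr[OF I that] .
  have X_smod: "submodule X R M"
  proof (rule smoduleI)
    show "X \<subseteq> carrier M" by (auto simp: X_def)
    show "\<zero>\<^bsub>M\<^esub> \<in> X" using Pc by (auto simp: X_def)
    fix u v assume "u \<in> X" "v \<in> X"
    then obtain n m where nm: "u \<in> carrier M" "v \<in> carrier M" "\<forall>b\<in>Pw n. b \<odot>\<^bsub>M\<^esub> u = \<zero>\<^bsub>M\<^esub>" "\<forall>b\<in>Pw m. b \<odot>\<^bsub>M\<^esub> v = \<zero>\<^bsub>M\<^esub>"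
      by (auto simp: X_def)
    have "\<forall>b\<in>Pw (max n m). b \<odot>\<^bsub>M\<^esub> (u \<oplus>\<^bsub>M\<^esub> v) = \<zero>\<^bsub>M\<^esub>"
      using kills_mono[OF nm(3), of "max n m"] kills_mono[OF nm(4), of "max n m"] nm(1,2) Pc
      by (simp add: smult_r_distr)
    then show "u \<oplus>\<^bsub>M\<^esub> v \<in> X" using nm by (auto simp: X_def)
  next
    fix a v assume a: "a \<in> carrier R" and "v \<in> X"
    then obtain n where "v \<in> carrier M" "\<forall>b\<in>Pw n. b \<odot>\<^bsub>M\<^esub> v = \<zero>\<^bsub>M\<^esub>" by (auto simp: X_def)
    then have "\<forall>b\<in>Pw n. b \<odot>\<^bsub>M\<^esub> (a \<odot>\<^bsub>M\<^esub> v) = \<zero>\<^bsub>M\<^esub>" using Pc a by (simp add: smult_comm[of _ a])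
    then show "a \<odot>\<^bsub>M\<^esub> v \<in> X" using a \<open>v \<in> carrier M\<close> by (auto simp: X_def)
  qed
  have closed: "v \<in> X" if v: "v \<in> carrier M" "\<And>a. a \<in> I \<Longrightarrow> a \<odot>\<^bsub>M\<^esub> v \<in> X" for v
  proof -
    have cX: "ideal ({a \<in> I. \<forall>b\<in>Pw n. b \<odot>\<^bsub>M\<^esub> (a \<odot>\<^bsub>M\<^esub> v) = \<zero>\<^bsub>M\<^esub>}) R" for n
    proof (rule idealI[OF R.ring_axioms])
      interpret I: ideal I R by (rule I)
      show "subgroup {a \<in> I. \<forall>b\<in>Pw n. b \<odot>\<^bsub>M\<^esub> (a \<odot>\<^bsub>M\<^esub> v) = \<zero>\<^bsub>M\<^esub>} (add_monoid R)"
      proof (rule R.add.subgroupI)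
        show "{a \<in> I. \<forall>b\<in>Pw n. b \<odot>\<^bsub>M\<^esub> (a \<odot>\<^bsub>M\<^esub> v) = \<zero>\<^bsub>M\<^esub>} \<noteq> {}"
          using v(1) Pc I.zero_closed by (intro ex_in_conv[THEN iffD1] exI[of _ \<zero>]) simp
      qed (use Ic Pc v(1) in \<open>auto simp: smult_l_minus smult_r_minus smult_l_distr smult_r_distr neg_zero\<close>)
      fix a r assume a: "a \<in> {a \<in> I. \<forall>b\<in>Pw n. b \<odot>\<^bsub>M\<^esub> (a \<odot>\<^bsub>M\<^esub> v) = \<zero>\<^bsub>M\<^esub>}" and r: "r \<in> carrier R"
      have "b \<odot>\<^bsub>M\<^esub> ((r \<otimes> a) \<odot>\<^bsub>M\<^esub> v) = \<zero>\<^bsub>M\<^esub>" if "b \<in> Pw n" for b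
        using that a r Ic Pc[OF that] v(1) by (simp add: smult_assoc1 smult_comm[of b r])
      then show "r \<otimes> a \<in> {a \<in> I. \<forall>b\<in>Pw n. b \<odot>\<^bsub>M\<^esub> (a \<odot>\<^bsub>M\<^esub> v) = \<zero>\<^bsub>M\<^esub>}"
        using a r I.I_l_closed by auto
      then show "a \<otimes> r \<in> {a \<in> I. \<forall>b\<in>Pw n. b \<odot>\<^bsub>M\<^esub> (a \<odot>\<^bsub>M\<^esub> v) = \<zero>\<^bsub>M\<^esub>}"
        using a r Ic R.m_comm[of a r] by auto
    qed
    define K where "K n = {a \<in> I. \<forall>b\<in>Pw n. b \<odot>\<^bsub>M\<^esub> (a \<odot>\<^bsub>M\<^esub> v) = \<zero>\<^bsub>M\<^esub>}" for n
    have "ideal (K n) R" for n unfolding K_def by (rule cX)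
    moreover have K_mono: "K n \<subseteq> K m" if "n \<le> m" for n m unfolding K_def using kills_mono that by blast
    ultimately obtain N where N: "\<forall>n\<ge>N. K n = K N" using ideal_sequence_stabilizes[of K] by (meson lessI less_imp_le)
    have IK: "a \<in> K N" if a: "a \<in> I" for a
    proof -
      obtain n where "a \<in> K n" using v(2)[OF a] a by (auto simp: X_def K_def)
      then have "a \<in> K (max n N)" using K_mono[of n "max n N"] by auto
      then show ?thesis using N by (metis max.cobounded2)
    qed
    have "c \<odot>\<^bsub>M\<^esub> v = \<zero>\<^bsub>M\<^esub>" if "c \<in> Pw N \<cdot> I" for c
      using that
    proof induction
      case (prod b a)
      then show ?case using IK[of a] Pc Ic v(1) by (simp add: K_def smult_assoc1)
    next
      case (sum s t)
      then have "s \<in> carrier R" "t \<in> carrier R" using R.ideal_prod_in_carrier[OF Pw_ideal I] by auto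
      then show ?case using sum v(1) by (simp add: smult_l_distr)
    qed
    then have "\<forall>c\<in>Pw (Suc N). c \<odot>\<^bsub>M\<^esub> v = \<zero>\<^bsub>M\<^esub>" by (simp add: Pw_Suc)
    then show ?thesis using v(1) unfolding X_def by blast
  qed
  have "saturation R I M {\<zero>\<^bsub>M\<^esub>} \<subseteq> X"
  proof -
    have "I \<subseteq> carrier R" using Ic by blast
    have T: "submodule (saturation R I M {\<zero>\<^bsub>M\<^esub>}) R M" by (rule saturation_smod[OF zero_smod \<open>I \<subseteq> carrier R\<close>])
    have "Ass_subq R M (saturation R I M {\<zero>\<^bsub>M\<^esub>}) X = {}"
    proof (rule ccontr)
      assume "\<not> ?thesis"
      then obtain P where P: "P \<in> Ass_subq R M (saturation R I M {\<zero>\<^bsub>M\<^esub>}) X" by blast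
      then obtain v where v: "v \<in> saturation R I M {\<zero>\<^bsub>M\<^esub>}" "P = conductor R M X v" by (auto simp: Ass_subq_def)
      interpret P: primeideal P R using P by (simp add: Ass_subq_def Spec_def)
      have vc: "v \<in> carrier M" using v smodD(2)[OF T] by blast
      have "a \<odot>\<^bsub>M\<^esub> v \<in> X" if a: "a \<in> I" for a
      proof -
        obtain n :: nat where "(a [^] n) \<odot>\<^bsub>M\<^esub> v \<in> {\<zero>\<^bsub>M\<^esub>}" by (rule saturationE[OF v(1) a])
        then have "a [^] n \<in> P" unfolding v(2) conductor_def using Ic[OF a] smodD(1)[OF X_smod] by simp
        then have "a \<in> P" by (rule P.nat_pow_mem[OF Ic[OF a]])
        then show ?thesis unfolding v(2) by (simp add: conductor_def)
      qed
      then have "v \<in> X" by (rule closed[OF vc])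
      then have "\<one> \<in> P" unfolding v(2) using vc by (simp add: conductor_def)
      then show False using P.one_notin by blast
    qed
    then show ?thesis using zero_divisor_in_Ass_subq[OF T X_smod, of _ \<zero>] smodD(1)[OF X_smod] smodD(2)[OF T]
      by (metis R.zero_closed emptyE smult_l_null subsetI)
  qed
  moreover have "X \<subseteq> saturation R I M {\<zero>\<^bsub>M\<^esub>}"
  proof -
    have "a [^] n \<in> Pw n" if "a \<in> I" for a n
    proof (induction n)
      case 0
      then show ?case by (simp add: Pw_0)
    next
      case (Suc n)
      then show ?case using that by (simp add: Pw_Suc ideal_prod.prod)
    qed
    then show ?thesis by (auto simp: X_def saturation_def)
  qed
  ultimately show ?thesis by (auto simp: torsion_def X_def Pw_def)
qed

lemma no_chain_of_module_dim:
  assumes "module_dim R N = ereal (real d)"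
  shows "\<not> has_chain (Supp R N) (Suc d)"
proof
  assume "has_chain (Supp R N) (Suc d)"
  then have "ereal (real (Suc d)) \<le> module_dim R N"
    unfolding module_dim_def has_chain_def by (intro Sup_upper) blast
  then show False using assms by simp
qed

lemma injective_resolution_complex:
  assumes "injective_resolution R N E \<delta> \<epsilon>"
  shows "injective_complex R E \<delta>"
  unfolding injective_complex_def
proof (intro allI conjI ballI)
  note res = assms[unfolded injective_resolution_def]
  fix i
  show "module R (E i)" using res by (simp add: injective_module_def)
  show "baer_injective R (E i) (carrier (E i))" by (rule injective_module_baer_injective) (use res in simp)
  show "\<delta> i \<in> mod_hom R (E i) (E (Suc i))" using res by simp
  fix e assume "e \<in> carrier (E i)"
  then have "\<delta> i e \<in> mod_ker (E (Suc i)) (E (Suc (Suc i))) (\<delta> (Suc i))" using res by simp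
  then show "\<delta> (Suc i) (\<delta> i e) = \<zero>\<^bsub>E (Suc (Suc i))\<^esub>" by (simp add: mod_ker_def)
qed

locale wl_resolution = torsion_complex R I E \<delta> for R (structure) and I and E :: "nat \<Rightarrow> ('a, 'e) module" and \<delta> +
  fixes N :: "('a, 'm, 'd) module_scheme" and \<epsilon> :: "'m \<Rightarrow> 'e"
  assumes res: "injective_resolution R N E \<delta> \<epsilon>" and wl: "weakly_Laskerian R N"
begin

lemma modN: "module R N" using wl by (simp add: weakly_Laskerian_def)

lemma hom_eps: "\<epsilon> \<in> mod_hom R N (E 0)"
  and ker_0: "\<And>e. e \<in> carrier (E 0) \<Longrightarrow> \<delta> 0 e = \<zero>\<^bsub>E 1\<^esub> \<longleftrightarrow> e \<in> \<epsilon> ` carrier N"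
  using res by (auto simp: injective_resolution_def mod_ker_def)

lemma ker_Suc:
  assumes "e \<in> carrier (E (Suc i))"
  shows "\<delta> (Suc i) e = \<zero>\<^bsub>E (Suc (Suc i))\<^esub> \<longleftrightarrow> e \<in> \<delta> i ` carrier (E i)"
proof -
  have "mod_ker (E (Suc i)) (E (Suc (Suc i))) (\<delta> (Suc i)) = \<delta> i ` carrier (E i)"
    using res by (simp add: injective_resolution_def)
  then show ?thesis using assms unfolding mod_ker_def by blast
qed

lemmas eps = mod_homD[OF modN modE hom_eps]

lemma d_eps: "n \<in> carrier N \<Longrightarrow> \<delta> 0 (\<epsilon> n) = \<zero>\<^bsub>E (Suc 0)\<^esub>"
  using ker_0 eps(1) by auto

text \<open>
  \<open>U/T 0\<close> is \<open>N\<close> modulo its torsion.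
\<close>

definition "U = \<epsilon> ` carrier N <+>\<^bsub>E 0\<^esub> T 0"

lemma in_U: "u \<in> U \<longleftrightarrow> (\<exists>n\<in>carrier N. \<exists>t\<in>T 0. u = \<epsilon> n \<oplus>\<^bsub>E 0\<^esub> t)"
  by (auto simp: U_def module.in_set_add[OF modE])

lemma U: "submodule U R (E 0)" "\<epsilon> ` carrier N \<subseteq> U" "T 0 \<subseteq> U"
proof -
  have "submodule (\<epsilon> ` carrier N) R (E 0)"
    by (rule image_submodule[OF modN modE hom_eps module.carrier_is_submodule[OF modN]])
  then show "submodule U R (E 0)" "\<epsilon> ` carrier N \<subseteq> U" "T 0 \<subseteq> U"
    unfolding U_def using module.set_add_submodule[OF modE _ T_smod] by blast+
qed

definition "pull_N V = {n \<in> carrier N. \<epsilon> n \<in> V}"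

lemma pull_N:
  assumes V: "submodule V R (E 0)" "T 0 \<subseteq> V"
  shows "submodule (pull_N V) R N"
    "Ass_subq R (E 0) U V \<subseteq> Ass_subq R N (carrier N) (pull_N V)"
    "Supp_subq R (E 0) U V \<subseteq> Supp_subq R N (carrier N) (pull_N V)"
proof -
  interpret M: module R "E 0" by (rule modE)
  interpret N: module R N by (rule modN)
  note VD = M.smodD[OF V(1)]
  show "submodule (pull_N V) R N"
    unfolding pull_N_def by (rule preimage_submodule[OF modN modE hom_eps V(1)])
  have rep: "\<exists>n\<in>carrier N. \<forall>a\<in>carrier R. a \<odot>\<^bsub>E 0\<^esub> u \<in> V \<longleftrightarrow> a \<odot>\<^bsub>N\<^esub> n \<in> pull_N V" if u: "u \<in> U" for u
  proof -
    obtain n t where nt: "n \<in> carrier N" "t \<in> T 0" "u = \<epsilon> n \<oplus>\<^bsub>E 0\<^esub> t" using u in_U by blast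
    have "a \<odot>\<^bsub>E 0\<^esub> u \<in> V \<longleftrightarrow> a \<odot>\<^bsub>N\<^esub> n \<in> pull_N V" if a: "a \<in> carrier R" for a
    proof -
      have eq: "a \<odot>\<^bsub>E 0\<^esub> u = \<epsilon> (a \<odot>\<^bsub>N\<^esub> n) \<oplus>\<^bsub>E 0\<^esub> (a \<odot>\<^bsub>E 0\<^esub> t)"
        using nt a eps(1,3) TD(2) by (simp add: M.smult_r_distr)
      have at: "a \<odot>\<^bsub>E 0\<^esub> t \<in> V" using VD(6) V(2) nt(2) a by blast
      have an: "a \<odot>\<^bsub>N\<^esub> n \<in> carrier N" using a nt by simp
      show ?thesis unfolding eq pull_N_def
        using an at VD(3)[OF _ at] M.smod_cancel[OF V(1) at eps(1)[OF an]] by blast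
    qed
    then show ?thesis using nt(1) by blast
  qed
  show "Ass_subq R (E 0) U V \<subseteq> Ass_subq R N (carrier N) (pull_N V)"
    "Supp_subq R (E 0) U V \<subseteq> Supp_subq R N (carrier N) (pull_N V)"
    using Ass_Supp_subq_transfer[OF rep] by simp_all
qed

lemma finite_Ass_subq_N:
  assumes "submodule V R N" shows "finite (Ass_subq R N (carrier N) V)"
  using wl assms Ass_quot_module[OF modN assms] by (metis weakly_Laskerian_def)

lemma saturation_of_kernel:
  assumes e: "e \<in> Z i" and K: "\<And>z. z \<in> carrier (E i) \<Longrightarrow> \<delta> i z = \<zero>\<^bsub>E (Suc i)\<^esub> \<Longrightarrow> z \<in> K"
  shows "e \<in> saturation R I (E i) K"
proof -
  interpret M: module R "E i" by (rule modE)
  have ec: "e \<in> carrier (E i)" and de: "\<delta> i e \<in> T (Suc i)" using e by (simp_all add: Z_mod_tor_def)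
  have "\<exists>n::nat. (a [^] n) \<odot>\<^bsub>E i\<^esub> e \<in> K" if a: "a \<in> I" for a
  proof -
    have ac: "a \<in> carrier R" using a I by blast
    obtain n :: nat where "(a [^] n) \<odot>\<^bsub>E (Suc i)\<^esub> \<delta> i e \<in> {\<zero>\<^bsub>E (Suc i)\<^esub>}"
      by (rule saturationE[OF de a])
    then have "\<delta> i ((a [^] n) \<odot>\<^bsub>E i\<^esub> e) = \<zero>\<^bsub>E (Suc i)\<^esub>" using d(3) ac ec by simp
    then show ?thesis using K ac ec by (metis M.smult_closed nat_pow_closed)
  qed
  then show ?thesis using ec by (simp add: saturation_def)
qed

lemma resolution_wl_complex: "wl_complex R I E \<delta> 0 U"
proof (intro wl_complex.intro wl_complex_axioms.intro torsion_complex_axioms U(1))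
  interpret M: module R "E 0" by (rule modE)
  interpret M1: module R "E (Suc 0)" by (rule modE)
  show "B 0 \<subseteq> U" unfolding B_0 by (rule U(3))
  show "U \<subseteq> Z 0"
  proof
    fix u assume "u \<in> U"
    then obtain n t where nt: "n \<in> carrier N" "t \<in> T 0" "u = \<epsilon> n \<oplus>\<^bsub>E 0\<^esub> t" using in_U by blast
    then show "u \<in> Z 0" using d_eps d(2) d_T eps(1) TD(2) by (simp add: Z_mod_tor_def)
  qed
  show "Z 0 \<subseteq> saturation R I (E 0) U"
    using saturation_of_kernel[of _ 0 U] ker_0 U(2) by auto
  show "Z j \<subseteq> saturation R I (E j) (B j)" if j: "j \<noteq> 0" for j
  proof -
    obtain i where i: "j = Suc i" using j by (cases j) auto
    have "z \<in> B (Suc i)" if "z \<in> carrier (E (Suc i))" "\<delta> (Suc i) z = \<zero>\<^bsub>E (Suc (Suc i))\<^esub>" for z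
      using ker_Suc that coboundaries_B[of "Suc i"] by (auto simp: coboundaries_def)
    then show ?thesis using saturation_of_kernel[of _ j "B j"] i by blast
  qed
  show "finite (Ass_subq R (E 0) U V)" if "submodule V R (E 0)" "B 0 \<subseteq> V" for V
    using pull_N(1,2)[of V] that finite_Ass_subq_N finite_subset unfolding B_0 by blast
qed

text \<open>
  The cocycles and coboundaries of the complex of torsion parts, whose cohomology is local cohomology.
\<close>

definition "torsion_cocycles i = {z \<in> T i. \<delta> i z = \<zero>\<^bsub>E (Suc i)\<^esub>}"
definition "torsion_coboundaries i = (case i of 0 \<Rightarrow> {\<zero>\<^bsub>E 0\<^esub>} | Suc j \<Rightarrow> \<delta> j ` T j)"

lemma torsion_cocycles_coboundaries: "submodule (torsion_cocycles i) R (E i)" "submodule (torsion_coboundaries i) R (E i)" "torsion_coboundaries i \<subseteq> torsion_cocycles i"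
proof -
  interpret M: module R "E i" by (rule modE)
  interpret N: module R "E (Suc i)" by (rule modE)
  show "submodule (torsion_cocycles i) R (E i)"
    by (rule M.smoduleI) (use TD d in \<open>auto simp: torsion_cocycles_def\<close>)
  show "submodule (torsion_coboundaries i) R (E i)"
  proof (cases i)
    case 0
    then show ?thesis using M.zero_smod by (simp add: torsion_coboundaries_def)
  next
    case (Suc j)
    then show ?thesis using image_submodule[OF modE modE homE T_smod] by (simp add: torsion_coboundaries_def)
  qed
  show "torsion_coboundaries i \<subseteq> torsion_cocycles i"
  proof (cases i)
    case 0
    then show ?thesis using TD(1) d(4) by (simp add: torsion_coboundaries_def torsion_cocycles_def)
  next
    case (Suc j)
    then show ?thesis using d_T dd TD(2) by (auto simp: torsion_coboundaries_def torsion_cocycles_def)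
  qed
qed

lemma local_cohomology_eq: "local_cohomology R I E \<delta> i = quot_module ((E i)\<lparr>carrier := torsion_cocycles i\<rparr>) (torsion_coboundaries i)"
proof -
  have tors: "torsion R I (E j) = (E j)\<lparr>carrier := T j\<rparr>" for j
    using noetherian_module.torsion_carrier[OF nmodE I_ideal, of j] by (simp add: torsion_def)
  show ?thesis
    unfolding local_cohomology_def cohomology_def tors
    by (auto simp: mod_ker_def coboundaries_def torsion_cocycles_def torsion_coboundaries_def cong: nat.case_cong)
qed

lemmas local_cohomology = subquotient[OF modE torsion_cocycles_coboundaries, folded local_cohomology_eq]

text \<open>
  In degree \<open>n = j + 1\<close> every torsion cocycle is \<open>\<delta> e\<close> with \<open>e \<in> Z j\<close>, and elements of \<open>B j\<close> (of \<open>U\<close>, if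
  \<open>j = 0\<close>) are mapped to coboundaries of torsion elements, so the result follows from the induction. For
  \<open>n = 0\<close> local cohomology is a submodule of \<open>N\<close>, whose support consists of associated primes.
\<close>

lemma finite_Supp_local_cohomology:
  assumes dim: "\<not> has_chain (Supp R N) (Suc n)"
  shows "finite (Supp R (local_cohomology R I E \<delta> n))"
proof -
  interpret NN: noetherian_module R N
    using modN noetherian_ring_axioms by (simp add: noetherian_module_def)
  have SN: "Supp R N = Supp_subq R N (carrier N) {\<zero>\<^bsub>N\<^esub>}" by (rule Supp_eq_Supp_subq[OF modN])
  show ?thesis
  proof (cases n)
    case 0
    have "finite (Supp R N)"
      unfolding SN by (rule NN.finite_Supp_subq_dim0[OF NN.carrier_is_submodule NN.zero_smod finite_Ass_subq_N[OF NN.zero_smod]])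
        (use dim 0 SN in simp)
    moreover have "Supp_subq R (E 0) (torsion_cocycles 0) (torsion_coboundaries 0) \<subseteq> Supp_subq R N (carrier N) {\<zero>\<^bsub>N\<^esub>}"
    proof
      fix P assume P: "P \<in> Supp_subq R (E 0) (torsion_cocycles 0) (torsion_coboundaries 0)"
      then obtain z where z: "z \<in> torsion_cocycles 0" "\<forall>s\<in>carrier R - P. s \<odot>\<^bsub>E 0\<^esub> z \<notin> torsion_coboundaries 0" by (auto simp: Supp_subq_def)
      obtain y where y: "y \<in> carrier N" "z = \<epsilon> y" using z(1) ker_0 TD(2) by (auto simp: torsion_cocycles_def)
      have "s \<odot>\<^bsub>N\<^esub> y \<noteq> \<zero>\<^bsub>N\<^esub>" if "s \<in> carrier R - P" for s
        using z(2) that y eps(3)[of s y] eps(4) by (auto simp: torsion_coboundaries_def)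
      moreover have "P \<in> Spec R" using P by (simp add: Supp_subq_def)
      ultimately show "P \<in> Supp_subq R N (carrier N) {\<zero>\<^bsub>N\<^esub>}" using y(1) unfolding Supp_subq_def by blast
    qed
    ultimately show ?thesis using local_cohomology(2) 0 SN finite_subset by metis
  next
    case (Suc j)
    interpret W: wl_complex R I E \<delta> 0 U by (rule resolution_wl_complex)
    have "Supp_subq R (E 0) U (B 0) \<subseteq> Supp_subq R N (carrier N) (pull_N (B 0))"
      by (rule pull_N(3)[OF B_smod]) (simp add: B_0)
    also have "\<dots> \<subseteq> Supp R N"
    proof -
      have "\<zero>\<^bsub>N\<^esub> \<in> pull_N (B 0)" using NN.smodD(1)[OF pull_N(1)[OF B_smod]] B_0 by simp
      then show ?thesis unfolding SN by (intro Supp_subq_antimono) simp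
    qed
    finally have "\<not> has_chain (Supp_subq R (E 0) U (B 0)) (Suc n)" using dim has_chain_mono by blast
    then have van: "vanishes_from R I E \<delta> 0 U (Suc n)"
      using vanishing W.wl_complex_axioms unfolding vanishing_for_type_def by blast
    define U' where "U' = (B(0 := U)) j"
    have fin: "finite (Supp_subq R (E j) (Z j) U')"
      using van Suc unfolding vanishes_from_def U'_def by simp
    have dU': "\<delta> j u \<in> \<delta> j ` T j" if u: "u \<in> U'" for u
    proof (cases j)
      case 0
      interpret M: module R "E (Suc 0)" by (rule modE)
      obtain m t where mt: "m \<in> carrier N" "t \<in> T 0" "u = \<epsilon> m \<oplus>\<^bsub>E 0\<^esub> t" using u in_U 0 by (auto simp: U'_def)
      then have "\<delta> 0 u = \<delta> 0 t" using d_eps d(1,2) eps(1) TD(2) by simp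
      then show ?thesis using mt 0 by auto
    next
      case (Suc i)
      interpret M: module R "E (Suc (Suc i))" by (rule modE)
      obtain g t where gt: "g \<in> carrier (E i)" "t \<in> T (Suc i)" "u = \<delta> i g \<oplus>\<^bsub>E (Suc i)\<^esub> t"
        using u in_B_Suc Suc by (auto simp: U'_def)
      then have "\<delta> (Suc i) u = \<delta> (Suc i) t" using dd d(1,2) TD(2) by simp
      then show ?thesis using gt Suc by auto
    qed
    have "Supp_subq R (E n) (torsion_cocycles n) (torsion_coboundaries n) \<subseteq> Supp_subq R (E j) (Z j) U'"
    proof
      fix P assume P: "P \<in> Supp_subq R (E n) (torsion_cocycles n) (torsion_coboundaries n)"
      then obtain z where z: "z \<in> torsion_cocycles n" "\<forall>s\<in>carrier R - P. s \<odot>\<^bsub>E n\<^esub> z \<notin> torsion_coboundaries n" by (auto simp: Supp_subq_def)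
      obtain e where e: "e \<in> carrier (E j)" "z = \<delta> j e" using z(1) ker_Suc TD(2) Suc by (auto simp: torsion_cocycles_def)
      have "e \<in> Z j" using e z(1) Suc by (simp add: Z_mod_tor_def torsion_cocycles_def)
      moreover have "s \<odot>\<^bsub>E j\<^esub> e \<notin> U'" if s: "s \<in> carrier R - P" for s
        using z(2) s dU'[of "s \<odot>\<^bsub>E j\<^esub> e"] d(3)[of s e j] e Suc by (auto simp: torsion_coboundaries_def)
      moreover have "P \<in> Spec R" using P by (simp add: Supp_subq_def)
      ultimately show "P \<in> Supp_subq R (E j) (Z j) U'" unfolding Supp_subq_def by blast
    qed
    then show ?thesis using local_cohomology(2) fin finite_subset by metis
  qed
qed

lemma Supp_local_cohomology_V: "Supp R (local_cohomology R I E \<delta> i) \<subseteq> V_set R I"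
proof
  interpret M: module R "E i" by (rule modE)
  fix P assume "P \<in> Supp R (local_cohomology R I E \<delta> i)"
  then have P: "P \<in> Supp_subq R (E i) (torsion_cocycles i) (torsion_coboundaries i)" using local_cohomology(2) by simp
  interpret P: primeideal P R using P by (simp add: Supp_subq_def Spec_def)
  obtain z where z: "z \<in> torsion_cocycles i" "\<forall>s\<in>carrier R - P. s \<odot>\<^bsub>E i\<^esub> z \<notin> torsion_coboundaries i" using P by (auto simp: Supp_subq_def)
  have "a \<in> P" if a: "a \<in> I" for a
  proof -
    have ac: "a \<in> carrier R" using a I by blast
    have "z \<in> T i" using z(1) by (simp add: torsion_cocycles_def)
    then obtain n :: nat where "(a [^] n) \<odot>\<^bsub>E i\<^esub> z \<in> {\<zero>\<^bsub>E i\<^esub>}"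
      by (rule saturationE[OF _ a])
    then have "(a [^] n) \<odot>\<^bsub>E i\<^esub> z \<in> torsion_coboundaries i" using M.smodD(1)[OF torsion_cocycles_coboundaries(2)] by simp
    then have "a [^] n \<in> P" using z(2) ac by blast
    then show ?thesis by (rule P.nat_pow_mem[OF ac])
  qed
  then show "P \<in> V_set R I" using P by (auto simp: V_set_def Supp_subq_def)
qed

end

section \<open>Hom modules\<close>

lemma Hom_module_simps:
  "f \<in> carrier (Hom_module R M N) \<longleftrightarrow> f \<in> mod_hom R M N \<and> f \<in> extensional (carrier M)"
  "\<zero>\<^bsub>Hom_module R M N\<^esub> = (\<lambda>x\<in>carrier M. \<zero>\<^bsub>N\<^esub>)"
  "f \<oplus>\<^bsub>Hom_module R M N\<^esub> g = (\<lambda>x\<in>carrier M. f x \<oplus>\<^bsub>N\<^esub> g x)"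
  "a \<odot>\<^bsub>Hom_module R M N\<^esub> f = (\<lambda>x\<in>carrier M. a \<odot>\<^bsub>N\<^esub> f x)"
  by (auto simp: Hom_module_def)

lemma Hom_module_eqI:
  assumes "f \<in> extensional (carrier M)" "g \<in> extensional (carrier M)" "\<And>x. x \<in> carrier M \<Longrightarrow> f x = g x"
  shows "f = g"
  using assms by (rule extensionalityI)

lemma mod_hom_restrict:
  assumes M: "module R M" and f: "f \<in> mod_hom R M N"
  shows "restrict f (carrier M) \<in> mod_hom R M N"
proof -
  interpret M: module R M by fact
  show ?thesis using f by (auto simp: mod_hom_def)
qed

lemma mod_hom_add:
  assumes M: "module R M" and N: "module R N" and f: "f \<in> mod_hom R M N" and g: "g \<in> mod_hom R M N"
  shows "(\<lambda>x. f x \<oplus>\<^bsub>N\<^esub> g x) \<in> mod_hom R M N"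
proof -
  interpret N: module R N by fact
  note f = mod_homD[OF M N f] and g = mod_homD[OF M N g]
  show ?thesis using f(1,2,3) g(1,2,3) by (auto simp: mod_hom_def N.add_add_swap N.smult_r_distr)
qed

lemma mod_hom_smult:
  assumes M: "module R M" and N: "module R N" and f: "f \<in> mod_hom R M N" and a: "a \<in> carrier R"
  shows "(\<lambda>x. a \<odot>\<^bsub>N\<^esub> f x) \<in> mod_hom R M N"
proof -
  interpret N: module R N by fact
  note f = mod_homD[OF M N f]
  show ?thesis using f(1,2,3) a by (auto simp: mod_hom_def N.smult_r_distr N.smult_comm[of a])
qed

lemma mod_hom_diff:
  assumes M: "module R M" and N: "module R N" and f: "f \<in> mod_hom R M N" and g: "g \<in> mod_hom R M N"
  shows "(\<lambda>x. f x \<ominus>\<^bsub>N\<^esub> g x) \<in> mod_hom R M N"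
proof -
  interpret N: module R N by fact
  note f = mod_homD[OF M N f] and g = mod_homD[OF M N g]
  show ?thesis using f(1,2,3) g(1,2,3)
    by (auto simp: mod_hom_def N.diff_add_diff a_minus_def[of N "a \<odot>\<^bsub>N\<^esub> x" for a x] N.smult_r_distr N.smult_r_minus)
      (simp add: a_minus_def N.smult_r_distr N.smult_r_minus)
qed

lemma mod_hom_comp:
  assumes "f \<in> mod_hom R M N" "g \<in> mod_hom R L M"
  shows "(\<lambda>x. f (g x)) \<in> mod_hom R L N"
  using assms by (auto simp: mod_hom_def Pi_iff)

lemma mod_hom_id: "(\<lambda>x. x) \<in> mod_hom R M M"
  by (auto simp: mod_hom_def)

lemma Hom_module_module:
  assumes M: "module R M" and N: "module R N"
  shows "module R (Hom_module R M N)" (is "module R ?H")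
proof -
  interpret M: module R M by fact
  interpret N: module R N by fact
  note s = Hom_module_simps[where R = R and M = M and N = N]
  have c: "f x \<in> carrier N" if "f \<in> mod_hom R M N" "x \<in> carrier M" for f x using that by (auto simp: mod_hom_def)
  show ?thesis
  proof (rule moduleI[OF M.R.is_cring])
    show "abelian_group ?H"
    proof (rule abelian_groupI)
      show "\<zero>\<^bsub>?H\<^esub> \<in> carrier ?H" by (auto simp: s mod_hom_def)
      show "f \<oplus>\<^bsub>?H\<^esub> g \<in> carrier ?H" if "f \<in> carrier ?H" "g \<in> carrier ?H" for f g
        using that mod_hom_restrict[OF M mod_hom_add[OF M N]] by (simp add: s)
      show "\<exists>g\<in>carrier ?H. g \<oplus>\<^bsub>?H\<^esub> f = \<zero>\<^bsub>?H\<^esub>" if f: "f \<in> carrier ?H" for f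
      proof (rule bexI)
        show "(\<lambda>x\<in>carrier M. (\<ominus>\<^bsub>R\<^esub> \<one>\<^bsub>R\<^esub>) \<odot>\<^bsub>N\<^esub> f x) \<in> carrier ?H"
          using f mod_hom_restrict[OF M mod_hom_smult[OF M N]] by (simp add: s)
        show "(\<lambda>x\<in>carrier M. (\<ominus>\<^bsub>R\<^esub> \<one>\<^bsub>R\<^esub>) \<odot>\<^bsub>N\<^esub> f x) \<oplus>\<^bsub>?H\<^esub> f = \<zero>\<^bsub>?H\<^esub>"
          using f c by (auto simp: s N.smult_l_minus N.M.l_neg intro!: restrict_ext)
      qed
      show "\<zero>\<^bsub>?H\<^esub> \<oplus>\<^bsub>?H\<^esub> f = f" if "f \<in> carrier ?H" for f
        by (rule Hom_module_eqI[of _ M]) (use that c in \<open>auto simp: s\<close>)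
    qed (use c in \<open>auto simp: s N.M.a_ac intro!: restrict_ext\<close>)
    show "a \<odot>\<^bsub>?H\<^esub> f \<in> carrier ?H" if "a \<in> carrier R" "f \<in> carrier ?H" for a f
      using that mod_hom_restrict[OF M mod_hom_smult[OF M N]] by (simp add: s)
    show "\<one>\<^bsub>R\<^esub> \<odot>\<^bsub>?H\<^esub> f = f" if "f \<in> carrier ?H" for f
      by (rule Hom_module_eqI[of _ M]) (use that c in \<open>auto simp: s\<close>)
  qed (use c in \<open>auto simp: s N.smult_l_distr N.smult_r_distr N.smult_assoc1 intro!: restrict_ext\<close>)
qed

section \<open>Lifting homomorphisms from free modules\<close>

text \<open>
  Projectivity of free modules; the submodule \<open>S\<close> controls the image of the lift.
\<close>

lemma free_module_lift:
  assumes F: "free_module R F" and M: "module R M" and N: "module R N"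
    and f: "f \<in> mod_hom R F N" and p: "p \<in> mod_hom R M N"
    and S: "submodule S R M" and img: "\<And>x. x \<in> carrier F \<Longrightarrow> f x \<in> p ` S"
  obtains g where "g \<in> mod_hom R F M" "\<And>x. x \<in> carrier F \<Longrightarrow> g x \<in> S" "\<And>x. x \<in> carrier F \<Longrightarrow> p (g x) = f x"
proof -
  have Fm: "module R F" using F by (simp add: free_module_def)
  interpret F: module R F by (rule Fm)
  interpret M: module R M by fact
  interpret N: module R N by fact
  note SD = M.smodD[OF S] and fD = mod_homD[OF Fm N f] and pD = mod_homD[OF M N p]
  obtain B where B: "B \<subseteq> carrier F" and uniq: "\<forall>x\<in>carrier F. \<exists>!c. (\<forall>b\<in>B. c b \<in> carrier R) \<and> (\<forall>b. b \<notin> B \<longrightarrow> c b = \<zero>\<^bsub>R\<^esub>) \<and>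
      finite {b. c b \<noteq> \<zero>\<^bsub>R\<^esub>} \<and> x = (\<Oplus>\<^bsub>F\<^esub>b\<in>{b. c b \<noteq> \<zero>\<^bsub>R\<^esub>}. c b \<odot>\<^bsub>F\<^esub> b)"
    using F unfolding free_module_def by blast
  define coef where "coef c \<longleftrightarrow> (\<forall>b\<in>B. c b \<in> carrier R) \<and> (\<forall>b. b \<notin> B \<longrightarrow> c b = \<zero>\<^bsub>R\<^esub>) \<and> finite {b. c b \<noteq> \<zero>\<^bsub>R\<^esub>}" for c
  define comb where "comb c = (\<Oplus>\<^bsub>F\<^esub>b\<in>{b. c b \<noteq> \<zero>\<^bsub>R\<^esub>}. c b \<odot>\<^bsub>F\<^esub> b)" for c
  have uniq': "\<exists>!c. coef c \<and> x = comb c" if "x \<in> carrier F" for x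
    using bspec[OF uniq that] unfolding coef_def comb_def by (simp add: conj_assoc)
  define k where "k x = (THE c. coef c \<and> x = comb c)" for x
  have k: "coef (k x)" "x = comb (k x)" if "x \<in> carrier F" for x
    using theI'[OF uniq'[OF that]] by (simp_all add: k_def)
  have k_eq: "k x = c" if "coef c" "x = comb c" "x \<in> carrier F" for x c
    using uniq'[OF that(3)] k[OF that(3)] that(1,2) by blast
  have "\<forall>b\<in>B. \<exists>m. m \<in> S \<and> p m = f b"
  proof
    fix b assume "b \<in> B"
    then have "f b \<in> p ` S" using img B by blast
    then show "\<exists>m. m \<in> S \<and> p m = f b" by (metis imageE)
  qed
  from bchoice[OF this] obtain m where "\<forall>b\<in>B. m b \<in> S \<and> p (m b) = f b" by blast
  then have m: "m b \<in> S \<and> p (m b) = f b" if "b \<in> B" for b using that by blast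
  have supp: "{b. c b \<noteq> \<zero>\<^bsub>R\<^esub>} \<subseteq> B" "finite {b. c b \<noteq> \<zero>\<^bsub>R\<^esub>}" "\<And>b. c b \<in> carrier R" if "coef c" for c
    using that by (auto simp: coef_def)
  have sumF: "comb c = (\<Oplus>\<^bsub>F\<^esub>b\<in>A. c b \<odot>\<^bsub>F\<^esub> b)" if "coef c" "finite A" "A \<subseteq> B" "{b. c b \<noteq> \<zero>\<^bsub>R\<^esub>} \<subseteq> A" for c A
    unfolding comb_def
    by (rule F.M.add.finprod_mono_neutral_cong_left) (use that supp[OF that(1)] B in auto)
  define val where "val c = (\<Oplus>\<^bsub>M\<^esub>b\<in>{b. c b \<noteq> \<zero>\<^bsub>R\<^esub>}. c b \<odot>\<^bsub>M\<^esub> m b)" for c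
  have mc: "m b \<in> carrier M" if "b \<in> B" for b using m[OF that] SD(2) by blast
  have sumM: "val c = (\<Oplus>\<^bsub>M\<^esub>b\<in>A. c b \<odot>\<^bsub>M\<^esub> m b)" if "coef c" "finite A" "A \<subseteq> B" "{b. c b \<noteq> \<zero>\<^bsub>R\<^esub>} \<subseteq> A" for c A
    unfolding val_def
    by (rule M.M.add.finprod_mono_neutral_cong_left) (use that supp[OF that(1)] mc in auto)
  define g where "g x = val (k x)" for x
  have sub_sum: "(\<Oplus>\<^bsub>M\<^esub>b\<in>A. c b \<odot>\<^bsub>M\<^esub> m b) \<in> S \<and>
      p (\<Oplus>\<^bsub>M\<^esub>b\<in>A. c b \<odot>\<^bsub>M\<^esub> m b) = f (\<Oplus>\<^bsub>F\<^esub>b\<in>A. c b \<odot>\<^bsub>F\<^esub> b)"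
    if "finite A" "A \<subseteq> B" "\<And>b. c b \<in> carrier R" for A c
    using that(1,2)
  proof (induction A)
    case empty
    then show ?case using SD(1) pD(4) fD(4) by simp
  next
    case (insert a A)
    have mA: "(\<lambda>b. c b \<odot>\<^bsub>M\<^esub> m b) \<in> A \<rightarrow> carrier M" "c a \<odot>\<^bsub>M\<^esub> m a \<in> carrier M"
      "(\<lambda>b. c b \<odot>\<^bsub>F\<^esub> b) \<in> A \<rightarrow> carrier F" "c a \<odot>\<^bsub>F\<^esub> a \<in> carrier F"
      using insert.prems that(3) mc B by auto
    have ma: "m a \<in> S" "p (m a) = f a" "m a \<in> carrier M" "a \<in> carrier F" using m mc insert.prems B by auto
    show ?case
      using insert that(3)[of a] mA ma SD(3,6) SD(2) pD(2,3) fD(2,3) by simp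
  qed
  have gS: "g x \<in> S" and pg: "p (g x) = f x" if x: "x \<in> carrier F" for x
    using sub_sum[of "{b. k x b \<noteq> \<zero>\<^bsub>R\<^esub>}" "k x"] supp[OF k(1)[OF x]] k(2)[OF x]
    by (simp_all add: g_def val_def comb_def)
  have "g \<in> mod_hom R F M"
    unfolding mod_hom_def
  proof (intro CollectI conjI ballI)
    show "g \<in> carrier F \<rightarrow> carrier M" using gS SD(2) by blast
    fix x y assume xy: "x \<in> carrier F" "y \<in> carrier F"
    let ?A = "{b. k x b \<noteq> \<zero>\<^bsub>R\<^esub>} \<union> {b. k y b \<noteq> \<zero>\<^bsub>R\<^esub>}" and ?c = "\<lambda>b. k x b \<oplus>\<^bsub>R\<^esub> k y b"
    note sx = supp[OF k(1)[OF xy(1)]] and sy = supp[OF k(1)[OF xy(2)]]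
    have A: "finite ?A" "?A \<subseteq> B" using sx sy by auto
    have cA: "{b. ?c b \<noteq> \<zero>\<^bsub>R\<^esub>} \<subseteq> ?A" by auto
    have "k x b = \<zero>\<^bsub>R\<^esub>" "k y b = \<zero>\<^bsub>R\<^esub>" if "b \<notin> B" for b using sx(1) sy(1) that by auto
    then have c: "coef ?c" unfolding coef_def
      using sx(3) sy(3) sx(1) sy(1) finite_subset[OF cA A(1)] by auto
    have "x \<oplus>\<^bsub>F\<^esub> y = (\<Oplus>\<^bsub>F\<^esub>b\<in>?A. k x b \<odot>\<^bsub>F\<^esub> b) \<oplus>\<^bsub>F\<^esub> (\<Oplus>\<^bsub>F\<^esub>b\<in>?A. k y b \<odot>\<^bsub>F\<^esub> b)"
      using k(2) xy sumF[OF k(1) A] by auto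
    also have "\<dots> = (\<Oplus>\<^bsub>F\<^esub>b\<in>?A. (k x b \<odot>\<^bsub>F\<^esub> b) \<oplus>\<^bsub>F\<^esub> (k y b \<odot>\<^bsub>F\<^esub> b))"
      by (rule F.M.add.finprod_multf[symmetric]) (use A sx(3) sy(3) B in auto)
    also have "\<dots> = (\<Oplus>\<^bsub>F\<^esub>b\<in>?A. ?c b \<odot>\<^bsub>F\<^esub> b)"
      by (rule F.M.add.finprod_cong') (use A sx(3) sy(3) B in \<open>auto simp: F.smult_l_distr\<close>)
    also have "\<dots> = comb ?c" using sumF[OF c A cA] by simp
    finally have "k (x \<oplus>\<^bsub>F\<^esub> y) = ?c" by (rule k_eq[OF c]) (use xy in simp)
    then have "g (x \<oplus>\<^bsub>F\<^esub> y) = (\<Oplus>\<^bsub>M\<^esub>b\<in>?A. ?c b \<odot>\<^bsub>M\<^esub> m b)" using sumM[OF c A cA] by (simp add: g_def)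
    also have "\<dots> = (\<Oplus>\<^bsub>M\<^esub>b\<in>?A. (k x b \<odot>\<^bsub>M\<^esub> m b) \<oplus>\<^bsub>M\<^esub> (k y b \<odot>\<^bsub>M\<^esub> m b))"
      by (rule M.M.add.finprod_cong') (use A sx(3) sy(3) mc in \<open>auto simp: M.smult_l_distr\<close>)
    also have "\<dots> = (\<Oplus>\<^bsub>M\<^esub>b\<in>?A. k x b \<odot>\<^bsub>M\<^esub> m b) \<oplus>\<^bsub>M\<^esub> (\<Oplus>\<^bsub>M\<^esub>b\<in>?A. k y b \<odot>\<^bsub>M\<^esub> m b)"
      by (rule M.M.add.finprod_multf) (use A sx(3) sy(3) mc in auto)
    also have "\<dots> = g x \<oplus>\<^bsub>M\<^esub> g y"
      using sumM[OF k(1)[OF xy(1)] A] sumM[OF k(1)[OF xy(2)] A] by (auto simp: g_def)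
    finally show "g (x \<oplus>\<^bsub>F\<^esub> y) = g x \<oplus>\<^bsub>M\<^esub> g y" .
  next
    fix a x assume ax: "a \<in> carrier R" "x \<in> carrier F"
    let ?A = "{b. k x b \<noteq> \<zero>\<^bsub>R\<^esub>}" and ?c = "\<lambda>b. a \<otimes>\<^bsub>R\<^esub> k x b"
    note sx = supp[OF k(1)[OF ax(2)]]
    have cA: "{b. ?c b \<noteq> \<zero>\<^bsub>R\<^esub>} \<subseteq> ?A" using ax by auto
    have "k x b = \<zero>\<^bsub>R\<^esub>" if "b \<notin> B" for b using sx(1) that by auto
    then have c: "coef ?c" unfolding coef_def using sx ax finite_subset[OF cA sx(2)] by auto
    have "a \<odot>\<^bsub>F\<^esub> x = a \<odot>\<^bsub>F\<^esub> (\<Oplus>\<^bsub>F\<^esub>b\<in>?A. k x b \<odot>\<^bsub>F\<^esub> b)" using k(2)[OF ax(2)] by (simp add: comb_def)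
    also have "\<dots> = (\<Oplus>\<^bsub>F\<^esub>b\<in>?A. a \<odot>\<^bsub>F\<^esub> (k x b \<odot>\<^bsub>F\<^esub> b))"
      by (rule F.finsum_smult_ldistr) (use sx ax B in auto)
    also have "\<dots> = (\<Oplus>\<^bsub>F\<^esub>b\<in>?A. ?c b \<odot>\<^bsub>F\<^esub> b)"
      by (rule F.M.add.finprod_cong') (use sx ax B in \<open>auto simp: F.smult_assoc1\<close>)
    also have "\<dots> = comb ?c" using sumF[OF c sx(2,1) cA] by simp
    finally have "k (a \<odot>\<^bsub>F\<^esub> x) = ?c" by (rule k_eq[OF c]) (use ax in simp)
    then have "g (a \<odot>\<^bsub>F\<^esub> x) = (\<Oplus>\<^bsub>M\<^esub>b\<in>?A. ?c b \<odot>\<^bsub>M\<^esub> m b)" using sumM[OF c sx(2,1) cA] by (simp add: g_def)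
    also have "\<dots> = (\<Oplus>\<^bsub>M\<^esub>b\<in>?A. a \<odot>\<^bsub>M\<^esub> (k x b \<odot>\<^bsub>M\<^esub> m b))"
      by (rule M.M.add.finprod_cong') (use sx ax mc in \<open>auto simp: M.smult_assoc1\<close>)
    also have "\<dots> = a \<odot>\<^bsub>M\<^esub> (\<Oplus>\<^bsub>M\<^esub>b\<in>?A. k x b \<odot>\<^bsub>M\<^esub> m b)"
      by (rule M.finsum_smult_ldistr[symmetric]) (use sx ax mc in auto)
    finally show "g (a \<odot>\<^bsub>F\<^esub> x) = a \<odot>\<^bsub>M\<^esub> g x" by (simp add: g_def val_def)
  qed
  then show ?thesis using that gS pg by blast
qed

section \<open>Finitely generated submodules\<close>

text \<open>
  Finite generation by adjoining one generator at a time, which suits proofs by induction.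
\<close>

inductive fin_gen :: "('r, 'b) ring_scheme \<Rightarrow> ('r, 'm, 'c) module_scheme \<Rightarrow> 'm set \<Rightarrow> bool"
  for R and M where
    zero: "fin_gen R M {\<zero>\<^bsub>M\<^esub>}"
  | adjoin: "fin_gen R M S \<Longrightarrow> x \<in> carrier M \<Longrightarrow> fin_gen R M {s \<oplus>\<^bsub>M\<^esub> (r \<odot>\<^bsub>M\<^esub> x) | s r. s \<in> S \<and> r \<in> carrier R}"

context module
begin

lemma adjoin_smod:
  assumes S: "submodule S R M" and x: "x \<in> carrier M"
  defines "S' \<equiv> {s \<oplus>\<^bsub>M\<^esub> (r \<odot>\<^bsub>M\<^esub> x) | s r. s \<in> S \<and> r \<in> carrier R}"
  shows "submodule S' R M" "S \<subseteq> S'" "x \<in> S'"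
proof -
  note SD = smodD[OF S]
  have S': "s \<oplus>\<^bsub>M\<^esub> (r \<odot>\<^bsub>M\<^esub> x) \<in> S'" if "s \<in> S" "r \<in> carrier R" for s r using that by (auto simp: S'_def)
  show "S \<subseteq> S'"
  proof
    fix s assume "s \<in> S"
    then show "s \<in> S'" using S'[of s \<zero>] SD(2) x by simp
  qed
  show "x \<in> S'" using S'[OF SD(1) R.one_closed] x by simp
  show "submodule S' R M"
  proof (rule smoduleI)
    show "S' \<subseteq> carrier M" using SD(2) x by (auto simp: S'_def)
    show "\<zero>\<^bsub>M\<^esub> \<in> S'" using \<open>S \<subseteq> S'\<close> SD(1) by blast
    fix u v assume "u \<in> S'" "v \<in> S'"
    then obtain s r t q where *: "s \<in> S" "r \<in> carrier R" "u = s \<oplus>\<^bsub>M\<^esub> (r \<odot>\<^bsub>M\<^esub> x)"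
      "t \<in> S" "q \<in> carrier R" "v = t \<oplus>\<^bsub>M\<^esub> (q \<odot>\<^bsub>M\<^esub> x)" by (auto simp: S'_def)
    then have "u \<oplus>\<^bsub>M\<^esub> v = (s \<oplus>\<^bsub>M\<^esub> t) \<oplus>\<^bsub>M\<^esub> ((r \<oplus> q) \<odot>\<^bsub>M\<^esub> x)"
      using SD(2) x by (simp add: add_add_swap smult_l_distr)
    then show "u \<oplus>\<^bsub>M\<^esub> v \<in> S'" using S' SD(3) * by simp
  next
    fix a u assume a: "a \<in> carrier R" and "u \<in> S'"
    then obtain s r where *: "s \<in> S" "r \<in> carrier R" "u = s \<oplus>\<^bsub>M\<^esub> (r \<odot>\<^bsub>M\<^esub> x)" by (auto simp: S'_def)
    then have "a \<odot>\<^bsub>M\<^esub> u = (a \<odot>\<^bsub>M\<^esub> s) \<oplus>\<^bsub>M\<^esub> ((a \<otimes> r) \<odot>\<^bsub>M\<^esub> x)"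
      using SD(2) x a by (simp add: smult_r_distr smult_assoc1)
    then show "a \<odot>\<^bsub>M\<^esub> u \<in> S'" using S' SD(6) * a by simp
  qed
qed

lemma fin_gen_smod: "fin_gen R M S \<Longrightarrow> submodule S R M"
  by (induction rule: fin_gen.induct) (auto intro: zero_smod adjoin_smod(1))

end

text \<open>
  For \<open>V \<subseteq> S + R x\<close> consider finitely generated \<open>T \<subseteq> V\<close> that contain \<open>V \<inter> S\<close>. If the ideal \<open>J T\<close> of
  coefficients of \<open>x\<close> occurring in \<open>T\<close> is maximal, then \<open>T = V\<close>: adjoining \<open>v \<in> V\<close> does not enlarge the ideal, so
  \<open>v\<close> differs from an element of \<open>T\<close> by an element of \<open>V \<inter> S\<close>.
\<close>

lemma (in noetherian_module) submodule_of_fin_gen: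
  assumes "fin_gen R M S" "submodule V R M" "V \<subseteq> S"
  shows "fin_gen R M V"
  using assms
proof (induction arbitrary: V rule: fin_gen.induct)
  case zero
  then have "V = {\<zero>\<^bsub>M\<^esub>}" using smodD(1) by blast
  then show ?case using fin_gen.zero by simp
next
  case (adjoin S x)
  have S: "submodule S R M" using fin_gen_smod adjoin.hyps by blast
  note SD = smodD[OF S] and VD = smodD[OF adjoin.prems(1)]
  define J where "J T = {r \<in> carrier R. \<exists>s\<in>S. s \<oplus>\<^bsub>M\<^esub> (r \<odot>\<^bsub>M\<^esub> x) \<in> T}" for T
  have Ji: "ideal (J T) R" if T: "submodule T R M" for T
  proof -
    note TD = smodD[OF T] and ST = set_add_submodule[OF S T]
    have "J T = conductor R M (S <+>\<^bsub>M\<^esub> T) x"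
    proof (rule subset_antisym; rule subsetI)
      fix r assume "r \<in> J T"
      then obtain s where rs: "r \<in> carrier R" "s \<in> S" "s \<oplus>\<^bsub>M\<^esub> (r \<odot>\<^bsub>M\<^esub> x) \<in> T" by (auto simp: J_def)
      have "r \<odot>\<^bsub>M\<^esub> x \<in> S <+>\<^bsub>M\<^esub> T"
        by (rule smod_cancel[OF ST(1) subsetD[OF ST(2) rs(2)]]) (use rs ST(3) adjoin.hyps in auto)
      then show "r \<in> conductor R M (S <+>\<^bsub>M\<^esub> T) x" using rs by (simp add: conductor_def)
    next
      fix r assume "r \<in> conductor R M (S <+>\<^bsub>M\<^esub> T) x"
      then obtain s t where st: "r \<in> carrier R" "s \<in> S" "t \<in> T" "r \<odot>\<^bsub>M\<^esub> x = s \<oplus>\<^bsub>M\<^esub> t"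
        by (auto simp: conductor_def in_set_add)
      have "(\<ominus>\<^bsub>M\<^esub> s) \<oplus>\<^bsub>M\<^esub> (r \<odot>\<^bsub>M\<^esub> x) = t" unfolding st(4) using st SD(2) TD(2) by (simp add: M.r_neg1)
      then show "r \<in> J T" using st SD(4) unfolding J_def by blast
    qed
    then show ?thesis using conductor_ideal[OF ST(1)] adjoin.hyps by simp
  qed
  define \<T> where "\<T> = {T. fin_gen R M T \<and> V \<inter> S \<subseteq> T \<and> T \<subseteq> V}"
  have "submodule (V \<inter> S) R M" by (rule smoduleI) (use VD SD in auto)
  then have "fin_gen R M (V \<inter> S)" using adjoin.IH by blast
  then have ne: "J ` \<T> \<noteq> {}" by (auto simp: \<T>_def)
  obtain Q where Q: "Q \<in> J ` \<T>" "\<And>Q'. Q' \<in> J ` \<T> \<Longrightarrow> Q \<subseteq> Q' \<Longrightarrow> Q' = Q"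
    using ne by (rule ideal_family_has_maximal) (auto simp: \<T>_def intro: Ji fin_gen_smod)
  then obtain T where T: "T \<in> \<T>" "Q = J T" by blast
  have Tf: "fin_gen R M T" and TVS: "V \<inter> S \<subseteq> T" "T \<subseteq> V" using T(1) by (auto simp: \<T>_def)
  have Ts: "submodule T R M" using fin_gen_smod Tf by blast
  note TD = smodD[OF Ts]
  have "V \<subseteq> T"
  proof
    fix v assume v: "v \<in> V"
    then obtain s r where sr: "s \<in> S" "r \<in> carrier R" "v = s \<oplus>\<^bsub>M\<^esub> (r \<odot>\<^bsub>M\<^esub> x)" using adjoin.prems(2) by blast
    have vc: "v \<in> carrier M" using v VD(2) by blast
    define T' where "T' = {t \<oplus>\<^bsub>M\<^esub> (q \<odot>\<^bsub>M\<^esub> v) | t q. t \<in> T \<and> q \<in> carrier R}"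
    note T' = adjoin_smod[OF Ts vc, folded T'_def]
    have "fin_gen R M T'" unfolding T'_def by (rule fin_gen.adjoin[OF Tf vc])
    moreover have "T' \<subseteq> V" using TVS(2) VD(3,6) v by (auto simp: T'_def)
    ultimately have "T' \<in> \<T>" using T'(2) TVS(1) by (auto simp: \<T>_def)
    moreover have "J T \<subseteq> J T'" using T'(2) by (auto simp: J_def)
    ultimately have "J T' = J T" using Q(2) T(2) by blast
    moreover have "r \<in> J T'" unfolding J_def using sr T'(3) by blast
    ultimately obtain s' where s': "s' \<in> S" "s' \<oplus>\<^bsub>M\<^esub> (r \<odot>\<^bsub>M\<^esub> x) \<in> T" by (auto simp: J_def)
    have c: "s \<in> carrier M" "s' \<in> carrier M" "r \<odot>\<^bsub>M\<^esub> x \<in> carrier M" using sr s' SD(2) adjoin.hyps by auto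
    have "v \<ominus>\<^bsub>M\<^esub> (s' \<oplus>\<^bsub>M\<^esub> (r \<odot>\<^bsub>M\<^esub> x)) = s \<ominus>\<^bsub>M\<^esub> s'"
      unfolding sr(3) using c by (simp add: diff_add_diff) (simp add: a_minus_def M.r_neg)
    then have "v \<ominus>\<^bsub>M\<^esub> (s' \<oplus>\<^bsub>M\<^esub> (r \<odot>\<^bsub>M\<^esub> x)) \<in> V \<inter> S"
      using VD(5)[OF v subsetD[OF TVS(2) s'(2)]] SD(5)[OF sr(1) s'(1)] by simp
    then have "v \<ominus>\<^bsub>M\<^esub> (s' \<oplus>\<^bsub>M\<^esub> (r \<odot>\<^bsub>M\<^esub> x)) \<in> T" using TVS(1) by blast
    then show "v \<in> T"
      using TD(3)[OF _ s'(2)] add_diff_cancel(2)[OF vc TD(2)[OF s'(2)]] by metis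
  qed
  then have "V = T" using TVS(2) by (rule subset_antisym)
  then show ?case using Tf by simp
qed

lemma fin_gen_preimage:
  assumes M: "module R M" and N: "module R N" and p: "p \<in> mod_hom R M N"
    and "fin_gen R N S" "S \<subseteq> p ` carrier M"
  shows "\<exists>S'. fin_gen R M S' \<and> S \<subseteq> p ` S'"
  using assms(4,5)
proof (induction rule: fin_gen.induct)
  case zero
  then show ?case using mod_homD(4)[OF M N p] fin_gen.zero[of R M] by (metis image_eqI insert_subset empty_subsetI singletonI)
next
  case (adjoin S x)
  interpret M: module R M by fact
  interpret N: module R N by fact
  note pD = mod_homD[OF M N p]
  note ad = N.adjoin_smod[OF N.fin_gen_smod[OF adjoin.hyps(1)] adjoin.hyps(2)]
  obtain S' where S': "fin_gen R M S'" "S \<subseteq> p ` S'" using adjoin ad(2) by blast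
  obtain y where y: "y \<in> carrier M" "x = p y" using ad(3) adjoin.prems by blast
  note SD' = M.smodD[OF M.fin_gen_smod[OF S'(1)]]
  have "{s \<oplus>\<^bsub>N\<^esub> (r \<odot>\<^bsub>N\<^esub> x) | s r. s \<in> S \<and> r \<in> carrier R} \<subseteq> p ` {s \<oplus>\<^bsub>M\<^esub> (r \<odot>\<^bsub>M\<^esub> y) | s r. s \<in> S' \<and> r \<in> carrier R}"
  proof
    fix w assume "w \<in> {s \<oplus>\<^bsub>N\<^esub> (r \<odot>\<^bsub>N\<^esub> x) | s r. s \<in> S \<and> r \<in> carrier R}"
    then obtain s r where sr: "s \<in> S" "r \<in> carrier R" "w = s \<oplus>\<^bsub>N\<^esub> (r \<odot>\<^bsub>N\<^esub> x)" by blast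
    obtain s' where s': "s' \<in> S'" "s = p s'" using S'(2) sr(1) by blast
    have "w = p (s' \<oplus>\<^bsub>M\<^esub> (r \<odot>\<^bsub>M\<^esub> y))" using sr s' y SD'(2) pD(2,3) by simp
    then show "w \<in> p ` {s \<oplus>\<^bsub>M\<^esub> (r \<odot>\<^bsub>M\<^esub> y) | s r. s \<in> S' \<and> r \<in> carrier R}" using s' sr by blast
  qed
  then show ?case using fin_gen.adjoin[OF S'(1) y(1)] by blast
qed

text \<open>
  Finitely many values in \<open>H\<close> can be killed by a common element outside \<open>P\<close>. This fails without finite
  generation, which is why free resolutions of infinite rank need the homotopy below.
\<close>

lemma fin_gen_killed:
  assumes M: "module R M" and H: "module R H" and f: "f \<in> mod_hom R M H" and P: "primeideal P R"
    and "P \<notin> Supp R H" and "fin_gen R M S"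
  shows "\<exists>s\<in>carrier R - P. \<forall>w\<in>S. s \<odot>\<^bsub>H\<^esub> f w = \<zero>\<^bsub>H\<^esub>"
  using assms(6)
proof (induction rule: fin_gen.induct)
  interpret P: primeideal P R by fact
  interpret H: module R H by fact
  interpret M: module R M by fact
  note fD = mod_homD[OF M H f]
  have one: "\<one>\<^bsub>R\<^esub> \<in> carrier R - P" using P.one_notin by blast
  case zero
  then show ?case using one fD(4) by auto
next
  interpret P: primeideal P R by fact
  interpret H: module R H by fact
  interpret M: module R M by fact
  note fD = mod_homD[OF M H f]
  case (adjoin S x)
  then obtain s where s: "s \<in> carrier R - P" "\<forall>w\<in>S. s \<odot>\<^bsub>H\<^esub> f w = \<zero>\<^bsub>H\<^esub>" by blast
  have Sc: "w \<in> carrier M" if "w \<in> S" for w using M.smodD(2)[OF M.fin_gen_smod] adjoin.hyps that by blast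
  have "f x \<in> carrier H" using fD(1) adjoin.hyps by blast
  then obtain t where t: "t \<in> carrier R - P" "t \<odot>\<^bsub>H\<^esub> f x = \<zero>\<^bsub>H\<^esub>"
    using assms(5) P unfolding Supp_eq_Supp_subq[OF H] Supp_subq_def Spec_def by blast
  have st: "s \<otimes>\<^bsub>R\<^esub> t \<in> carrier R - P" using s t P.I_prime by auto
  have "(s \<otimes>\<^bsub>R\<^esub> t) \<odot>\<^bsub>H\<^esub> f (w \<oplus>\<^bsub>M\<^esub> (r \<odot>\<^bsub>M\<^esub> x)) = \<zero>\<^bsub>H\<^esub>" if w: "w \<in> S" "r \<in> carrier R" for w r
  proof -
    have c: "s \<in> carrier R" "t \<in> carrier R" "f w \<in> carrier H" "f x \<in> carrier H" "w \<in> carrier M" "x \<in> carrier M"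
      using s t w Sc fD(1) adjoin.hyps by auto
    have "(s \<otimes>\<^bsub>R\<^esub> t) \<odot>\<^bsub>H\<^esub> f w = t \<odot>\<^bsub>H\<^esub> (s \<odot>\<^bsub>H\<^esub> f w)" using c by (simp add: H.smult_assoc1 H.smult_comm[of s t])
    moreover have "(s \<otimes>\<^bsub>R\<^esub> t) \<odot>\<^bsub>H\<^esub> (r \<odot>\<^bsub>H\<^esub> f x) = r \<odot>\<^bsub>H\<^esub> (s \<odot>\<^bsub>H\<^esub> (t \<odot>\<^bsub>H\<^esub> f x))"
      using c w by (simp add: H.smult_assoc1 H.smult_comm[of _ r])
    ultimately show ?thesis using c w s t fD(2,3) by (simp add: H.smult_r_distr)
  qed
  then show ?case using st by blast
qed

section \<open>Ext from a free resolution\<close>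

locale noetherian_free_resolution = noetherian_ring R + cring R for R (structure) +
  fixes I :: "'a set" and F :: "nat \<Rightarrow> ('a, 'f, 'd) module_scheme" and D :: "nat \<Rightarrow> 'f \<Rightarrow> 'f" and \<eta> :: "'f \<Rightarrow> 'a set"
  assumes I: "ideal I R" and res: "free_resolution R (quot_module (regular_module R) I) F D \<eta>"
begin

abbreviation "Q \<equiv> quot_module (regular_module R) I"

lemma reg: "module R (regular_module R)" and I_smod: "submodule I R (regular_module R)"
proof -
  have "(regular_module R)\<lparr>carrier := carrier R\<rparr> = regular_module R" by (simp add: regular_module_def)
  then show reg: "module R (regular_module R)" using ideal_module[OF oneideal] by simp
  interpret reg: module R "regular_module R" by (rule reg)
  interpret I: ideal I R by (rule I)
  show "submodule I R (regular_module R)"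
    by (rule reg.smoduleI) (auto simp: regular_module_def I.I_l_closed)
qed

lemma Qm: "module R Q" using module.quot_module_module[OF reg I_smod] .

lemma freeF: "free_module R (F i)" and hometa: "\<eta> \<in> mod_hom R (F 0) Q"
  and eta_onto: "\<eta> ` carrier (F 0) = carrier Q" and homD: "D i \<in> mod_hom R (F (Suc i)) (F i)"
  and ker_eta: "mod_ker (F 0) Q \<eta> = D 0 ` carrier (F 1)"
  and ker_D: "mod_ker (F (Suc i)) (F i) (D i) = D (Suc i) ` carrier (F (Suc (Suc i)))"
  using res unfolding free_resolution_def by auto

lemma Fm: "module R (F i)" using freeF by (simp add: free_module_def)

lemma nF: "noetherian_module R (F i)"
  using Fm noetherian_ring_axioms by (simp add: noetherian_module_def)

lemmas DD = mod_homD[OF Fm Fm homD]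

lemma D_D: "x \<in> carrier (F (Suc (Suc i))) \<Longrightarrow> D i (D (Suc i) x) = \<zero>\<^bsub>F i\<^esub>"
  using ker_D[of i] by (auto simp: mod_ker_def)

lemma in_image_D: "y \<in> carrier (F (Suc i)) \<Longrightarrow> D i y = \<zero>\<^bsub>F i\<^esub> \<Longrightarrow> y \<in> D (Suc i) ` carrier (F (Suc (Suc i)))"
  using ker_D[of i] by (auto simp: mod_ker_def)

text \<open>
  The identity of \<open>F\<close> is homotopic to an endomorphism whose image in each degree lies in a finitely
  generated submodule. In degree \<open>0\<close>, lift \<open>\<eta>\<close> along its restriction to \<open>R y\<close>, where \<open>\<eta> y\<close> generates \<open>R/I\<close>.
\<close>

lemma small_homotopy_0:
  "\<exists>\<theta> h W. \<theta> \<in> mod_hom R (F 0) (F 0) \<and> h \<in> mod_hom R (F 0) (F 1) \<and> fin_gen R (F 0) W \<and>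
    (\<forall>x\<in>carrier (F 0). \<theta> x \<in> W \<and> x = \<theta> x \<oplus>\<^bsub>F 0\<^esub> D 0 (h x))"
proof -
  interpret M: module R "F 0" by (rule Fm)
  interpret reg: module R "regular_module R" by (rule reg)
  interpret Q: module R Q by (rule Qm)
  note e = mod_homD[OF Fm Qm hometa] and q = reg.quot_module_simps[OF I_smod]
  have creg: "carrier (regular_module R) = carrier R" by (simp add: regular_module_def)
  have "I +>\<^bsub>regular_module R\<^esub> \<one> \<in> \<eta> ` carrier (F 0)" unfolding eta_onto q(1) creg by blast
  then obtain y where y: "y \<in> carrier (F 0)" "\<eta> y = I +>\<^bsub>regular_module R\<^esub> \<one>" by auto
  define W where "W = {s \<oplus>\<^bsub>F 0\<^esub> (r \<odot>\<^bsub>F 0\<^esub> y) | s r. s \<in> {\<zero>\<^bsub>F 0\<^esub>} \<and> r \<in> carrier R}"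
  have W: "fin_gen R (F 0) W" unfolding W_def by (rule fin_gen.adjoin[OF fin_gen.zero y(1)])
  have Ws: "submodule W R (F 0)" by (rule M.fin_gen_smod[OF W])
  have "\<eta> x \<in> \<eta> ` W" if x: "x \<in> carrier (F 0)" for x
  proof -
    obtain r where r: "r \<in> carrier R" "\<eta> x = I +>\<^bsub>regular_module R\<^esub> r" using e(1)[OF x] unfolding q(1) creg by blast
    have "\<eta> (r \<odot>\<^bsub>F 0\<^esub> y) = r \<odot>\<^bsub>Q\<^esub> (I +>\<^bsub>regular_module R\<^esub> \<one>)" using e(3) r y by simp
    also have "\<dots> = I +>\<^bsub>regular_module R\<^esub> (r \<odot>\<^bsub>regular_module R\<^esub> \<one>)" by (rule q(4)) (use r creg in auto)
    also have "\<dots> = \<eta> x" using r by (simp add: regular_module_def)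
    finally have "\<eta> x = \<eta> (r \<odot>\<^bsub>F 0\<^esub> y)" by simp
    moreover have "r \<odot>\<^bsub>F 0\<^esub> y \<in> W" using M.smodD(6)[OF Ws r(1)] M.adjoin_smod(3)[OF M.zero_smod y(1)] unfolding W_def by blast
    ultimately show ?thesis by blast
  qed
  then obtain \<theta> where th: "\<theta> \<in> mod_hom R (F 0) (F 0)" "\<And>x. x \<in> carrier (F 0) \<Longrightarrow> \<theta> x \<in> W"
    "\<And>x. x \<in> carrier (F 0) \<Longrightarrow> \<eta> (\<theta> x) = \<eta> x"
    by (rule free_module_lift[OF freeF Fm Qm hometa hometa Ws]) blast+
  note t = mod_homD[OF Fm Fm th(1)]
  have diff: "(\<lambda>x. x \<ominus>\<^bsub>F 0\<^esub> \<theta> x) \<in> mod_hom R (F 0) (F 0)" by (rule mod_hom_diff[OF Fm Fm mod_hom_id th(1)])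
  have "x \<ominus>\<^bsub>F 0\<^esub> \<theta> x \<in> D 0 ` carrier (F 1)" if x: "x \<in> carrier (F 0)" for x
  proof -
    have "\<eta> (x \<ominus>\<^bsub>F 0\<^esub> \<theta> x) = \<zero>\<^bsub>Q\<^esub>" using e(1,6) th(3) x t(1) by (simp add: a_minus_def Q.M.r_neg)
    then show ?thesis using x t(1) ker_eta by (auto simp: mod_ker_def)
  qed
  then obtain h where h: "h \<in> mod_hom R (F 0) (F 1)" "\<And>x. x \<in> carrier (F 0) \<Longrightarrow> D 0 (h x) = x \<ominus>\<^bsub>F 0\<^esub> \<theta> x"
    using free_module_lift[OF freeF Fm Fm diff homD module.carrier_is_submodule[OF Fm]] by (metis One_nat_def)
  have "x = \<theta> x \<oplus>\<^bsub>F 0\<^esub> D 0 (h x)" if "x \<in> carrier (F 0)" for x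
    using h(2)[OF that] that t(1) by (simp add: M.add_diff_cancel)
  then show ?thesis using th h W by blast
qed

text \<open>
  The submodule \<open>W \<inter> D (F (i + 1))\<close> is finitely generated, hence covered by a finitely generated \<open>W'\<close>, and
  \<open>\<theta> D\<close> takes its values there; so \<open>\<theta>'\<close> can be chosen with values in \<open>W'\<close>. The difference of the identity
  and \<open>\<theta>' + h D\<close> takes values in cycles and therefore lifts to \<open>h'\<close>.
\<close>

lemma small_homotopy_Suc:
  assumes th: "\<theta> \<in> mod_hom R (F i) (F i)" and h: "h \<in> mod_hom R (F i) (F (Suc i))" and W: "fin_gen R (F i) W"
    and img: "\<And>x. x \<in> carrier (F i) \<Longrightarrow> \<theta> x \<in> W"
    and eq: "\<And>y. y \<in> D i ` carrier (F (Suc i)) \<Longrightarrow> y = \<theta> y \<oplus>\<^bsub>F i\<^esub> D i (h y)"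
  shows "\<exists>\<theta>' h' W'. \<theta>' \<in> mod_hom R (F (Suc i)) (F (Suc i)) \<and> h' \<in> mod_hom R (F (Suc i)) (F (Suc (Suc i))) \<and>
    fin_gen R (F (Suc i)) W' \<and> (\<forall>x\<in>carrier (F (Suc i)). \<theta>' x \<in> W' \<and>
      x = (\<theta>' x \<oplus>\<^bsub>F (Suc i)\<^esub> D (Suc i) (h' x)) \<oplus>\<^bsub>F (Suc i)\<^esub> h (D i x))"
proof -
  interpret M: noetherian_module R "F i" by (rule nF)
  interpret N: module R "F (Suc i)" by (rule Fm)
  note t = mod_homD[OF Fm Fm th] and hD = mod_homD[OF Fm Fm h]
  have imD: "submodule (D i ` carrier (F (Suc i))) R (F i)" by (rule image_submodule[OF Fm Fm homD N.carrier_is_submodule])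
  have Ws: "submodule W R (F i)" by (rule M.fin_gen_smod[OF W])
  note WD = M.smodD[OF Ws] and iD = M.smodD[OF imD]
  have "submodule (W \<inter> D i ` carrier (F (Suc i))) R (F i)"
    by (rule M.smoduleI) (use WD iD in auto)
  then have "fin_gen R (F i) (W \<inter> D i ` carrier (F (Suc i)))" by (rule M.submodule_of_fin_gen[OF W]) blast
  then obtain W' where W': "fin_gen R (F (Suc i)) W'" "W \<inter> D i ` carrier (F (Suc i)) \<subseteq> D i ` W'"
    using fin_gen_preimage[OF Fm Fm homD, of i] by blast
  have W's: "submodule W' R (F (Suc i))" by (rule N.fin_gen_smod[OF W'(1)])
  have thD: "(\<lambda>x. \<theta> (D i x)) \<in> mod_hom R (F (Suc i)) (F i)" by (rule mod_hom_comp[OF th homD])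
  have "\<theta> (D i x) \<in> D i ` W'" if x: "x \<in> carrier (F (Suc i))" for x
  proof -
    have y: "D i x \<in> D i ` carrier (F (Suc i))" using x by blast
    have c: "D i x \<in> carrier (F i)" using DD(1) x by blast
    have hc: "h (D i x) \<in> carrier (F (Suc i))" using hD(1) c by blast
    have "\<theta> (D i x) \<in> D i ` carrier (F (Suc i))"
    proof (rule M.smod_cancel[OF imD])
      show "D i (h (D i x)) \<in> D i ` carrier (F (Suc i))" using hc by blast
      show "\<theta> (D i x) \<in> carrier (F i)" using t(1) c by blast
      show "D i (h (D i x)) \<oplus>\<^bsub>F i\<^esub> \<theta> (D i x) \<in> D i ` carrier (F (Suc i)) \<or> \<theta> (D i x) \<oplus>\<^bsub>F i\<^esub> D i (h (D i x)) \<in> D i ` carrier (F (Suc i))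
         \<or> \<theta> (D i x) \<ominus>\<^bsub>F i\<^esub> D i (h (D i x)) \<in> D i ` carrier (F (Suc i))"
        using eq[OF y] y by simp
    qed
    then show ?thesis using img[OF c] W'(2) by blast
  qed
  then obtain \<theta>' where th': "\<theta>' \<in> mod_hom R (F (Suc i)) (F (Suc i))" "\<And>x. x \<in> carrier (F (Suc i)) \<Longrightarrow> \<theta>' x \<in> W'"
    "\<And>x. x \<in> carrier (F (Suc i)) \<Longrightarrow> D i (\<theta>' x) = \<theta> (D i x)"
    by (rule free_module_lift[OF freeF Fm Fm thD homD W's]) blast+
  note t' = mod_homD[OF Fm Fm th'(1)]
  have hDi: "(\<lambda>x. h (D i x)) \<in> mod_hom R (F (Suc i)) (F (Suc i))" by (rule mod_hom_comp[OF h homD])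
  define f where "f = (\<lambda>x. (x \<ominus>\<^bsub>F (Suc i)\<^esub> \<theta>' x) \<ominus>\<^bsub>F (Suc i)\<^esub> h (D i x))"
  have f: "f \<in> mod_hom R (F (Suc i)) (F (Suc i))"
    unfolding f_def by (rule mod_hom_diff[OF Fm Fm mod_hom_diff[OF Fm Fm mod_hom_id th'(1)] hDi])
  have "f x \<in> D (Suc i) ` carrier (F (Suc (Suc i)))" if x: "x \<in> carrier (F (Suc i))" for x
  proof (rule in_image_D)
    have c: "D i x \<in> carrier (F i)" "h (D i x) \<in> carrier (F (Suc i))" "\<theta>' x \<in> carrier (F (Suc i))"
      using DD(1) hD(1) t'(1) x by auto
    show "f x \<in> carrier (F (Suc i))" using mod_homD(1)[OF Fm Fm f] x .
    have y: "D i x \<in> D i ` carrier (F (Suc i))" using x by blast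
    have "D i (f x) = (D i x \<ominus>\<^bsub>F i\<^esub> \<theta> (D i x)) \<ominus>\<^bsub>F i\<^esub> D i (h (D i x))"
      using x c DD(6) th'(3) by (simp add: f_def)
    also have "D i x \<ominus>\<^bsub>F i\<^esub> \<theta> (D i x) = D i (h (D i x))"
      using eq[OF y] c t(1) DD(1) M.add_diff_cancel(3)[of "D i (h (D i x))" "\<theta> (D i x)"] by simp
    also have "\<dots> \<ominus>\<^bsub>F i\<^esub> D i (h (D i x)) = \<zero>\<^bsub>F i\<^esub>" using c DD(1) by (simp add: a_minus_def M.M.r_neg)
    finally show "D i (f x) = \<zero>\<^bsub>F i\<^esub>" .
  qed
  then obtain h' where h': "h' \<in> mod_hom R (F (Suc i)) (F (Suc (Suc i)))"
    "\<And>x. x \<in> carrier (F (Suc i)) \<Longrightarrow> D (Suc i) (h' x) = f x"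
    using free_module_lift[OF freeF Fm Fm f homD module.carrier_is_submodule[OF Fm]] by metis
  have "x = (\<theta>' x \<oplus>\<^bsub>F (Suc i)\<^esub> D (Suc i) (h' x)) \<oplus>\<^bsub>F (Suc i)\<^esub> h (D i x)" if x: "x \<in> carrier (F (Suc i))" for x
  proof -
    have c: "h (D i x) \<in> carrier (F (Suc i))" "\<theta>' x \<in> carrier (F (Suc i))" "x \<ominus>\<^bsub>F (Suc i)\<^esub> \<theta>' x \<in> carrier (F (Suc i))"
      using DD(1) hD(1) t'(1) x by auto
    have "\<theta>' x \<oplus>\<^bsub>F (Suc i)\<^esub> (f x \<oplus>\<^bsub>F (Suc i)\<^esub> h (D i x)) = x"
      unfolding f_def using c x by (simp add: N.add_diff_cancel)
    then show ?thesis unfolding h'(2)[OF x] using c x mod_homD(1)[OF Fm Fm f] by (simp add: N.M.a_assoc)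
  qed
  then show ?thesis using th' h' W'(1) by blast
qed

lemma small_homotopy:
  "\<exists>\<theta> h W. \<theta> \<in> mod_hom R (F i) (F i) \<and> h \<in> mod_hom R (F i) (F (Suc i)) \<and> fin_gen R (F i) W \<and>
    (\<forall>x\<in>carrier (F i). \<theta> x \<in> W) \<and> (\<forall>y\<in>D i ` carrier (F (Suc i)). y = \<theta> y \<oplus>\<^bsub>F i\<^esub> D i (h y))"
proof (induction i)
  case 0
  obtain \<theta> h W where *: "\<theta> \<in> mod_hom R (F 0) (F 0)" "h \<in> mod_hom R (F 0) (F 1)" "fin_gen R (F 0) W"
    "\<forall>x\<in>carrier (F 0). \<theta> x \<in> W \<and> x = \<theta> x \<oplus>\<^bsub>F 0\<^esub> D 0 (h x)"
    using small_homotopy_0 by blast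
  have "\<forall>y\<in>D 0 ` carrier (F (Suc 0)). y = \<theta> y \<oplus>\<^bsub>F 0\<^esub> D 0 (h y)" using *(4) DD(1) by blast
  then show ?case using * by (metis One_nat_def)
next
  case (Suc i)
  then obtain \<theta> h W where *: "\<theta> \<in> mod_hom R (F i) (F i)" "h \<in> mod_hom R (F i) (F (Suc i))" "fin_gen R (F i) W"
    "\<forall>x\<in>carrier (F i). \<theta> x \<in> W" "\<forall>y\<in>D i ` carrier (F (Suc i)). y = \<theta> y \<oplus>\<^bsub>F i\<^esub> D i (h y)" by blast
  obtain \<theta>' h' W' where **: "\<theta>' \<in> mod_hom R (F (Suc i)) (F (Suc i))" "h' \<in> mod_hom R (F (Suc i)) (F (Suc (Suc i)))"
    "fin_gen R (F (Suc i)) W'" "\<forall>x\<in>carrier (F (Suc i)). \<theta>' x \<in> W' \<and>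
      x = (\<theta>' x \<oplus>\<^bsub>F (Suc i)\<^esub> D (Suc i) (h' x)) \<oplus>\<^bsub>F (Suc i)\<^esub> h (D i x)"
    using small_homotopy_Suc[OF *(1-3)] *(4,5) by blast
  interpret N: module R "F (Suc i)" by (rule Fm)
  have "y = \<theta>' y \<oplus>\<^bsub>F (Suc i)\<^esub> D (Suc i) (h' y)" if y: "y \<in> D (Suc i) ` carrier (F (Suc (Suc i)))" for y
  proof -
    have yc: "y \<in> carrier (F (Suc i))" "D i y = \<zero>\<^bsub>F i\<^esub>" using y DD(1) D_D by auto
    have "\<theta>' y \<oplus>\<^bsub>F (Suc i)\<^esub> D (Suc i) (h' y) \<in> carrier (F (Suc i))"
      using yc DD(1) mod_homD(1)[OF Fm Fm **(1)] mod_homD(1)[OF Fm Fm **(2)] by simp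
    then show ?thesis using bspec[OF **(4) yc(1)] yc(2) mod_homD(4)[OF Fm Fm *(2)] by simp
  qed
  then show ?case using **(1-3) **(4) by blast
qed

abbreviation "Hm H j \<equiv> Hom_module R (F j) H"
abbreviation "dd j f \<equiv> compose (carrier (F (Suc j))) f (D j)"

context
  fixes H :: "('a, 'w, 'g) module_scheme"
  assumes H: "module R H"
begin

lemma HomF: "module R (Hm H j)" by (rule Hom_module_module[OF Fm H])

lemma hom_dd: "(\<lambda>f. dd j f) \<in> mod_hom R (Hm H j) (Hm H (Suc j))"
proof -
  interpret H: module R H by (rule H)
  have "dd j f \<in> carrier (Hm H (Suc j))" if f: "f \<in> carrier (Hm H j)" for f
  proof -
    have "dd j f = restrict (\<lambda>x. f (D j x)) (carrier (F (Suc j)))" by (auto simp: compose_def)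
    moreover have fh: "f \<in> mod_hom R (F j) H" using f by (simp add: Hom_module_simps)
    ultimately show ?thesis
      using mod_hom_restrict[OF Fm mod_hom_comp[OF fh homD]] by (simp add: Hom_module_simps)
  qed
  then show ?thesis
    using DD(1) by (auto simp: mod_hom_def[of R "Hm H j"] Hom_module_simps(3,4) compose_def intro!: restrict_ext)
qed

lemma Ext_subquotient:
  defines "K i \<equiv> {f \<in> carrier (Hm H i). dd i f = \<zero>\<^bsub>Hm H (Suc i)\<^esub>}"
    and "L i \<equiv> (case i of 0 \<Rightarrow> {\<zero>\<^bsub>Hm H 0\<^esub>} | Suc j \<Rightarrow> (\<lambda>f. dd j f) ` carrier (Hm H j))"
  shows "module R (Ext R F D H i)" "Supp R (Ext R F D H i) = Supp_subq R (Hm H i) (K i) (L i)"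
proof -
  interpret HH: module R "Hm H i" by (rule HomF)
  interpret HS: module R "Hm H (Suc i)" by (rule HomF)
  interpret H: module R H by (rule H)
  note hd = mod_homD[OF HomF HomF hom_dd]
  have "submodule {f \<in> carrier (Hm H i). dd i f \<in> {\<zero>\<^bsub>Hm H (Suc i)\<^esub>}} R (Hm H i)"
    by (rule preimage_submodule[OF HomF HomF hom_dd HS.zero_smod])
  then have Ks: "submodule (K i) R (Hm H i)" by (simp add: K_def)
  have Ls: "submodule (L i) R (Hm H i) \<and> L i \<subseteq> K i"
  proof (cases i)
    case 0
    then show ?thesis using HH.zero_smod HH.M.zero_closed hd(4) by (simp add: L_def K_def)
  next
    case (Suc j)
    have "submodule ((\<lambda>f. dd j f) ` carrier (Hm H j)) R (Hm H (Suc j))"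
      by (rule image_submodule[OF HomF HomF hom_dd module.carrier_is_submodule[OF HomF]])
    moreover have "dd (Suc j) (dd j f) = \<zero>\<^bsub>Hm H (Suc (Suc j))\<^esub>" if f: "f \<in> carrier (Hm H j)" for f
    proof -
      have "f \<zero>\<^bsub>F j\<^esub> = \<zero>\<^bsub>H\<^esub>" using f mod_homD(4)[OF Fm H] by (auto simp: Hom_module_simps)
      then show ?thesis using D_D DD(1) by (auto simp: Hom_module_simps compose_def intro!: restrict_ext)
    qed
    ultimately show ?thesis using Suc hd(1) by (auto simp: L_def K_def)
  qed
  have eq: "Ext R F D H i = quot_module ((Hm H i)\<lparr>carrier := K i\<rparr>) (L i)"
    unfolding Ext_def cohomology_def by (auto simp: mod_ker_def coboundaries_def K_def L_def cong: nat.case_cong)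
  show "module R (Ext R F D H i)" "Supp R (Ext R F D H i) = Supp_subq R (Hm H i) (K i) (L i)"
    unfolding eq using subquotient[OF HomF Ks] Ls by auto
qed

text \<open>
  Let \<open>P\<close> be outside the support of \<open>H\<close>. A cocycle \<open>f\<close> differs from \<open>f \<theta>\<close> by a coboundary, because \<open>f\<close>
  vanishes on the image of \<open>D\<close>, and \<open>f \<theta>\<close> is killed by some \<open>s\<close> outside \<open>P\<close>, because \<open>\<theta>\<close> has values in a
  finitely generated submodule. Hence \<open>s f\<close> is a coboundary.
\<close>

lemma Supp_Ext: "Supp R (Ext R F D H i) \<subseteq> Supp R H"
proof
  interpret H: module R H by (rule H)
  fix P assume P: "P \<in> Supp R (Ext R F D H i)"
  show "P \<in> Supp R H"
  proof (rule ccontr)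
    assume PH: "P \<notin> Supp R H"
    have Pp: "primeideal P R" using P by (simp add: Supp_def Spec_def)
    obtain f where f: "f \<in> carrier (Hm H i)" "dd i f = \<zero>\<^bsub>Hm H (Suc i)\<^esub>"
      and not: "\<forall>s\<in>carrier R - P. s \<odot>\<^bsub>Hm H i\<^esub> f \<notin> (case i of 0 \<Rightarrow> {\<zero>\<^bsub>Hm H 0\<^esub>} | Suc j \<Rightarrow> (\<lambda>f. dd j f) ` carrier (Hm H j))"
      using P unfolding Ext_subquotient(2) Supp_subq_def by blast
    have fh: "f \<in> mod_hom R (F i) H" using f by (simp add: Hom_module_simps)
    note fD = mod_homD[OF Fm H fh]
    have f0: "f (D i x) = \<zero>\<^bsub>H\<^esub>" if "x \<in> carrier (F (Suc i))" for x
      using fun_cong[OF f(2), of x] that by (simp add: compose_def Hom_module_simps)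
    show False
    proof (cases i)
      case 0
      obtain \<theta> h W where *: "\<theta> \<in> mod_hom R (F 0) (F 0)" "h \<in> mod_hom R (F 0) (F 1)" "fin_gen R (F 0) W"
        "\<forall>x\<in>carrier (F 0). \<theta> x \<in> W \<and> x = \<theta> x \<oplus>\<^bsub>F 0\<^esub> D 0 (h x)"
        using small_homotopy_0 by blast
      obtain s where s: "s \<in> carrier R - P" "\<forall>w\<in>W. s \<odot>\<^bsub>H\<^esub> f w = \<zero>\<^bsub>H\<^esub>"
        using fin_gen_killed[OF Fm H fh Pp PH] *(3) 0 by blast
      have "s \<odot>\<^bsub>H\<^esub> f x = \<zero>\<^bsub>H\<^esub>" if x: "x \<in> carrier (F 0)" for x
      proof -
        have c: "\<theta> x \<in> carrier (F 0)" "h x \<in> carrier (F (Suc 0))"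
          using mod_homD(1)[OF Fm Fm *(1) x] mod_homD(1)[OF Fm Fm *(2) x] by auto
        have "f (\<theta> x \<oplus>\<^bsub>F 0\<^esub> D 0 (h x)) = f (\<theta> x)" using fD(1,2) c DD(1) f0 0 by simp
        then have "f x = f (\<theta> x)" using *(4) x by simp
        then show ?thesis using s(2) *(4) x by simp
      qed
      then have "s \<odot>\<^bsub>Hm H i\<^esub> f = \<zero>\<^bsub>Hm H 0\<^esub>" using 0 by (auto simp: Hom_module_simps intro!: restrict_ext)
      then show False using not s(1) 0 by simp
    next
      case (Suc j)
      obtain \<theta> h W where *: "\<theta> \<in> mod_hom R (F j) (F j)" "h \<in> mod_hom R (F j) (F (Suc j))" "fin_gen R (F j) W"
        "\<forall>x\<in>carrier (F j). \<theta> x \<in> W" "\<forall>y\<in>D j ` carrier (F (Suc j)). y = \<theta> y \<oplus>\<^bsub>F j\<^esub> D j (h y)"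
        using small_homotopy by blast
      obtain \<theta>' h' W' where **: "\<theta>' \<in> mod_hom R (F (Suc j)) (F (Suc j))" "h' \<in> mod_hom R (F (Suc j)) (F (Suc (Suc j)))"
        "fin_gen R (F (Suc j)) W'" "\<forall>x\<in>carrier (F (Suc j)). \<theta>' x \<in> W' \<and>
          x = (\<theta>' x \<oplus>\<^bsub>F (Suc j)\<^esub> D (Suc j) (h' x)) \<oplus>\<^bsub>F (Suc j)\<^esub> h (D j x)"
        using small_homotopy_Suc[OF *(1-3)] *(4,5) by blast
      obtain s where s: "s \<in> carrier R - P" "\<forall>w\<in>W'. s \<odot>\<^bsub>H\<^esub> f w = \<zero>\<^bsub>H\<^esub>"
        using fin_gen_killed[OF Fm H fh Pp PH] **(3) Suc by blast
      define g where "g = restrict (\<lambda>y. s \<odot>\<^bsub>H\<^esub> f (h y)) (carrier (F j))"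
      have fh': "f \<in> mod_hom R (F (Suc j)) H" using fh Suc by simp
      have g: "g \<in> carrier (Hm H j)"
        unfolding g_def Hom_module_simps
        using mod_hom_restrict[OF Fm mod_hom_smult[OF Fm H mod_hom_comp[OF fh' *(2)]]] s(1) by simp
      have "s \<odot>\<^bsub>H\<^esub> f x = g (D j x)" if x: "x \<in> carrier (F (Suc j))" for x
      proof -
        interpret N: module R "F (Suc j)" by (rule Fm)
        have c: "\<theta>' x \<in> carrier (F (Suc j))" "h' x \<in> carrier (F (Suc (Suc j)))" "D j x \<in> carrier (F j)" "h (D j x) \<in> carrier (F (Suc j))"
          using mod_homD(1)[OF Fm Fm **(1) x] mod_homD(1)[OF Fm Fm **(2) x] DD(1)[OF x] mod_homD(1)[OF Fm Fm *(2)] by auto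
        have "f ((\<theta>' x \<oplus>\<^bsub>F (Suc j)\<^esub> D (Suc j) (h' x)) \<oplus>\<^bsub>F (Suc j)\<^esub> h (D j x)) = f (\<theta>' x) \<oplus>\<^bsub>H\<^esub> f (h (D j x))"
          using fD(1,2) c DD(1) f0 Suc by simp
        then have "f x = f (\<theta>' x) \<oplus>\<^bsub>H\<^esub> f (h (D j x))" using **(4) x by metis
        then have "s \<odot>\<^bsub>H\<^esub> f x = (s \<odot>\<^bsub>H\<^esub> f (\<theta>' x)) \<oplus>\<^bsub>H\<^esub> (s \<odot>\<^bsub>H\<^esub> f (h (D j x)))"
          using s(1) c fD(1) Suc by (simp add: H.smult_r_distr)
        then show ?thesis using s **(4) x c fD(1) Suc by (simp add: g_def)
      qed
      then have "s \<odot>\<^bsub>Hm H i\<^esub> f = dd j g" using Suc by (auto simp: Hom_module_simps compose_def intro!: restrict_ext)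
      then show False using not s(1) g Suc by auto
    qed
  qed
qed

end

end

lemma finite_Supp_imp_weakly_cofinite:
  assumes "cring R" "noetherian_ring R" "ideal I R" and H: "module R H" and fin: "finite (Supp R H)" and "Supp R H \<subseteq> V_set R I"
  shows "weakly_cofinite R I H"
  unfolding weakly_cofinite_def
proof (intro conjI allI impI assms(6) H)
  fix F :: "nat \<Rightarrow> ('a, nat \<Rightarrow> 'a) module" and D \<eta> i
  assume res: "free_resolution R (quot_module (regular_module R) I) F D \<eta>"
  interpret noetherian_free_resolution R I F D \<eta>
    using assms(1-3) res by (intro noetherian_free_resolution.intro noetherian_free_resolution_axioms.intro)
  show "weakly_Laskerian R (Ext R F D H i)"
    by (rule finite_Supp_imp_weakly_Laskerian[OF Ext_subquotient(1)[OF H] finite_subset[OF Supp_Ext[OF H] fin]])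
qed

theorem proposition3p29:
  fixes R :: "('r, 'b) ring_scheme"
    and I :: "'r set"
    and N :: "('r, 'm, 'c) module_scheme"
    and E :: "nat \<Rightarrow> ('r, 'e) module"
    and \<delta> :: "nat \<Rightarrow> 'e \<Rightarrow> 'e"
    and \<epsilon> :: "'m \<Rightarrow> 'e"
    and d :: nat
  assumes "cring R" and "noetherian_ring R"
    and "ideal I R" and "I \<noteq> carrier R"
    and "weakly_Laskerian R N"
    and "module_dim R N = ereal (real d)"
    and "injective_resolution R N E \<delta> \<epsilon>"
  shows "finite (Supp R (local_cohomology R I E \<delta> d))
    \<and> weakly_Laskerian R (local_cohomology R I E \<delta> d)
    \<and> weakly_cofinite R I (local_cohomology R I E \<delta> d)"
proof -
  interpret wl_resolution R I E \<delta> N \<epsilon>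
    using assms injective_resolution_complex[OF assms(7)]
    by (intro wl_resolution.intro wl_resolution_axioms.intro torsion_complex.intro torsion_complex_axioms.intro)
  have fin: "finite (Supp R (local_cohomology R I E \<delta> d))"
    by (rule finite_Supp_local_cohomology[OF no_chain_of_module_dim[OF assms(6)]])
  then show ?thesis
    using finite_Supp_imp_weakly_Laskerian[OF local_cohomology(1) fin]
      finite_Supp_imp_weakly_cofinite[OF assms(1-3) local_cohomology(1) fin Supp_local_cohomology_V] by blast
qed

end
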